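(* Let $H$ be a GHA$_S(m,n;\mathbf h,\mathbf k)$ over a group $G$, with a compatible ordering $(\omega_r,\omega_c)$. Then there exists a biembedding of the circuit decompositions $\mathcal C_+(\omega_r)$ and $\mathcal C_-(\omega_c^-)$ of $Cay(G;S)$ over an orientable surface.
   Context: $G$ is an additively written group, not necessarily abelian, in which the elements whose period is used below have finite period, with a fixed map $\|\cdot\|:G\to G$ satisfying $\|a\|=\|-a\|\in\{a,-a\}$; $G^+=\{\|a\|:a\in G,a\neq0\}$. For $S\subseteq G^+$, $\mathbf h=(h_1,\dots,h_m)$, $\mathbf k=(k_1,\dots,k_n)$ with $1\le h_i\le n$, $1\le k_j\le m$, a GHA$_S(m,n;\mathbf h,\mathbf k)$ over $G$ (multiplicity 1) is an $m\times n$ matrix $H$ over $G$ such that, as multisets, two copies of the multiset $\|\mathcal E(H)\|$ of absolute values of the nonzero entries of $H$ equal two copies of $S\setminus I(S)$ together with one copy of $I(S)$, where $I(S)$ is the set of elements of order 2 in $S$ (hence $I(S)=\varnothing$ and each element of $S$ occurs exactly once in $\|\mathcal E(H)\|$); moreover the $i$-th row (resp. $j$-th column) of $H$ has exactly $h_i$ (resp. $k_j$) nonzero entries. $\mathcal E(H)$ denotes the (multi)set of nonzero entries. An ordering $(\omega_r,\omega_c)$ of $H$ consists of $\omega_r=(\omega_{r,1},\dots,\omega_{r,m})$, $\omega_c=(\omega_{c,1},\dots,\omega_{c,n})$, where $\omega_{r,i}$ (resp. $\omega_{c,j}$) is a sequence listing the nonzero entries of the $i$-th row (resp. $j$-th column).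 Each such sequence $(a_1,\dots,a_k)$ is also viewed as the cyclic permutation $a_1\mapsto a_2\mapsto\cdots\mapsto a_k\mapsto a_1$, and $\omega_r=\omega_{r,1}\cdots\omega_{r,m}$, $\omega_c=\omega_{c,1}\cdots\omega_{c,n}$ are viewed as permutations of $\mathcal E(H)$. The ordering is compatible if $\omega_c\omega_r$ is a cyclic permutation of $\mathcal E(H)$ of length $|\mathcal E(H)|$. $\omega_c^-=(\omega_{c,1}^-,\dots,\omega_{c,n}^-)$, where $\omega^-$ is the reverse of the sequence $\omega$. For a sequence $\omega=(g_1,\dots,g_k)$ of nonzero elements, put $s_i(\omega)=g_1+\cdots+g_i$, $s_i^-(\omega)=g_{k-i+1}+\cdots+g_k$, and define the walks $W_+(\omega)=(0,-s_1(\omega),\ldots,-s_k(\omega))$, $W_-(\omega)=(0,s_1^-(\omega),\ldots,s_k^-(\omega))$; $W_x(\omega)^*$ is the undirected version of $W_x(\omega)$, and $\Gamma+g$ replaces each vertex $y$ of $\Gamma$ by $y+g$. For $x\in\{+,-\}$ let $g$ be the last vertex of $W_x(\omega)$ (so $0$ and $g$ are its end vertices), $p(g)$ the period of $g$ (least positive integer with $p(g)g=0$), and $T\subseteq G$ a complete set of representatives such that every element of $G$ is uniquely $ig+t$ with $1\le i\le p(g)$, $t\in T$. Then $C_x(\omega)=\bigcup_{i=1}^{p(g)}(W_x(\omega)^*+ig)$ is the closed walk (circuit) obtained by joining these translates, and $\mathcal C_x(\omega)=\{C_x(\omega)+t:t\in T\}$. Put $\mathcal C_x(\omega_r)=\bigcup_{i=1}^m\mathcal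 C_x(\omega_{r,i})$ and $\mathcal C_x(\omega_c^-)=\bigcup_{j=1}^n\mathcal C_x(\omega_{c,j}^-)$. These are decompositions of $Cay(G;S)$ into circuits, where $Cay(G;S)$ is the simple undirected graph with vertex set $G$ and edges $\{y,d+y\}$, $y\in G$, $d\in S$. An embedding of a graph $\Gamma$ (viewed as a simplicial 1-complex with the usual topology) in a surface $\Sigma$ is a continuous injective map $\phi:\Gamma\to\Sigma$; $\Gamma$ and $\Sigma$ need not be connected. The faces are the connected components of $\Sigma\setminus\phi(\Gamma)$. Given two circuit decompositions $\mathcal C,\mathcal C'$ of a simple graph $\Gamma$, an embedding $\phi$ is a biembedding of $\mathcal C$ and $\mathcal C'$ if it is face 2-colorable (faces sharing an edge get different colors) and the sets of face boundaries of the two color classes are $\phi(\mathcal C)$ and $\phi(\mathcal C')$, respectively. *)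

theory Defs
  imports
    "HOL-Complex_Analysis.Complex_Analysis"
    "HOL-Combinatorics.Combinatorics"
    "HOL-Library.Multiset"
begin

section \<open>Generalized Heffter arrays and their orderings\<close>

text \<open>The group is the type of sort group_add: additively written, not necessarily abelian.
  Rows and columns are indexed by i < m and j < n.\<close>

definition absolute_value :: "('g::group_add \<Rightarrow> 'g) \<Rightarrow> bool" where
  "absolute_value nrm \<longleftrightarrow> (\<forall>a. nrm a = nrm (- a) \<and> nrm a \<in> {a, - a})"

definition positive_part :: "('g::group_add \<Rightarrow> 'g) \<Rightarrow> 'g set" where
  "positive_part nrm = {nrm a | a. a \<noteq> 0}"

definition involutions :: "'g::group_add set \<Rightarrow> 'g set" where
  "involutions S = {x \<in> S. x \<noteq> 0 \<and> x + x = 0}"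

definition row_entries :: "nat \<Rightarrow> (nat \<Rightarrow> nat \<Rightarrow> 'g::group_add) \<Rightarrow> nat \<Rightarrow> 'g multiset" where
  "row_entries n H i = image_mset (\<lambda>j. H i j) (mset_set {j. j < n \<and> H i j \<noteq> 0})"

definition col_entries :: "nat \<Rightarrow> (nat \<Rightarrow> nat \<Rightarrow> 'g::group_add) \<Rightarrow> nat \<Rightarrow> 'g multiset" where
  "col_entries m H j = image_mset (\<lambda>i. H i j) (mset_set {i. i < m \<and> H i j \<noteq> 0})"

definition entries :: "nat \<Rightarrow> nat \<Rightarrow> (nat \<Rightarrow> nat \<Rightarrow> 'g::group_add) \<Rightarrow> 'g multiset" where
  "entries m n H =
     image_mset (\<lambda>(i, j). H i j) (mset_set {(i, j). i < m \<and> j < n \<and> H i j \<noteq> 0})"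

text \<open>Finiteness of S is implied by the informal multiset equation; it is stated because mset_set
  is empty on infinite sets.\<close>

definition GHA ::
  "('g::group_add \<Rightarrow> 'g) \<Rightarrow> 'g set \<Rightarrow> nat \<Rightarrow> nat \<Rightarrow> (nat \<Rightarrow> nat) \<Rightarrow> (nat \<Rightarrow> nat)
     \<Rightarrow> (nat \<Rightarrow> nat \<Rightarrow> 'g) \<Rightarrow> bool" where
  "GHA nrm S m n h k H \<longleftrightarrow>
     1 \<le> m \<and> 1 \<le> n \<and>
     S \<subseteq> positive_part nrm \<and> finite S \<and>
     (\<forall>i<m. 1 \<le> h i \<and> h i \<le> n) \<and> (\<forall>j<n. 1 \<le> k j \<and> k j \<le> m) \<and>
     repeat_mset 2 (image_mset nrm (entries m n H)) =
       repeat_mset 2 (mset_set (S - involutions S)) + mset_set (involutions S) \<and>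
     (\<forall>i<m. size (row_entries n H i) = h i) \<and>
     (\<forall>j<n. size (col_entries m H j) = k j)"

definition GHA_ordering ::
  "nat \<Rightarrow> nat \<Rightarrow> (nat \<Rightarrow> nat \<Rightarrow> 'g::group_add) \<Rightarrow> (nat \<Rightarrow> 'g list) \<Rightarrow> (nat \<Rightarrow> 'g list) \<Rightarrow> bool"
  where
  "GHA_ordering m n H \<omega>r \<omega>c \<longleftrightarrow>
     (\<forall>i<m. mset (\<omega>r i) = row_entries n H i) \<and> (\<forall>j<n. mset (\<omega>c j) = col_entries m H j)"

definition ordering_perm :: "nat \<Rightarrow> (nat \<Rightarrow> 'g list) \<Rightarrow> 'g \<Rightarrow> 'g" where
  "ordering_perm l \<omega> = foldr (\<circ>) (map (\<lambda>i. cycle_of_list (\<omega> i)) [0..<l]) id"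

definition compatible_ordering ::
  "nat \<Rightarrow> nat \<Rightarrow> (nat \<Rightarrow> nat \<Rightarrow> 'g::group_add) \<Rightarrow> (nat \<Rightarrow> 'g list) \<Rightarrow> (nat \<Rightarrow> 'g list) \<Rightarrow> bool"
  where
  "compatible_ordering m n H \<omega>r \<omega>c \<longleftrightarrow>
     GHA_ordering m n H \<omega>r \<omega>c \<and>
     cyclic_on (ordering_perm n \<omega>c \<circ> ordering_perm m \<omega>r) (set_mset (entries m n H))"

section \<open>Walks and circuits\<close>

definition nat_mult :: "nat \<Rightarrow> 'g::group_add \<Rightarrow> 'g" where
  "nat_mult i g = sum_list (replicate i g)"

definition finite_period :: "'g::group_add \<Rightarrow> bool" where
  "finite_period g \<longleftrightarrow> (\<exists>p>0. nat_mult p g = 0)"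

definition period :: "'g::group_add \<Rightarrow> nat" where
  "period g = (LEAST p. 0 < p \<and> nat_mult p g = 0)"

definition walk_plus :: "'g::group_add list \<Rightarrow> 'g list" where
  "walk_plus \<omega> = map (\<lambda>i. - sum_list (take i \<omega>)) [0..<Suc (length \<omega>)]"

definition walk_minus :: "'g::group_add list \<Rightarrow> 'g list" where
  "walk_minus \<omega> = map (\<lambda>i. sum_list (drop (length \<omega> - i) \<omega>)) [0..<Suc (length \<omega>)]"

text \<open>A circuit is given by the list of its vertices in cyclic order: the walk goes from w ! j to
  w ! (j + 1), indices modulo length w. For a walk W from 0 to g, the last vertex of W + ig is the
  first vertex of W + (i + 1)g, hence the butlast.\<close>

definition circuit_of_walk :: "'g::group_add list \<Rightarrow> 'g list" where
  "circuit_of_walk W =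
     concat (map (\<lambda>i. map (\<lambda>y. y + nat_mult i (last W)) (butlast W)) [1..<Suc (period (last W))])"

definition representatives :: "'g::group_add \<Rightarrow> 'g set \<Rightarrow> bool" where
  "representatives g T \<longleftrightarrow>
     (\<forall>y. \<exists>!(i, t). 1 \<le> i \<and> i \<le> period g \<and> t \<in> T \<and> y = nat_mult i g + t)"

definition circuit_translates :: "'g::group_add list \<Rightarrow> 'g set \<Rightarrow> 'g list set" where
  "circuit_translates W T = {map (\<lambda>y. y + t) (circuit_of_walk W) | t. t \<in> T}"

definition cayley_edges :: "'g::group_add set \<Rightarrow> 'g set set" where
  "cayley_edges S = {{y, d + y} | y d. d \<in> S}"

definition circuit_decomposition :: "'v set set \<Rightarrow> 'v list set \<Rightarrow> bool" where
  "circuit_decomposition E C \<longleftrightarrow>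
     (\<forall>w\<in>C. w \<noteq> [] \<and> (\<forall>j<length w. {w ! j, w ! (Suc j mod length w)} \<in> E)) \<and>
     (\<forall>e\<in>E. \<exists>!(w, j). w \<in> C \<and> j < length w \<and> e = {w ! j, w ! (Suc j mod length w)})"

section \<open>Topological realization of a graph\<close>

text \<open>Points are functions of barycentric coordinates.\<close>

definition vertex_point :: "'v \<Rightarrow> 'v \<Rightarrow> real" where
  "vertex_point v = (\<lambda>x. of_bool (x = v))"

definition edge_point :: "'v \<Rightarrow> 'v \<Rightarrow> real \<Rightarrow> 'v \<Rightarrow> real" where
  "edge_point u v t = (\<lambda>x. (1 - t) * vertex_point u x + t * vertex_point v x)"

definition realization :: "'v set \<Rightarrow> 'v set set \<Rightarrow> ('v \<Rightarrow> real) set" where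
  "realization V E = vertex_point ` V \<union> {edge_point u v t | u v t. {u, v} \<in> E \<and> t \<in> {0..1}}"

text \<open>The weak topology with respect to the closed edges.\<close>

definition graph_topology :: "'v set \<Rightarrow> 'v set set \<Rightarrow> ('v \<Rightarrow> real) topology" where
  "graph_topology V E = topology (\<lambda>U. U \<subseteq> realization V E \<and>
     (\<forall>u v. {u, v} \<in> E \<longrightarrow>
        openin (top_of_set {0..1}) {t \<in> {0..1}. edge_point u v t \<in> U}))"

lemma openin_graph_topology:
  "openin (graph_topology V E) U \<longleftrightarrow> U \<subseteq> realization V E \<and>
     (\<forall>u v. {u, v} \<in> E \<longrightarrow>
        openin (top_of_set {0..1}) {t \<in> {0..1}. edge_point u v t \<in> U})"
proof -
  have "istopology (\<lambda>U. U \<subseteq> realization V E \<and>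
     (\<forall>u v. {u, v} \<in> E \<longrightarrow>
        openin (top_of_set {0..1}) {t \<in> {0..1}. edge_point u v t \<in> U}))"
    unfolding istopology_def
  proof (intro conjI allI impI)
    fix A B u v
    assume "A \<subseteq> realization V E \<and> (\<forall>u v. {u, v} \<in> E \<longrightarrow>
          openin (top_of_set {0..1}) {t \<in> {0..1}. edge_point u v t \<in> A})"
      and "B \<subseteq> realization V E \<and> (\<forall>u v. {u, v} \<in> E \<longrightarrow>
          openin (top_of_set {0..1}) {t \<in> {0..1}. edge_point u v t \<in> B})"
      and "{u, v} \<in> E"
    then have "openin (top_of_set {0..1}) ({t \<in> {0..1}. edge_point u v t \<in> A} \<inter>
        {t \<in> {0..1}. edge_point u v t \<in> B})"
      by (intro openin_Int) auto
    moreover have "{t \<in> {0..1}. edge_point u v t \<in> A} \<inter> {t \<in> {0..1}. edge_point u v t \<in> B} =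
        {t \<in> {0..1}. edge_point u v t \<in> A \<inter> B}"
      by auto
    ultimately show "openin (top_of_set {0..1}) {t \<in> {0..1}. edge_point u v t \<in> A \<inter> B}"
      by simp
  next
    fix \<K> u v
    assume "\<forall>K\<in>\<K>. K \<subseteq> realization V E \<and> (\<forall>u v. {u, v} \<in> E \<longrightarrow>
          openin (top_of_set {0..1}) {t \<in> {0..1}. edge_point u v t \<in> K})"
      and "{u, v} \<in> E"
    then have "openin (top_of_set {0..1}) (\<Union>K\<in>\<K>. {t \<in> {0..1}. edge_point u v t \<in> K})"
      by blast
    moreover have "(\<Union>K\<in>\<K>. {t \<in> {0..1}. edge_point u v t \<in> K}) =
        {t \<in> {0..1}. edge_point u v t \<in> \<Union>\<K>}"
      by auto
    ultimately show "openin (top_of_set {0..1}) {t \<in> {0..1}. edge_point u v t \<in> \<Union>\<K>}"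
      by simp
  qed auto
  then show ?thesis
    unfolding graph_topology_def by (simp add: topology_inverse')
qed

lemma topspace_graph_topology: "topspace (graph_topology V E) = realization V E"
proof (rule antisym)
  have "openin (graph_topology V E) (realization V E)"
    unfolding openin_graph_topology
  proof (intro conjI allI impI)
    fix u v
    assume "{u, v} \<in> E"
    then have "{t \<in> {0..1}. edge_point u v t \<in> realization V E} = {0..1}"
      unfolding realization_def by auto
    then show "openin (top_of_set {0..1}) {t \<in> {0..1}. edge_point u v t \<in> realization V E}"
      by simp
  qed simp
  then show "realization V E \<subseteq> topspace (graph_topology V E)"
    by (rule openin_subset)
  show "topspace (graph_topology V E) \<subseteq> realization V E"
    using openin_graph_topology openin_topspace by blast
qed

section \<open>Surfaces\<close>

definition plane_chart :: "'a topology \<Rightarrow> 'a set \<Rightarrow> ('a \<Rightarrow> complex) \<Rightarrow> bool" where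
  "plane_chart X U c \<longleftrightarrow> openin X U \<and> open (c ` U) \<and>
     homeomorphic_map (subtopology X U) (top_of_set (c ` U)) c"

text \<open>Surfaces need not be connected and may have uncountably many components (if the Cayley graph
  has), so second countability is required of the components only.\<close>

definition surface :: "'a topology \<Rightarrow> bool" where
  "surface X \<longleftrightarrow> Hausdorff_space X \<and>
     (\<forall>K\<in>connected_components_of X. second_countable (subtopology X K)) \<and>
     (\<forall>x\<in>topspace X. \<exists>U c. x \<in> U \<and> plane_chart X U c)"

text \<open>The transition map from (U, c) to (V, d) preserves orientation: it maps every small positively
  oriented circle around a point to a loop of winding number 1 around the image of that point.\<close>

definition same_orientation ::
  "'a set \<Rightarrow> ('a \<Rightarrow> complex) \<Rightarrow> 'a set \<Rightarrow> ('a \<Rightarrow> complex) \<Rightarrow> bool" where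
  "same_orientation U c V d \<longleftrightarrow>
     (\<forall>x\<in>U \<inter> V. \<forall>\<^sub>F r in at_right 0.
        winding_number (d \<circ> inv_into U c \<circ> circlepath (c x) r) (d x) = 1)"

definition orientable :: "'a topology \<Rightarrow> bool" where
  "orientable X \<longleftrightarrow> (\<exists>\<A>.
     (\<forall>(U, c)\<in>\<A>. plane_chart X U c) \<and>
     topspace X = (\<Union>(U, c)\<in>\<A>. U) \<and>
     (\<forall>(U, c)\<in>\<A>. \<forall>(V, d)\<in>\<A>. same_orientation U c V d))"

section \<open>Embeddings and biembeddings\<close>

definition graph_embedding ::
  "'v set \<Rightarrow> 'v set set \<Rightarrow> 'a topology \<Rightarrow> (('v \<Rightarrow> real) \<Rightarrow> 'a) \<Rightarrow> bool" where
  "graph_embedding V E X \<phi> \<longleftrightarrow>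
     continuous_map (graph_topology V E) X \<phi> \<and> inj_on \<phi> (realization V E)"

definition faces ::
  "'v set \<Rightarrow> 'v set set \<Rightarrow> 'a topology \<Rightarrow> (('v \<Rightarrow> real) \<Rightarrow> 'a) \<Rightarrow> 'a set set" where
  "faces V E X \<phi> =
     connected_components_of (subtopology X (topspace X - \<phi> ` realization V E))"

definition circuit_points :: "'v list \<Rightarrow> ('v \<Rightarrow> real) set" where
  "circuit_points w =
     (\<Union>j<length w. edge_point (w ! j) (w ! (Suc j mod length w)) ` {0..1})"

text \<open>The boundary of the face F is the image of the closed walk w: as a point set the frontier of F
  is the image of w, and F has a half-open collar f along its boundary, an annulus
  with parameters (s, t), 0 <= s <= length w (ends identified) and 0 < t <= 1, whose boundary curve t = 0 is
  the image of w traversed edge by edge. The frontier alone would not determine the closed walk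
  when w passes through a vertex more than once. The face is not required to be a disc, and the
  condition does not depend on the starting point and the direction of w.\<close>

definition face_boundary ::
  "'a topology \<Rightarrow> (('v \<Rightarrow> real) \<Rightarrow> 'a) \<Rightarrow> 'a set \<Rightarrow> 'v list \<Rightarrow> bool" where
  "face_boundary X \<phi> F w \<longleftrightarrow>
     X frontier_of F = \<phi> ` circuit_points w \<and>
     (\<exists>f :: real \<times> real \<Rightarrow> 'a.
        continuous_map (top_of_set ({0..real (length w)} \<times> {0..1})) X f \<and>
        (\<forall>t\<in>{0..1}. f (real (length w), t) = f (0, t)) \<and>
        inj_on f ({0..<real (length w)} \<times> {0<..1}) \<and>
        f ` ({0..<real (length w)} \<times> {0<..1}) \<subseteq> F \<and>
        (\<forall>j<length w. \<forall>u\<in>{0..1}.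
           f (real j + u, 0) = \<phi> (edge_point (w ! j) (w ! (Suc j mod length w)) u)))"

definition share_edge ::
  "'v set set \<Rightarrow> 'a topology \<Rightarrow> (('v \<Rightarrow> real) \<Rightarrow> 'a) \<Rightarrow> 'a set \<Rightarrow> 'a set \<Rightarrow> bool" where
  "share_edge E X \<phi> F F' \<longleftrightarrow> (\<exists>u v. {u, v} \<in> E \<and>
     \<phi> ` edge_point u v ` {0..1} \<subseteq> X frontier_of F \<inter> X frontier_of F')"

definition color_class_bounded_by ::
  "'a topology \<Rightarrow> (('v \<Rightarrow> real) \<Rightarrow> 'a) \<Rightarrow> 'a set set \<Rightarrow> 'v list set \<Rightarrow> bool" where
  "color_class_bounded_by X \<phi> A C \<longleftrightarrow>
     (\<forall>F\<in>A. \<exists>w\<in>C. face_boundary X \<phi> F w) \<and> (\<forall>w\<in>C. \<exists>F\<in>A. face_boundary X \<phi> F w)"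

definition biembedding ::
  "'v set \<Rightarrow> 'v set set \<Rightarrow> 'v list set \<Rightarrow> 'v list set
     \<Rightarrow> 'a topology \<Rightarrow> (('v \<Rightarrow> real) \<Rightarrow> 'a) \<Rightarrow> bool" where
  "biembedding V E C C' X \<phi> \<longleftrightarrow>
     circuit_decomposition E C \<and> circuit_decomposition E C' \<and>
     graph_embedding V E X \<phi> \<and>
     (\<exists>A B. A \<union> B = faces V E X \<phi> \<and> A \<inter> B = {} \<and>
        (\<forall>K\<in>{A, B}. \<forall>F\<in>K. \<forall>F'\<in>K. F \<noteq> F' \<longrightarrow> \<not> share_edge E X \<phi> F F') \<and>
        color_class_bounded_by X \<phi> A C \<and> color_class_bounded_by X \<phi> B C')"

end

theory Submission
  imports Defs "HOL-Library.Real_Mod" "HOL-Number_Theory.Cong"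
begin

text \<open>Let \<open>E\<close> be the set of entries of the array; the edges of the graph are the pairs of \<open>y\<close> and \<open>a + y\<close>
  with \<open>a \<in> E\<close>, directed from \<open>y\<close> to \<open>a + y\<close>. Every edge lies on one circuit of a column, which traverses it
  forwards, and on one circuit of a row, which traverses it backwards. Attach to every edge the
  strip \<open>0 \<le> Re z < 1\<close>, the edge itself being the segment \<open>Im z = 0\<close>; gluing the upper halves of the strips
  along the column circuits and the lower halves along the row circuits turns every circuit of length \<open>l\<close>
  into the boundary of a half-cylinder of circumference \<open>l\<close>. The result is a translation surface
  away from the vertices. Going around a vertex
  leads from the outgoing edge with label \<open>a\<close> to the one whose label is the image of \<open>a\<close> under the inverse of
  \<open>\<omega>c \<circ> \<omega>r\<close>, so compatibility means that one turn meets all \<open>N = card E\<close> outgoing edges, and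
  the vertex becomes a cone point of angle \<open>2 * pi * N\<close>: the map \<open>w \<mapsto> w ^ N\<close> gives a chart there. All
  transition maps are holomorphic, hence orientation preserving. The faces are the open
  half-cylinders, so they are annuli, not discs, and the surface is not compact.\<close>

section \<open>Surfaces glued from plane domains\<close>

text \<open>The rotation at a vertex is where the two orderings interact. A column circuit that
  arrives on an incoming edge labelled \<open>b\<close> leaves on the outgoing edge labelled
  \<open>\<omega>c b\<close>. A row circuit arrives backwards on an outgoing edge labelled
  \<open>a\<close> and leaves backwards on the incoming edge labelled \<open>\<omega>r a\<close>. So
  a clockwise turn leads from the outgoing \<open>a\<close> across a row corner to the incoming
  \<open>\<omega>r a\<close>, and then across a column corner to the outgoing
  \<open>\<omega>c (\<omega>r a)\<close>; hence the composition, and its inverse in the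
  counterclockwise order. Entries rather than elements of \<open>S\<close> serve as labels because
  exactly one of \<open>d\<close> and \<open>- d\<close> is an entry for each \<open>d\<close> in
  \<open>S\<close>, which gives every edge a definite direction. Half-cylinders with an open end are
  enough because a face is recognised by its frontier and a collar only, so no end has to be capped.
  The group may be nonabelian and uncountable: labels are added on the left, translations act on the
  right, and each component reaches only countably many vertices.\<close>

lemma winding_number_injective_holomorphic:
  assumes hol: "g holomorphic_on W" and inj: "inj_on g W" and "open W" "w \<in> W"
  shows "\<forall>\<^sub>F r in at_right 0. winding_number (g \<circ> circlepath w r) (g w) = 1"
proof -
  define D where "D = deriv g w"
  have D0: "D \<noteq> 0"
    unfolding D_def by (rule holomorphic_injective_imp_regular[OF hol \<open>open W\<close> inj \<open>w \<in> W\<close>])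
  have "(g has_field_derivative D) (at w)"
    unfolding D_def by (rule holomorphic_derivI[OF hol \<open>open W\<close> \<open>w \<in> W\<close>])
  then have "(g has_derivative (\<lambda>h. D * h)) (at w)"
    by (simp add: has_field_derivative_def)
  \<comment> \<open>Half of \<open>norm D\<close> keeps the image loop closer to its linearization
    \<open>D * (v - w)\<close> than that is to 0, so both loops wind equally often.\<close>
  then obtain \<delta> where "\<delta> > 0" and \<delta>:
    "\<And>v. norm (v - w) < \<delta> \<Longrightarrow> norm (g v - g w - D * (v - w)) \<le> norm D / 2 * norm (v - w)"
    unfolding has_derivative_at_alt using D0 by (metis half_gt_zero zero_less_norm_iff)
  obtain e where "e > 0" and e: "ball w e \<subseteq> W"
    using \<open>open W\<close> \<open>w \<in> W\<close> openE by blast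
  show ?thesis
    unfolding eventually_at_right_field
  proof (intro exI[of _ "min \<delta> e"] conjI allI impI)
    fix r :: real
    assume r: "0 < r" "r < min \<delta> e"
    have circ: "circlepath w r t - w = r * exp (2 * of_real pi * \<i> * of_real t)" for t
      by (simp add: circlepath mult_ac)
    have ncirc: "norm (circlepath w r t - w) = r" for t
      unfolding circ using r norm_exp_i_times[of "2 * pi * t"] by (simp add: norm_mult mult_ac)
    \<comment> \<open>An explicit logarithm of the linearized loop; it grows by
      \<open>2 * pi * \<i>\<close> in one turn, which gives winding number 1.\<close>
    define p :: "real \<Rightarrow> complex" where "p = (\<lambda>t. Ln D + Ln r + 2 * of_real pi * \<i> * of_real t)"
    have exp_p: "(exp \<circ> p) t = D * (circlepath w r t - w)" for t
      unfolding circ using r D0 by (simp add: p_def exp_add)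
    have path_p: "path p"
      unfolding path_def p_def by (intro continuous_intros)
    have in_ball: "circlepath w r t \<in> ball w e" for t
      using ncirc[of t] r by (simp add: dist_norm norm_minus_commute)
    have path_g: "path (\<lambda>t. (g \<circ> circlepath w r) t - g w)"
      unfolding path_def comp_def
      by (intro continuous_intros continuous_on_compose2[OF holomorphic_on_imp_continuous_on[OF hol]])
        (use in_ball e path_circlepath[of w r] in \<open>auto simp: path_def\<close>)
    have "winding_number (\<lambda>t. (g \<circ> circlepath w r) t - g w) 0 = winding_number (exp \<circ> p) 0"
    proof (rule winding_number_nearby_loops_eq)
      show "path (exp \<circ> p)"
        by (intro path_continuous_image path_p continuous_intros)
      show "pathfinish (exp \<circ> p) = pathstart (exp \<circ> p)"
        unfolding pathfinish_def pathstart_def exp_p circ by simp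
      show "pathfinish (\<lambda>t. (g \<circ> circlepath w r) t - g w) = pathstart (\<lambda>t. (g \<circ> circlepath w r) t - g w)"
        using pathfinish_circlepath[of w r] pathstart_circlepath[of w r]
        by (simp add: pathfinish_def pathstart_def)
      show "norm ((g \<circ> circlepath w r) t - g w - (exp \<circ> p) t) < norm ((exp \<circ> p) t - 0)" for t
        unfolding exp_p using \<delta>[of "circlepath w r t"] r D0 ncirc[of t]
        by (simp add: norm_mult)
          (smt (verit) mult_pos_pos zero_less_norm_iff field_sum_of_halves mult.commute)
    qed (use path_g in simp)
    also have "\<dots> = 1"
      using winding_number_compose_exp[OF path_p] by (simp add: p_def pathfinish_def pathstart_def)
    finally show "winding_number (g \<circ> circlepath w r) (g w) = 1"
      by (subst winding_number_offset) (simp add: o_def)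
  qed (use \<open>\<delta> > 0\<close> \<open>e > 0\<close> in simp)
qed

text \<open>The transition maps are required only as local lifts; injectivity of the
  parametrizations makes them agree with the global ones.\<close>

locale holomorphic_gluing =
  fixes \<Omega> :: "complex set" and p :: "'i \<Rightarrow> complex \<Rightarrow> 'a"
  assumes open_domain: "open \<Omega>"
    and inj: "inj_on (p i) \<Omega>"
    and lift: "\<lbrakk>w \<in> \<Omega>; w' \<in> \<Omega>; p i w = p j w'\<rbrakk> \<Longrightarrow>
      \<exists>W g. open W \<and> w \<in> W \<and> W \<subseteq> \<Omega> \<and> g holomorphic_on W \<and> g ` W \<subseteq> \<Omega> \<and> (\<forall>v\<in>W. p j (g v) = p i v)"
begin

definition glued :: "'a topology" where
  "glued = topology (\<lambda>U. U \<subseteq> (\<Union>i. p i ` \<Omega>) \<and> (\<forall>i. open {w \<in> \<Omega>. p i w \<in> U}))"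

lemma openin_glued:
  "openin glued U \<longleftrightarrow> U \<subseteq> (\<Union>i. p i ` \<Omega>) \<and> (\<forall>i. open {w \<in> \<Omega>. p i w \<in> U})"
proof -
  have "istopology (\<lambda>U. U \<subseteq> (\<Union>i. p i ` \<Omega>) \<and> (\<forall>i. open {w \<in> \<Omega>. p i w \<in> U}))"
    unfolding istopology_def
  proof (intro conjI allI impI)
    fix A B i
    assume "A \<subseteq> (\<Union>i. p i ` \<Omega>) \<and> (\<forall>i. open {w \<in> \<Omega>. p i w \<in> A})"
      and "B \<subseteq> (\<Union>i. p i ` \<Omega>) \<and> (\<forall>i. open {w \<in> \<Omega>. p i w \<in> B})"
    then have "open ({w \<in> \<Omega>. p i w \<in> A} \<inter> {w \<in> \<Omega>. p i w \<in> B})"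
      by (intro open_Int) auto
    moreover have "{w \<in> \<Omega>. p i w \<in> A} \<inter> {w \<in> \<Omega>. p i w \<in> B} = {w \<in> \<Omega>. p i w \<in> A \<inter> B}"
      by auto
    ultimately show "open {w \<in> \<Omega>. p i w \<in> A \<inter> B}"
      by simp
  next
    fix \<K> i
    assume "\<forall>K\<in>\<K>. K \<subseteq> (\<Union>i. p i ` \<Omega>) \<and> (\<forall>i. open {w \<in> \<Omega>. p i w \<in> K})"
    then have "open (\<Union>K\<in>\<K>. {w \<in> \<Omega>. p i w \<in> K})"
      by blast
    moreover have "(\<Union>K\<in>\<K>. {w \<in> \<Omega>. p i w \<in> K}) = {w \<in> \<Omega>. p i w \<in> \<Union>\<K>}"
      by auto
    ultimately show "open {w \<in> \<Omega>. p i w \<in> \<Union>\<K>}"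
      by simp
  qed auto
  then show ?thesis
    unfolding glued_def by (simp add: topology_inverse')
qed

text \<open>Seen through another parametrization, the image is locally the preimage of
  \<open>W\<close> under a holomorphic transition map; in this way every parametrization becomes an
  open map.\<close>

lemma openin_glued_image:
  assumes "open W" "W \<subseteq> \<Omega>"
  shows "openin glued (p i ` W)"
  unfolding openin_glued
proof (intro conjI allI)
  show "p i ` W \<subseteq> (\<Union>i. p i ` \<Omega>)"
    using assms by blast
  fix j
  show "open {w \<in> \<Omega>. p j w \<in> p i ` W}"
  proof (subst open_subopen, intro ballI)
    fix v
    assume v: "v \<in> {w \<in> \<Omega>. p j w \<in> p i ` W}"
    then obtain w where w: "w \<in> W" "p j v = p i w"
      by auto
    have "v \<in> \<Omega>" "w \<in> \<Omega>"
      using v w assms by auto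
    with w obtain V g where V: "open V" "v \<in> V" "V \<subseteq> \<Omega>" "g holomorphic_on V"
      "g ` V \<subseteq> \<Omega>" "\<forall>u\<in>V. p i (g u) = p j u"
      using lift[of v w j i] by blast
    have gv: "g v = w"
    proof (rule inj_onD[OF inj[of i]])
      show "p i (g v) = p i w" "g v \<in> \<Omega>" "w \<in> \<Omega>"
        using V w \<open>w \<in> \<Omega>\<close> by auto
    qed
    have "open (g -` W \<inter> V)"
      using V \<open>open W\<close> by (subst Int_commute) (intro continuous_open_preimage holomorphic_on_imp_continuous_on)
    moreover have "v \<in> g -` W \<inter> V"
      using gv w V by auto
    moreover have "g -` W \<inter> V \<subseteq> {w \<in> \<Omega>. p j w \<in> p i ` W}"
      using V by (auto intro: rev_image_eqI)
    ultimately show "\<exists>T. open T \<and> v \<in> T \<and> T \<subseteq> {w \<in> \<Omega>. p j w \<in> p i ` W}"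
      by blast
  qed
qed

lemma topspace_glued: "topspace glued = (\<Union>i. p i ` \<Omega>)"
proof (rule antisym)
  show "topspace glued \<subseteq> (\<Union>i. p i ` \<Omega>)"
    using openin_glued openin_topspace by blast
  have "openin glued (p i ` \<Omega>)" for i
    using openin_glued_image[OF open_domain] by simp
  then show "(\<Union>i. p i ` \<Omega>) \<subseteq> topspace glued"
    using openin_subset by blast
qed

lemma continuous_map_param: "continuous_map (top_of_set \<Omega>) glued (p i)"
  unfolding continuous_map_def
proof (intro conjI allI impI)
  show "p i \<in> topspace (top_of_set \<Omega>) \<rightarrow> topspace glued"
    by (auto simp: topspace_glued)
  fix U
  assume "openin glued U"
  then show "openin (top_of_set \<Omega>) {x \<in> topspace (top_of_set \<Omega>). p i x \<in> U}"
    using open_domain by (simp add: openin_glued openin_open_eq)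
qed

lemma plane_chart_param: "plane_chart glued (p i ` \<Omega>) (inv_into \<Omega> (p i))"
proof -
  have image: "inv_into \<Omega> (p i) ` p i ` \<Omega> = \<Omega>"
    by (simp add: image_inv_into_cancel[of "p i"] inj inv_into_image_cancel)
  have sub: "topspace (subtopology glued (p i ` \<Omega>)) = p i ` \<Omega>"
    by (auto simp: topspace_glued)
  have "homeomorphic_map (top_of_set \<Omega>) (subtopology glued (p i ` \<Omega>)) (p i)"
  proof (rule bijective_open_imp_homeomorphic_map)
    show "continuous_map (top_of_set \<Omega>) (subtopology glued (p i ` \<Omega>)) (p i)"
      using continuous_map_param by (simp add: continuous_map_in_subtopology)
    show "open_map (top_of_set \<Omega>) (subtopology glued (p i ` \<Omega>)) (p i)"
      unfolding open_map_def
    proof (intro allI impI)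
      fix U
      assume "openin (top_of_set \<Omega>) U"
      then have "open U" "U \<subseteq> \<Omega>"
        using open_domain openin_open_eq by auto
      then show "openin (subtopology glued (p i ` \<Omega>)) (p i ` U)"
        by (intro subset_openin_subtopology openin_glued_image) auto
    qed
    show "p i ` topspace (top_of_set \<Omega>) = topspace (subtopology glued (p i ` \<Omega>))"
      unfolding sub by simp
    show "inj_on (p i) (topspace (top_of_set \<Omega>))"
      by (simp add: inj)
  qed
  moreover have "inv_into \<Omega> (p i) (p i x) = x" if "x \<in> \<Omega>" for x
    using that by (simp add: inj)
  ultimately have "homeomorphic_map (subtopology glued (p i ` \<Omega>)) (top_of_set \<Omega>) (inv_into \<Omega> (p i))"
    by (smt (verit) homeomorphic_map_maps homeomorphic_maps_map homeomorphic_maps_def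
        homeomorphic_maps_sym sub topspace_euclidean_subtopology homeomorphic_eq_everything_map image_iff
        homeomorphic_map_eq inv_into_f_f inj)
  then show ?thesis
    unfolding plane_chart_def image using open_domain openin_glued_image by simp
qed

lemma same_orientation_param:
  "same_orientation (p i ` \<Omega>) (inv_into \<Omega> (p i)) (p j ` \<Omega>) (inv_into \<Omega> (p j))"
  unfolding same_orientation_def
proof
  fix x
  assume "x \<in> p i ` \<Omega> \<inter> p j ` \<Omega>"
  then obtain w w' where w: "w \<in> \<Omega>" "x = p i w" "w' \<in> \<Omega>" "x = p j w'"
    by auto
  then obtain W g where W: "open W" "w \<in> W" "W \<subseteq> \<Omega>" "g holomorphic_on W" "g ` W \<subseteq> \<Omega>"
    "\<And>v. v \<in> W \<Longrightarrow> p j (g v) = p i v"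
    using lift[of w w' i j] by auto
  have "inj_on g W"
    by (rule inj_onI) (metis W(3,6) inj inj_onD subsetD)
  have g: "inv_into \<Omega> (p j) (p i v) = g v" if "v \<in> W" for v
    using W that inj[of j] by (metis image_subset_iff inv_into_f_f)
  have inv_i: "inv_into (p i ` \<Omega>) (inv_into \<Omega> (p i)) v = p i v" if "v \<in> \<Omega>" for v
  proof -
    have "inj_on (inv_into \<Omega> (p i)) (p i ` \<Omega>)"
      by (rule inj_on_inv_into) simp
    from inv_into_f_f[OF this, of "p i v"] show ?thesis
      using that inj[of i] by simp
  qed
  \<comment> \<open>For radii below \<open>e\<close> the whole circle lies where the transition map
    equals \<open>g\<close>.\<close>
  obtain e where "e > 0" and e: "ball w e \<subseteq> W"
    using W openE by blast
  have "\<forall>\<^sub>F r in at_right 0. r < e \<and> 0 < r"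
    using \<open>e > 0\<close> by (auto simp: eventually_at_right_field)
  moreover note winding_number_injective_holomorphic[OF W(4) \<open>inj_on g W\<close> W(1,2)]
  ultimately show "\<forall>\<^sub>F r in at_right 0. winding_number (inv_into \<Omega> (p j) \<circ>
      inv_into (p i ` \<Omega>) (inv_into \<Omega> (p i)) \<circ> circlepath (inv_into \<Omega> (p i) x) r) (inv_into \<Omega> (p j) x) = 1"
  proof eventually_elim
    case (elim r)
    have "circlepath w r t \<in> W" for t
    proof -
      have "norm (circlepath w r t - w) = r"
        using elim norm_exp_i_times[of "2 * pi * t"] by (simp add: circlepath norm_mult mult_ac)
      then show ?thesis
        using e elim by (auto simp: dist_norm norm_minus_commute subset_iff)
    qed
    then have "inv_into \<Omega> (p j) \<circ> inv_into (p i ` \<Omega>) (inv_into \<Omega> (p i)) \<circ> circlepath w r = g \<circ> circlepath w r"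
      using W(3) by (auto simp: g inv_i subset_iff)
    moreover have "inv_into \<Omega> (p i) x = w" "inv_into \<Omega> (p j) x = g w"
      using w inj g[OF W(2)] by auto
    ultimately show ?case
      using elim by simp
  qed
qed

lemma orientable_glued: "orientable glued"
  unfolding orientable_def
proof (intro exI conjI)
  let ?\<A> = "range (\<lambda>i. (p i ` \<Omega>, inv_into \<Omega> (p i)))"
  show "\<forall>(U, c)\<in>?\<A>. plane_chart glued U c"
    using plane_chart_param by auto
  show "topspace glued = (\<Union>(U, c)\<in>?\<A>. U)"
    by (simp add: topspace_glued)
  show "\<forall>(U, c)\<in>?\<A>. \<forall>(V, d)\<in>?\<A>. same_orientation U c V d"
    using same_orientation_param by auto
qed

text \<open>Prepares the countability of the components, which lie in countably many charts even if
  the whole surface needs uncountably many.\<close>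

lemma second_countable_Union_params:
  assumes "countable I"
  shows "second_countable (subtopology glued (\<Union>i\<in>I. p i ` \<Omega>))"
proof -
  obtain B :: "complex set set" where B: "countable B" "topological_basis B"
    using ex_countable_basis by blast
  let ?\<B> = "(\<lambda>(i, W). p i ` W) ` (I \<times> {W \<in> B. W \<subseteq> \<Omega>})"
  have 1: "countable ?\<B>"
    using assms B by (intro countable_image countable_SIGMA) auto
  have 2: "\<forall>V\<in>?\<B>. openin (subtopology glued (\<Union>i\<in>I. p i ` \<Omega>)) V"
  proof clarify
    fix i W
    assume "i \<in> I" "W \<in> B" "W \<subseteq> \<Omega>"
    then show "openin (subtopology glued (\<Union>i\<in>I. p i ` \<Omega>)) (p i ` W)"
      using B by (intro subset_openin_subtopology openin_glued_image topological_basis_open) auto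
  qed
  have 3: "\<exists>V\<in>?\<B>. x \<in> V \<and> V \<subseteq> U"
    if U: "openin (subtopology glued (\<Union>i\<in>I. p i ` \<Omega>)) U" "x \<in> U" for U x
  proof -
    obtain U' where U': "openin glued U'" "U = U' \<inter> (\<Union>i\<in>I. p i ` \<Omega>)"
      using U by (auto simp: openin_subtopology)
    then obtain i w where w: "i \<in> I" "w \<in> \<Omega>" "x = p i w"
      using U by auto
    have "open {w \<in> \<Omega>. p i w \<in> U'}" "w \<in> {w \<in> \<Omega>. p i w \<in> U'}"
      using U' w U by (auto simp: openin_glued)
    then obtain W where W: "W \<in> B" "w \<in> W" "W \<subseteq> {w \<in> \<Omega>. p i w \<in> U'}"
      using B(2) topological_basisE by blast
    then have "p i ` W \<in> ?\<B>" "x \<in> p i ` W" "p i ` W \<subseteq> U"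
      using w U' by auto
    then show ?thesis
      by blast
  qed
  show ?thesis
    unfolding second_countable_def
    by (rule exI[of _ ?\<B>], intro conjI allI impI) (rule 1, rule 2, elim conjE, rule 3)
qed

end

section \<open>Branches of the root\<close>

text \<open>The branch of the \<open>N\<close>-th root on the half-plane with inner normal \<open>cis (pi * q / 2)\<close> whose
  image is the sector around the argument \<open>pi * q / (2 * N)\<close>. The branches for
  \<open>q = 4 * k\<close> and \<open>q = 4 * k + 2\<close> live on the right and on the left half-plane.\<close>

definition sector_root :: "nat \<Rightarrow> int \<Rightarrow> complex \<Rightarrow> complex" where
  "sector_root N q z =
     cis (pi * of_int q / (2 * real N)) * (cis (- (pi * of_int q / 2)) * z) powr (1 / of_nat N)"

lemma sector_root_0 [simp]: "sector_root N q 0 = 0"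
  by (simp add: sector_root_def)

lemma powr_inverse_nat_power:
  fixes z :: complex
  assumes "0 < N"
  shows "(z powr (1 / of_nat N)) ^ N = z"
proof (cases "z = 0")
  case False
  then show ?thesis
    using assms by (simp add: powr_def exp_of_nat_mult[symmetric])
qed (use assms in simp)

lemma sector_root_power:
  assumes "0 < N"
  shows "sector_root N q z ^ N = z"
proof -
  have "cis (pi * of_int q / (2 * real N)) ^ N = cis (pi * of_int q / 2)"
    by (subst Complex.DeMoivre) (use assms in simp)
  moreover have "((cis (- (pi * of_int q / 2)) * z) powr (1 / of_nat N)) ^ N = cis (- (pi * of_int q / 2)) * z"
    using assms by (rule powr_inverse_nat_power)
  ultimately show ?thesis
    by (simp add: sector_root_def power_mult_distrib mult.assoc[symmetric] cis_mult)
qed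

lemma sector_root_eq_0_iff:
  assumes "0 < N"
  shows "sector_root N q z = 0 \<longleftrightarrow> z = 0"
  using sector_root_power[OF assms, of q z] assms by auto

lemma cis_add_int_pi: "cis (x - 2 * pi * of_int k) = cis x"
  unfolding cis_eq_iff rcong_altdef by (rule exI[of _ k]) simp

lemma cis_quarter_int:
  "cis (- (pi * of_int (4 * k) / 2)) = 1"
  "cis (- (pi * of_int (4 * k + 1) / 2)) = - \<i>"
  "cis (- (pi * of_int (4 * k + 2) / 2)) = - 1"
  "cis (- (pi * of_int (4 * k + 3) / 2)) = \<i>"
proof -
  have *: "cis (- (pi * of_int (4 * k + r) / 2)) = cis (- (pi * of_int r / 2))" for r
    unfolding cis_add_int_pi[of "- (pi * of_int r / 2)" k, symmetric]
    by (rule arg_cong[of _ _ cis]) (simp add: field_simps)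
  show "cis (- (pi * of_int (4 * k) / 2)) = 1"
    using *[of 0] by simp
  show "cis (- (pi * of_int (4 * k + 1) / 2)) = - \<i>"
    unfolding * by (simp add: complex_eq_iff)
  show "cis (- (pi * of_int (4 * k + 2) / 2)) = - 1"
    unfolding * by (simp add: complex_eq_iff)
  have "cis (- (pi * of_int 3 / 2)) = cis (pi / 2 - 2 * pi * of_int 1)"
    by (simp add: field_simps)
  also have "\<dots> = \<i>"
    unfolding cis_add_int_pi by (simp add: complex_eq_iff)
  finally show "cis (- (pi * of_int (4 * k + 3) / 2)) = \<i>"
    unfolding * .
qed

text \<open>Adding 4 to \<open>q\<close> turns the normal once around, so the half-plane stays and
  only the rotation in front changes: branches over one half-plane differ by roots of unity.\<close>

lemma sector_root_shift:
  "sector_root N (q + 4 * k) z = cis (2 * pi * of_int k / real N) * sector_root N q z"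
proof -
  have "cis (- (pi * of_int (q + 4 * k) / 2)) = cis (- (pi * of_int q / 2))"
    unfolding cis_add_int_pi[of "- (pi * of_int q / 2)" k, symmetric]
    by (rule arg_cong[of _ _ cis]) (simp add: field_simps)
  moreover have "cis (pi * of_int (q + 4 * k) / (2 * real N)) =
      cis (2 * pi * of_int k / real N) * cis (pi * of_int q / (2 * real N))"
    unfolding cis_mult by (rule arg_cong[of _ _ cis]) (simp add: field_simps add_divide_distrib)
  ultimately show ?thesis
    by (simp add: sector_root_def)
qed

text \<open>Consecutive half-planes share a quadrant, and on it the two branches continue each
  other; this joins the sectors around 0.\<close>

lemma sector_root_Suc:
  assumes "0 \<le> Re (cis (- (pi * of_int q / 2)) * z)" "0 \<le> Re (cis (- (pi * of_int (q + 1) / 2)) * z)"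
  shows "sector_root N (q + 1) z = sector_root N q z"
proof (cases "z = 0")
  case False
  define \<zeta> where "\<zeta> = cis (- (pi * of_int q / 2)) * z"
  have "cis (- (pi * of_int (q + 1) / 2)) = - \<i> * cis (- (pi * of_int q / 2))"
    unfolding cis_minus_pi_half[symmetric] cis_mult
    by (rule arg_cong[of _ _ cis]) (simp add: field_simps)
  then have \<zeta>': "cis (- (pi * of_int (q + 1) / 2)) * z = - \<i> * \<zeta>"
    by (simp add: \<zeta>_def)
  have "\<zeta> \<noteq> 0"
    using False by (simp add: \<zeta>_def)
  \<comment> \<open>The argument of \<open>- \<i> * \<zeta>\<close> is at most a quarter turn in
    absolute value, so adding a quarter turn does not cross the cut of \<open>Ln\<close>.\<close>
  have "Ln (\<i> * (- \<i> * \<zeta>)) = Ln (- \<i> * \<zeta>) + \<i> * of_real pi / 2"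
    using \<open>\<zeta> \<noteq> 0\<close> assms(2) unfolding \<zeta>' by (subst Ln_times_ii) auto
  then have "Ln \<zeta> = Ln (- \<i> * \<zeta>) + \<i> * of_real pi / 2"
    by (simp add: mult.assoc[symmetric])
  then have "1 / of_nat N * Ln \<zeta> = \<i> * of_real (pi / (2 * real N)) + 1 / of_nat N * Ln (- \<i> * \<zeta>)"
    by (simp add: distrib_left)
  then have "\<zeta> powr (1 / of_nat N) = cis (pi / (2 * real N)) * (- \<i> * \<zeta>) powr (1 / of_nat N)"
    using \<open>\<zeta> \<noteq> 0\<close> by (simp only: powr_def cis_conv_exp exp_add) simp
  moreover have "cis (pi * of_int (q + 1) / (2 * real N)) =
      cis (pi * of_int q / (2 * real N)) * cis (pi / (2 * real N))"
    unfolding cis_mult by (rule arg_cong[of _ _ cis]) (simp add: field_simps add_divide_distrib)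
  ultimately show ?thesis
    by (simp add: sector_root_def \<zeta>'[simplified] \<zeta>_def[symmetric])
qed simp

text \<open>After the rotation the closed half-plane meets the cut of the principal power only at 0,
  where the positive exponent still gives continuity.\<close>

lemma continuous_on_sector_root:
  assumes "0 < N"
  shows "continuous_on {z. 0 \<le> Re (cis (- (pi * of_int q / 2)) * z)} (sector_root N q)"
  unfolding sector_root_def
  by (intro continuous_on_mult continuous_on_const continuous_on_powr_complex continuous_on_id)
    (use assms in \<open>auto simp: Re_divide_of_nat\<close>)

lemma holomorphic_on_sector_root:
  "sector_root N q holomorphic_on {z. 0 < Re (cis (- (pi * of_int q / 2)) * z)}"
  unfolding sector_root_def
  by (intro holomorphic_intros) (auto simp: complex_nonpos_Reals_iff)

lemma inj_on_sector_root:
  assumes "0 < N"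
  shows "inj_on (sector_root N q) A"
  by (rule inj_onI) (metis sector_root_power[OF assms])

lemma open_image_sector_root:
  assumes "0 < N" "open A" "A \<subseteq> {z. 0 < Re (cis (- (pi * of_int q / 2)) * z)}"
  shows "open (sector_root N q ` A)"
  using holomorphic_on_subset[OF holomorphic_on_sector_root assms(3)] assms(2)
    inj_on_sector_root[OF assms(1)]
  by (rule open_mapping_thm3)

text \<open>All \<open>N\<close>-th roots of \<open>w ^ N\<close> are multiples of one branch value
  by roots of unity, and shifting \<open>q\<close> by multiples of 4 produces all these
  factors.\<close>

lemma sector_root_exists:
  assumes "0 < N"
  obtains k where "w = sector_root N (q + 4 * k) (w ^ N)"
proof (cases "w = 0")
  case True
  then show ?thesis
    using assms by (intro that[of 0]) (simp add: zero_power)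
next
  case False
  define v where "v = sector_root N q (w ^ N)"
  have "v ^ N = w ^ N"
    unfolding v_def using sector_root_power assms by blast
  moreover have "v \<noteq> 0"
    unfolding v_def using sector_root_eq_0_iff assms False by auto
  ultimately have "w / v \<in> {z. z ^ N = 1}"
    using False by (simp add: power_divide)
  also have "{z. z ^ N = 1} = (\<lambda>k. cis (2 * pi * real k / real N)) ` {..<N}"
    using bij_betw_imp_surj_on[OF Complex.bij_betw_roots_unity[OF assms]] by simp
  finally obtain k where "w / v = cis (2 * pi * real k / real N)"
    by blast
  then have "w = cis (2 * pi * real k / real N) * v"
    using \<open>v \<noteq> 0\<close> by (simp add: field_simps)
  then show ?thesis
    using that[of "int k"] by (simp add: sector_root_shift v_def)
qed

text \<open>A point determines the index of its sector only modulo \<open>N\<close>. The labels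
  around a vertex are required to have the same period, so they can be read off from the
  point.\<close>

lemma sector_root_eq_iff:
  assumes "0 < N" "z \<noteq> 0"
  shows "sector_root N (q + 4 * k) z = sector_root N (q + 4 * l) z \<longleftrightarrow> [k = l] (mod int N)"
proof -
  have "sector_root N (q + 4 * k) z = sector_root N (q + 4 * l) z \<longleftrightarrow>
      cis (2 * pi * of_int k / real N) = cis (2 * pi * of_int l / real N)"
    using sector_root_eq_0_iff[OF assms(1), of q z] assms(2) by (simp only: sector_root_shift mult_cancel_right) simp
  also have "\<dots> \<longleftrightarrow> (\<exists>n. real_of_int l = of_int k + of_int n * real N)"
  proof -
    have "2 * pi * of_int l / real N = 2 * pi * of_int k / real N + of_int n * (2 * pi) \<longleftrightarrow>
        real_of_int l = of_int k + of_int n * real N" for n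
    proof -
      have "2 * pi * of_int l / real N = 2 * pi * of_int k / real N + of_int n * (2 * pi) \<longleftrightarrow>
          (2 * pi) * of_int l = (2 * pi) * (of_int k + of_int n * real N)"
        using assms(1) by (simp add: field_simps)
      then show ?thesis
        by (subst (asm) mult_cancel_left) simp
    qed
    then show ?thesis
      unfolding cis_eq_iff rcong_altdef by simp
  qed
  also have "\<dots> \<longleftrightarrow> (\<exists>n. l = k + n * int N)"
  proof -
    have "real_of_int l = of_int k + of_int n * real N \<longleftrightarrow> l = k + n * int N" for n
      by (subst of_int_eq_iff[where 'a = real, symmetric]) simp
    then show ?thesis
      by simp
  qed
  also have "\<dots> \<longleftrightarrow> [k = l] (mod int N)"
    by (simp only: cong_iff_lin mult.commute[of "int N"])
  finally show ?thesis .
qed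

section \<open>Charts around the vertices\<close>

lemma connectedin_subset_of_disjoint_open:
  assumes "connectedin X K" "openin X A" "openin X B" "A \<inter> B = {}" "K \<subseteq> A \<union> B" "x \<in> K \<inter> A"
  shows "K \<subseteq> A"
proof -
  have "B \<inter> K = {}"
    using assms unfolding connectedin by blast
  then show ?thesis
    using assms(5) by blast
qed

lemma holomorphic_on_sector_root_right: "sector_root N (4 * k) holomorphic_on {z. 0 < Re z}"
  using holomorphic_on_sector_root[of N "4 * k"] by (simp only: cis_quarter_int mult_1)

lemma holomorphic_on_sector_root_left: "sector_root N (4 * k + 2) holomorphic_on {z. Re z < 0}"
  using holomorphic_on_sector_root[of N "4 * k + 2"] by (simp only: cis_quarter_int) simp

lemma open_image_sector_root_right:
  assumes "0 < N" "open A" "A \<subseteq> {z. 0 < Re z}"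
  shows "open (sector_root N (4 * k) ` A)"
  using assms by (intro open_image_sector_root) (simp_all only: cis_quarter_int mult_1)

lemma open_image_sector_root_left:
  assumes "0 < N" "open A" "A \<subseteq> {z. Re z < 0}"
  shows "open (sector_root N (4 * k + 2) ` A)"
  using assms by (intro open_image_sector_root) (simp_all only: cis_quarter_int, simp)

text \<open>One branch serves a whole half-plane: \<open>4 * k + 1\<close> above the real axis,
  where it agrees with \<open>4 * k\<close> and \<open>4 * k + 2\<close> on the two quadrants, and
  \<open>4 * k + 3\<close> below. The right half-plane met after \<open>4 * k + 2\<close> has index
  \<open>4 * (k + 1)\<close>, whence the \<open>k + 1\<close> on the lower side.\<close>

lemma continuous_on_half_plane_root:
  assumes "0 < N" and s: "s = 1 \<or> s = - 1"
  shows "continuous_on {z. 0 \<le> s * Im z} (\<lambda>z. if 0 \<le> Re z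
    then sector_root N (4 * (if s = 1 then k else k + 1)) z else sector_root N (4 * k + 2) z)"
  using s
proof
  assume s: "s = 1"
  have "sector_root N (4 * k + 1) z = (if 0 \<le> Re z
      then sector_root N (4 * (if s = 1 then k else k + 1)) z else sector_root N (4 * k + 2) z)"
    if "0 \<le> Im z" for z
  proof (cases "0 \<le> Re z")
    case True
    then show ?thesis
      using that s sector_root_Suc[of "4 * k" z N] by (simp only: cis_quarter_int) simp
  next
    case False
    have 2: "4 * k + 1 + 1 = 4 * k + 2"
      by simp
    have "sector_root N (4 * k + 1 + 1) z = sector_root N (4 * k + 1) z"
      by (rule sector_root_Suc) (use False that in \<open>simp_all only: cis_quarter_int 2\<close>, simp_all)
    then show ?thesis
      using False unfolding 2 by simp
  qed
  then show ?thesis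
    using continuous_on_sector_root[OF assms(1), of "4 * k + 1"] s
    by (simp only: cis_quarter_int) (simp cong: continuous_on_cong_simp)
next
  assume s: "s = - 1"
  have "sector_root N (4 * k + 3) z = (if 0 \<le> Re z
      then sector_root N (4 * (if s = 1 then k else k + 1)) z else sector_root N (4 * k + 2) z)"
    if "Im z \<le> 0" for z
  proof (cases "0 \<le> Re z")
    case True
    have 4: "4 * k + 3 + 1 = 4 * (k + 1)"
      by simp
    have "sector_root N (4 * k + 3 + 1) z = sector_root N (4 * k + 3) z"
      by (rule sector_root_Suc) (use True that in \<open>simp_all only: cis_quarter_int 4\<close>, simp_all)
    then show ?thesis
      using True s unfolding 4 by simp
  next
    case False
    have 3: "4 * k + 2 + 1 = 4 * k + 3"
      by simp
    have "sector_root N (4 * k + 2 + 1) z = sector_root N (4 * k + 2) z"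
      by (rule sector_root_Suc) (use False that in \<open>simp_all only: cis_quarter_int 3\<close>, simp_all)
    then show ?thesis
      using False unfolding 3 by simp
  qed
  then show ?thesis
    using continuous_on_sector_root[OF assms(1), of "4 * k + 3"] s
    by (simp only: cis_quarter_int) (simp cong: continuous_on_cong_simp)
qed

text \<open>The tile of the edge from \<open>y\<close> to \<open>a + y\<close> is the strip \<open>0 \<le> Re z < 1\<close>, the edge being its real
  segment and \<open>z = 0\<close> being the vertex \<open>y\<close>. Around every vertex, counterclockwise, the
  outgoing edge with label \<open>\<alpha> k\<close> is followed by the incoming edge with label \<open>\<beta> k\<close>
  and then by the outgoing edge with label \<open>\<alpha> (k + 1)\<close>.\<close>

locale vertex_rotation =
  fixes N :: nat and E :: "'g::group_add set" and \<alpha> \<beta> :: "int \<Rightarrow> 'g" and idx :: "'g \<Rightarrow> nat"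
  assumes N_pos: "0 < N"
    and \<alpha>_eq_iff: "\<alpha> k = \<alpha> l \<longleftrightarrow> [k = l] (mod int N)"
    and \<beta>_eq_iff: "\<beta> k = \<beta> l \<longleftrightarrow> [k = l] (mod int N)"
    and range_\<alpha>: "range \<alpha> = E"
    and range_\<beta>: "range \<beta> = E"
    and minus_notin: "a \<in> E \<Longrightarrow> - a \<notin> E"
    and inj_idx: "inj_on idx E"
begin

abbreviation rt :: "int \<Rightarrow> complex \<Rightarrow> complex" where
  "rt \<equiv> sector_root N"

text \<open>Points are singletons because the carrier of the surface is a type of sets. At
  \<open>z = 0\<close> the label is replaced by 0, which merges the starts of all tiles at
  \<open>y\<close> into one point, the vertex.\<close>

definition pt :: "'g \<Rightarrow> 'g \<Rightarrow> complex \<Rightarrow> ('g \<times> nat \<times> complex) set" where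
  "pt y a z = {(y, if z = 0 then 0 else idx a, z)}"

text \<open>The inverse chart at \<open>y\<close>, with root coordinate \<open>w\<close> and flat
  coordinate \<open>w ^ N\<close>. Right sectors enter the tiles that start at \<open>y\<close>,
  left sectors those that end there, whence the shift by 1. \<open>SOME\<close> may return any index
  of its residue class, and all of them carry the same label. The imaginary axis goes to the right
  because tiles contain their left border.\<close>

definition param :: "'g \<Rightarrow> complex \<Rightarrow> ('g \<times> nat \<times> complex) set" where
  "param y w =
     (if 0 \<le> Re (w ^ N) then pt y (\<alpha> (SOME k. w = rt (4 * k) (w ^ N))) (w ^ N)
      else let k = SOME k. w = rt (4 * k + 2) (w ^ N) in pt (- \<beta> k + y) (\<beta> k) (w ^ N + 1))"

definition star :: "complex set" where
  "star = {w. \<bar>Re (w ^ N)\<bar> < 1}"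

lemma zero_notin: "0 \<notin> E"
  using minus_notin[of 0] by auto

lemma \<alpha>_in [simp]: "\<alpha> k \<in> E" and \<beta>_in [simp]: "\<beta> k \<in> E"
  using range_\<alpha> range_\<beta> by auto

lemma pt_eq_iff:
  assumes "a \<in> E" "a' \<in> E"
  shows "pt y a z = pt y' a' z' \<longleftrightarrow> y = y' \<and> z = z' \<and> (z = 0 \<or> a = a')"
  using assms inj_idx by (auto simp: pt_def inj_on_eq_iff)

lemma pt_0: "pt y a 0 = pt y a' 0"
  by (simp add: pt_def)

lemma rt_power [simp]: "rt q z ^ N = z"
  by (rule sector_root_power[OF N_pos])

lemma rt_eq_iff:
  assumes "z \<noteq> 0"
  shows "rt (4 * k) z = rt (4 * l) z \<longleftrightarrow> [k = l] (mod int N)"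
    and "rt (4 * k + 2) z = rt (4 * l + 2) z \<longleftrightarrow> [k = l] (mod int N)"
  using sector_root_eq_iff[OF N_pos assms, of 0 k l] sector_root_eq_iff[OF N_pos assms, of 2 k l]
  by (simp_all add: add.commute)

lemma param_right:
  assumes "0 \<le> Re z"
  shows "param y (rt (4 * k) z) = pt y (\<alpha> k) z"
proof (cases "z = 0")
  case True
  then show ?thesis
    using N_pos by (simp add: param_def zero_power pt_0)
next
  case False
  define l where "l = (SOME l. rt (4 * k) z = rt (4 * l) z)"
  have "rt (4 * k) z = rt (4 * l) z"
    unfolding l_def by (rule someI) (rule refl)
  then have "\<alpha> l = \<alpha> k"
    using rt_eq_iff(1)[OF False] \<alpha>_eq_iff by metis
  then show ?thesis
    using assms by (simp add: param_def flip: l_def)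
qed

lemma param_left:
  assumes "Re z < 0"
  shows "param y (rt (4 * k + 2) z) = pt (- \<beta> k + y) (\<beta> k) (z + 1)"
proof -
  have "z \<noteq> 0"
    using assms by auto
  define l where "l = (SOME l. rt (4 * k + 2) z = rt (4 * l + 2) z)"
  have "rt (4 * k + 2) z = rt (4 * l + 2) z"
    unfolding l_def by (rule someI) (rule refl)
  then have "\<beta> l = \<beta> k"
    using rt_eq_iff(2)[OF \<open>z \<noteq> 0\<close>] \<beta>_eq_iff by metis
  then show ?thesis
    using assms by (simp add: param_def flip: l_def)
qed

lemma sector_cases:
  obtains (right) k where "0 \<le> Re (w ^ N)" "w = rt (4 * k) (w ^ N)"
  | (left) k where "Re (w ^ N) < 0" "w = rt (4 * k + 2) (w ^ N)"
  using sector_root_exists[OF N_pos, of w 0] sector_root_exists[OF N_pos, of w 2]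
  by (metis add.commute add_0 linorder_not_less)

lemma tile_point_exhaust:
  assumes "a \<in> E" "0 \<le> Re z" "Re z < 1"
  obtains w where "w \<in> star" "w ^ N = z" "pt y a z = param y w"
proof -
  obtain k where "a = \<alpha> k"
    using assms range_\<alpha> by auto
  then show ?thesis
    using assms param_right[of z y k] by (intro that[of "rt (4 * k) z"]) (auto simp: star_def)
qed

lemma param_exhaust:
  assumes "w \<in> star"
  obtains a z where "a \<in> E" "0 \<le> Re z" "Re z < 1" "param y w = pt y a z" "z = w ^ N"
  | a z where "a \<in> E" "0 < Re z" "Re z < 1" "param y w = pt (- a + y) a z" "z = w ^ N + 1"
proof (cases w rule: sector_cases)
  case (right k)
  then show ?thesis
    using assms param_right[of "w ^ N" y k] by (intro that(1)[of "\<alpha> k" "w ^ N"]) (auto simp: star_def)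
next
  case (left k)
  then show ?thesis
    using assms param_left[of "w ^ N" y k] by (intro that(2)[of "\<beta> k" "w ^ N + 1"]) (auto simp: star_def)
qed

text \<open>A tile has only two ends, so different charts can meet only inside a tile, which lies to
  the right of one centre and to the left of the other. Two views from the same side have the same
  label and flat coordinate, hence the same root.\<close>

lemma param_eq_cases:
  assumes "w \<in> star" "w' \<in> star" "param y w = param y' w'"
  obtains (same) "y = y'" "w = w'"
  | (outward) k l where "\<alpha> k = \<beta> l" "y = - \<beta> l + y'" "0 < Re (w ^ N)"
      "w = rt (4 * k) (w ^ N)" "w' ^ N = w ^ N - 1" "w' = rt (4 * l + 2) (w' ^ N)"
  | (inward) k l where "\<alpha> k = \<beta> l" "y' = - \<beta> l + y" "Re (w ^ N) < 0"
      "w = rt (4 * l + 2) (w ^ N)" "w' ^ N = w ^ N + 1" "w' = rt (4 * k) (w' ^ N)"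
proof (cases w rule: sector_cases)
  case w: (right k)
  show ?thesis
  proof (cases w' rule: sector_cases)
    case w': (right k')
    have "pt y (\<alpha> k) (w ^ N) = pt y' (\<alpha> k') (w' ^ N)"
      using assms(3) param_right[OF w(1), of y k] param_right[OF w'(1), of y' k'] w(2) w'(2) by simp
    then have eq: "y = y'" "w ^ N = w' ^ N" "w ^ N = 0 \<or> \<alpha> k = \<alpha> k'"
      unfolding pt_eq_iff[OF \<alpha>_in \<alpha>_in] by blast+
    have "w = w'"
    proof (cases "w ^ N = 0")
      case True
      then show ?thesis
        using eq(2) by (metis power_not_zero)
    next
      case False
      then have "rt (4 * k) (w ^ N) = rt (4 * k') (w ^ N)"
        using eq(3) rt_eq_iff(1)[OF False] \<alpha>_eq_iff False by metis
      then show ?thesis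
        using w(2) w'(2) eq(2) by simp
    qed
    then show ?thesis
      using same eq by blast
  next
    case w': (left l)
    have "pt y (\<alpha> k) (w ^ N) = pt (- \<beta> l + y') (\<beta> l) (w' ^ N + 1)"
      using assms(3) param_right[OF w(1), of y k] param_left[OF w'(1), of y' l] w(2) w'(2) by simp
    then have eq: "y = - \<beta> l + y'" "w ^ N = w' ^ N + 1" "w ^ N = 0 \<or> \<alpha> k = \<beta> l"
      unfolding pt_eq_iff[OF \<alpha>_in \<beta>_in] by blast+
    \<comment> \<open>The bound - 1 in \<open>star\<close> keeps the point off the start of its
      tile, so \<open>pt\<close> still remembers the label.\<close>
    have pos: "0 < Re (w ^ N)"
      using assms(2) unfolding star_def eq(2) by auto
    then have "w ^ N \<noteq> 0"
      by (metis less_irrefl zero_complex.simps(1))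
    show ?thesis
      by (rule outward[OF _ eq(1) pos w(2) _ w'(2)]) (use eq(2,3) \<open>w ^ N \<noteq> 0\<close> in \<open>metis, simp\<close>)
  qed
next
  case w: (left l)
  show ?thesis
  proof (cases w' rule: sector_cases)
    case w': (right k)
    have "pt (- \<beta> l + y) (\<beta> l) (w ^ N + 1) = pt y' (\<alpha> k) (w' ^ N)"
      using assms(3) param_left[OF w(1), of y l] param_right[OF w'(1), of y' k] w(2) w'(2) by simp
    then have eq: "y' = - \<beta> l + y" "w' ^ N = w ^ N + 1" "w' ^ N = 0 \<or> \<alpha> k = \<beta> l"
      unfolding pt_eq_iff[OF \<beta>_in \<alpha>_in] by auto
    have "0 < Re (w' ^ N)"
      using assms(1) unfolding star_def eq(2) by auto
    then have "w' ^ N \<noteq> 0"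
      by (metis less_irrefl zero_complex.simps(1))
    show ?thesis
      by (rule inward[OF _ eq(1) w(1,2) eq(2) w'(2)]) (use eq(3) \<open>w' ^ N \<noteq> 0\<close> in metis)
  next
    case w': (left l')
    have "pt (- \<beta> l + y) (\<beta> l) (w ^ N + 1) = pt (- \<beta> l' + y') (\<beta> l') (w' ^ N + 1)"
      using assms(3) param_left[OF w(1), of y l] param_left[OF w'(1), of y' l'] w(2) w'(2) by simp
    then have eq: "- \<beta> l + y = - \<beta> l' + y'" "w ^ N = w' ^ N" "w ^ N + 1 = 0 \<or> \<beta> l = \<beta> l'"
      unfolding pt_eq_iff[OF \<beta>_in \<beta>_in] by auto
    have "0 < Re (w ^ N + 1)"
      using assms(1) unfolding star_def by auto
    then have "w ^ N + 1 \<noteq> 0"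
      by (metis less_irrefl zero_complex.simps(1))
    then have "\<beta> l = \<beta> l'"
      using eq(3) by blast
    then have "rt (4 * l + 2) (w ^ N) = rt (4 * l' + 2) (w ^ N)"
      using w(1) rt_eq_iff(2)[of "w ^ N"] \<beta>_eq_iff by (metis less_irrefl zero_complex.simps(1))
    then have "w = w'"
      using w(2) w'(2) eq(2) by simp
    then show ?thesis
      using same eq \<open>\<beta> l = \<beta> l'\<close> by auto
  qed
qed

lemma minus_neq_self: "a \<in> E \<Longrightarrow> y \<noteq> - a + y"
  using zero_notin add_right_cancel[of 0 y "- a"] by auto

text \<open>A chart could meet itself only along a loop of the graph, and loops are excluded because
  0 is not a label.\<close>

lemma inj_on_param: "inj_on (param y) star"
proof (rule inj_onI)
  fix w w'
  assume "w \<in> star" "w' \<in> star" "param y w = param y w'"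
  then show "w = w'"
    by (cases rule: param_eq_cases) (use minus_neq_self[OF \<beta>_in] in auto)
qed

lemma open_star: "open star"
  unfolding star_def by (intro open_Collect_less continuous_intros)

lemma open_strip: "open {z. a < Re z \<and> Re z < b}"
  by (intro open_Collect_conj open_Collect_less continuous_intros)

text \<open>Between different charts the transition is a translation by 1 of the flat coordinate,
  seen through a power and a root; it is holomorphic because overlaps avoid the vertices.\<close>

lemma param_lift:
  assumes "w \<in> star" "w' \<in> star" "param y w = param y' w'"
  shows "\<exists>W g. open W \<and> w \<in> W \<and> W \<subseteq> star \<and> g holomorphic_on W \<and> g ` W \<subseteq> star \<and>
    (\<forall>v\<in>W. param y' (g v) = param y v)"
  using assms
proof (cases rule: param_eq_cases)
  case same
  then show ?thesis
    using assms open_star by (intro exI[of _ star] exI[of _ "\<lambda>v. v"]) auto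
next
  case (outward k l)
  let ?A = "{z. 0 < Re z \<and> Re z < 1}"
  let ?W = "rt (4 * k) ` ?A" and ?g = "\<lambda>v. rt (4 * l + 2) (v ^ N - 1)"
  have "param y' (rt (4 * l + 2) (z - 1)) = param y (rt (4 * k) z)" if "z \<in> ?A" for z
    using that param_right[of z y k] param_left[of "z - 1" y' l] outward(1,2) by simp
  moreover have "open ?W"
    using N_pos open_strip by (rule open_image_sector_root_right) auto
  moreover have "w \<in> ?W"
    using assms(1) outward(3) by (subst outward(4)) (auto simp: star_def)
  moreover have "?W \<subseteq> star" "?g ` ?W \<subseteq> star"
    by (auto simp: star_def)
  moreover have "?g holomorphic_on ?W"
    by (rule holomorphic_on_compose[of "\<lambda>v. v ^ N - 1" _ "rt (4 * l + 2)", unfolded o_def])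
      (auto intro!: holomorphic_intros holomorphic_on_subset[OF holomorphic_on_sector_root_left])
  ultimately show ?thesis
    by (intro exI[of _ ?W] exI[of _ ?g]) auto
next
  case (inward k l)
  let ?A = "{z. - 1 < Re z \<and> Re z < 0}"
  let ?W = "rt (4 * l + 2) ` ?A" and ?g = "\<lambda>v. rt (4 * k) (v ^ N + 1)"
  have "param y' (rt (4 * k) (z + 1)) = param y (rt (4 * l + 2) z)" if "z \<in> ?A" for z
    using that param_left[of z y l] param_right[of "z + 1" y' k] inward(1,2) by simp
  moreover have "open ?W"
    using N_pos open_strip by (rule open_image_sector_root_left) auto
  moreover have "w \<in> ?W"
    using assms(1) inward(3) by (subst inward(4)) (auto simp: star_def)
  moreover have "?W \<subseteq> star" "?g ` ?W \<subseteq> star"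
    by (auto simp: star_def)
  moreover have "?g holomorphic_on ?W"
    by (rule holomorphic_on_compose[of "\<lambda>v. v ^ N + 1" _ "rt (4 * k)", unfolded o_def])
      (auto intro!: holomorphic_intros holomorphic_on_subset[OF holomorphic_on_sector_root_right])
  ultimately show ?thesis
    by (intro exI[of _ ?W] exI[of _ ?g]) auto
qed

sublocale holomorphic_gluing star param
  by unfold_locales (use open_star inj_on_param param_lift in auto)

lemma topspace_tiles:
  "topspace glued = {pt y a z | y a z. a \<in> E \<and> 0 \<le> Re z \<and> Re z < 1}"
proof (intro set_eqI iffI)
  fix x
  assume "x \<in> topspace glued"
  then obtain y w where "w \<in> star" "x = param y w"
    by (auto simp: topspace_glued)
  then show "x \<in> {pt y a z | y a z. a \<in> E \<and> 0 \<le> Re z \<and> Re z < 1}"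
    by (cases rule: param_exhaust[of w y]) fastforce+
next
  fix x
  assume "x \<in> {pt y a z | y a z. a \<in> E \<and> 0 \<le> Re z \<and> Re z < 1}"
  then obtain y a z where "a \<in> E" "0 \<le> Re z" "Re z < 1" "x = pt y a z"
    by auto
  then obtain w where "w \<in> star" "x = param y w"
    using tile_point_exhaust by metis
  then show "x \<in> topspace glued"
    by (auto simp: topspace_glued)
qed

section \<open>Separation and countability\<close>

definition pos :: "('g \<times> nat \<times> complex) set \<Rightarrow> complex" where
  "pos x = snd (snd (the_elem x))"

lemma pos_pt [simp]: "pos (pt y a z) = z"
  by (simp add: pos_def pt_def)

text \<open>\<open>pos\<close> jumps by 1 where one tile ends and the next begins, and a 1-periodic
  function does not notice the jump.\<close>

lemma continuous_map_periodic_pos: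
  fixes f :: "complex \<Rightarrow> complex"
  assumes "continuous_on UNIV f" "\<And>z. f (z + 1) = f z"
  shows "continuous_map glued euclidean (\<lambda>x. f (pos x))"
  unfolding continuous_map
proof (intro conjI allI impI)
  fix U :: "complex set"
  assume "openin euclidean U"
  have f: "f (pos (param y w)) = f (w ^ N)" if "w \<in> star" for y w
    using that by (cases rule: param_exhaust[of w y]) (auto simp: assms(2))
  have "open {w \<in> star. param y w \<in> {x \<in> topspace glued. f (pos x) \<in> U}}" for y
  proof -
    have "{w \<in> star. param y w \<in> {x \<in> topspace glued. f (pos x) \<in> U}} = star \<inter> (\<lambda>w. f (w ^ N)) -` U"
      by (auto simp: f topspace_glued)
    moreover have "continuous_on star (\<lambda>w. f (w ^ N))"
      by (intro continuous_on_compose2[OF assms(1)] continuous_intros) auto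
    ultimately show ?thesis
      using open_star \<open>openin euclidean U\<close> by (metis continuous_open_preimage open_openin)
  qed
  then show "openin glued {x \<in> topspace glued. f (pos x) \<in> U}"
    unfolding openin_glued by (auto simp: topspace_glued)
qed auto

lemma openin_tile:
  assumes "a \<in> E" "open A" "A \<subseteq> {z. 0 < Re z \<and> Re z < 1}"
  shows "openin glued (pt y a ` A)"
proof -
  obtain k where k: "a = \<alpha> k"
    using assms range_\<alpha> by auto
  have "pt y a ` A = param y ` rt (4 * k) ` A"
    using assms(3) param_right[of _ y k] by (force simp: image_image k intro!: image_cong)
  moreover have "open (rt (4 * k) ` A)"
    using N_pos assms(2) by (rule open_image_sector_root_right) (use assms(3) in auto)
  moreover have "rt (4 * k) ` A \<subseteq> star"
    using assms(3) by (auto simp: star_def)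
  ultimately show ?thesis
    using openin_glued_image by simp
qed

lemma Hausdorff_glued: "Hausdorff_space glued"
  unfolding Hausdorff_space_def
proof (intro allI impI, elim conjE)
  fix x x'
  assume "x \<in> topspace glued" "x' \<in> topspace glued" and "x \<noteq> x'"
  then obtain y a z y' a' z' where x: "x = pt y a z" "a \<in> E" "0 \<le> Re z" "Re z < 1"
    and x': "x' = pt y' a' z'" "a' \<in> E" "0 \<le> Re z'" "Re z' < 1"
    unfolding topspace_tiles by blast
  \<comment> \<open>A 1-periodic function that is injective on the strip
    \<open>0 \<le> Re z < 1\<close>; it separates all points with different tile
    coordinates.\<close>
  let ?f = "\<lambda>z. exp (2 * of_real pi * \<i> * z)"
  show "\<exists>U V. openin glued U \<and> openin glued V \<and> x \<in> U \<and> x' \<in> V \<and> disjnt U V"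
  proof (cases "?f z = ?f z'")
    case False
    then obtain U V where UV: "open U" "open V" "?f z \<in> U" "?f z' \<in> V" "U \<inter> V = {}"
      using hausdorff[OF False] by blast
    have "?f (u + 1) = ?f u" for u
      unfolding distrib_left exp_add mult_1_right exp_two_pi_i by (rule refl)
    then have "continuous_map glued euclidean (\<lambda>x. ?f (pos x))"
      by (intro continuous_map_periodic_pos continuous_intros)
    then have "openin glued {x \<in> topspace glued. ?f (pos x) \<in> W}" if "open W" for W
      using that openin_continuous_map_preimage by fastforce
    moreover have "disjnt {x \<in> topspace glued. ?f (pos x) \<in> U} {x \<in> topspace glued. ?f (pos x) \<in> V}"
      using UV by (auto simp: disjnt_def)
    moreover have "x \<in> topspace glued" "x' \<in> topspace glued"
      using x x' by (auto simp: topspace_tiles)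
    ultimately show ?thesis
      using UV x(1) x'(1)
      by (intro exI[of _ "{x \<in> topspace glued. ?f (pos x) \<in> U}"]
          exI[of _ "{x \<in> topspace glued. ?f (pos x) \<in> V}"]) auto
  next
    case True
    then obtain n :: int where n: "2 * of_real pi * \<i> * z = 2 * of_real pi * \<i> * z' + (of_int (2 * n) * pi) * \<i>"
      by (auto simp: exp_eq)
    have "(2 * of_real pi * \<i>) * z = (2 * of_real pi * \<i>) * (z' + of_int n)"
      unfolding n by (simp add: algebra_simps)
    then have n: "z = z' + of_int n"
      by (subst (asm) mult_cancel_left) simp
    have "\<bar>real_of_int n\<bar> < 1"
      using x x' unfolding n by auto
    then have "z' = z"
      using n by simp
    show ?thesis
    proof (cases "0 < Re z")
      case True
      let ?A = "{z. 0 < Re z \<and> Re z < 1}"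
      have "z \<noteq> 0"
        using True by auto
      have "(y, a) \<noteq> (y', a')"
        using \<open>x \<noteq> x'\<close> x x' \<open>z' = z\<close> by auto
      moreover have "u \<noteq> 0" if "u \<in> ?A" for u
        using that by auto
      ultimately have "disjnt (pt y a ` ?A) (pt y' a' ` ?A)"
        using x(2) x'(2) by (force simp: disjnt_def pt_eq_iff)
      then show ?thesis
        using openin_tile[OF x(2) open_strip, of 0 1 y] openin_tile[OF x'(2) open_strip, of 0 1 y'] True x x' \<open>z' = z\<close>
        by (intro exI[of _ "pt y a ` ?A"] exI[of _ "pt y' a' ` ?A"]) auto
    next
      case False
      obtain w w' where w: "w \<in> star" "w ^ N = z" "x = param y w" and w': "w' \<in> star" "w' ^ N = z" "x' = param y' w'"
        using tile_point_exhaust[OF x(2-4)] tile_point_exhaust[OF x'(2-4)] x(1) x'(1) \<open>z' = z\<close> by metis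
      show ?thesis
      proof (cases "y = y'")
        case True
        then have "w \<noteq> w'"
          using w w' \<open>x \<noteq> x'\<close> by auto
        then obtain U V where UV: "open U" "open V" "w \<in> U" "w' \<in> V" "U \<inter> V = {}"
          using hausdorff[OF \<open>w \<noteq> w'\<close>] by blast
        have "openin glued (param y ` (U \<inter> star))" "openin glued (param y' ` (V \<inter> star))"
          using UV open_star by (auto intro!: openin_glued_image)
        moreover have "disjnt (param y ` (U \<inter> star)) (param y' ` (V \<inter> star))"
          unfolding disjnt_def True[symmetric]
          using UV(5) inj_on_image_Int[OF inj_on_param, of "U \<inter> star" "V \<inter> star" y] by (simp add: Int_ac) (metis Int_empty_right image_empty inf_assoc inf_commute)
        moreover have "x \<in> param y ` (U \<inter> star)" "x' \<in> param y' ` (V \<inter> star)"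
          using UV w w' by auto
        ultimately show ?thesis
          by blast
      next
        case False
        \<comment> \<open>The flat coordinates of a common point of two different charts differ by
          1, which is impossible if both real parts are below 1 / 2 in absolute value.\<close>
        let ?V = "{w. \<bar>Re (w ^ N)\<bar> < 1 / 2}"
        have "open ?V"
          by (intro open_Collect_less continuous_intros)
        moreover have "?V \<subseteq> star"
          by (auto simp: star_def)
        ultimately have "openin glued (param u ` ?V)" for u
          by (rule openin_glued_image)
        moreover have "param y v \<noteq> param y' v'" if v: "v \<in> ?V" "v' \<in> ?V" for v v'
        proof
          assume eq: "param y v = param y' v'"
          have "v \<in> star" "v' \<in> star"
            using v by (auto simp: star_def)
          then show False
            using eq by (cases rule: param_eq_cases) (use False v in auto)
        qed
        then have "disjnt (param y ` ?V) (param y' ` ?V)"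
          unfolding disjnt_def by blast
        moreover have "x \<in> param y ` ?V" "x' \<in> param y' ` ?V"
          using \<open>\<not> 0 < Re z\<close> x(3) w w' by auto
        ultimately show ?thesis
          by blast
      qed
    qed
  qed
qed

text \<open>Overlapping charts have equal or adjacent centres, so the charts reachable from one
  vertex and the remaining charts cover disjoint open sets. A component therefore stays within the
  reachable ones, and these are countably many because there are countably many labels.\<close>

lemma second_countable_component:
  assumes "K \<in> connected_components_of glued"
  shows "second_countable (subtopology glued K)"
proof -
  have conn: "connectedin glued K" and "K \<noteq> {}"
    using assms connectedin_connected_components_of nonempty_connected_components_of by blast+
  then obtain x where "x \<in> K" "x \<in> topspace glued"
    using connectedin_subset_topspace by blast
  then obtain y0 w0 where y0: "w0 \<in> star" "x = param y0 w0"
    by (auto simp: topspace_glued)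
  define adj where "adj = {(y, y'). \<exists>a\<in>E. y' = a + y \<or> y' = - a + y}"
  define R where "R = adj\<^sup>* `` {y0}"
  let ?M = "\<Union>y\<in>R. param y ` star" and ?M' = "\<Union>y\<in>- R. param y ` star"
  have "countable (adj `` Y)" if "countable Y" for Y
  proof -
    have "adj `` Y \<subseteq> (\<Union>y\<in>Y. \<Union>k. {\<alpha> k + y, - \<alpha> k + y})"
      unfolding adj_def range_\<alpha>[symmetric] by auto
    then show ?thesis
      by (rule countable_subset) (use that in auto)
  qed
  then have "countable R"
    unfolding R_def by (intro countable_rtrancl) auto
  have open_M: "openin glued ?M" "openin glued ?M'"
    using openin_glued_image[OF open_star] by auto
  have "?M \<inter> ?M' = {}"
  proof -
    have False if "y \<in> R" "y' \<notin> R" "w \<in> star" "w' \<in> star" "param y w = param y' w'" for y y' w w'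
    proof -
      have "(y, y') \<in> adj \<or> y = y'"
        using that(3-5)
      proof (cases rule: param_eq_cases)
        case (outward k l)
        then have "y' = \<beta> l + y"
          by (simp add: add.assoc[symmetric])
        then show ?thesis
          by (auto simp: adj_def)
      qed (auto simp: adj_def)
      then show False
        using that(1,2) unfolding R_def by (auto intro: rtrancl.rtrancl_into_rtrancl)
    qed
    then show ?thesis
      by blast
  qed
  moreover have "K \<subseteq> ?M \<union> ?M'"
  proof
    fix u
    assume "u \<in> K"
    then obtain y where "u \<in> param y ` star"
      using connectedin_subset_topspace[OF conn] unfolding topspace_glued by (meson UN_E subsetD)
    then show "u \<in> ?M \<union> ?M'"
      by (cases "y \<in> R") auto
  qed
  moreover have "x \<in> K \<inter> ?M"
    using \<open>x \<in> K\<close> y0 by (auto simp: R_def)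
  ultimately have "K \<subseteq> ?M"
    by (rule connectedin_subset_of_disjoint_open[OF conn open_M])
  then have "subtopology glued K = subtopology (subtopology glued ?M) K"
    by (simp add: subtopology_subtopology inf.absorb2)
  then show ?thesis
    using second_countable_subtopology[OF second_countable_Union_params[OF \<open>countable R\<close>]] by simp
qed

lemma surface_glued: "surface glued"
  unfolding surface_def
proof (intro conjI ballI)
  fix x
  assume "x \<in> topspace glued"
  then obtain y where "x \<in> param y ` star"
    by (auto simp: topspace_glued)
  then show "\<exists>U c. x \<in> U \<and> plane_chart glued U c"
    using plane_chart_param by blast
qed (use Hausdorff_glued second_countable_component in auto)

end

section \<open>Faces and their closures\<close>

lemma connected_components_of_open_partition:
  assumes P: "\<And>F. F \<in> P \<Longrightarrow> openin X F \<and> connectedin X F \<and> F \<noteq> {}"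
    and disj: "\<And>F F'. \<lbrakk>F \<in> P; F' \<in> P; F \<inter> F' \<noteq> {}\<rbrakk> \<Longrightarrow> F = F'"
    and cover: "topspace X = \<Union>P"
  shows "connected_components_of X = P"
proof -
  have comp: "connected_component_of_set X x = F" if "F \<in> P" "x \<in> F" for F x
  proof (rule antisym)
    show "F \<subseteq> connected_component_of_set X x"
      using P that by (intro connected_component_of_maximal) auto
    show "connected_component_of_set X x \<subseteq> F"
    proof (rule connectedin_subset_of_disjoint_open)
      show "connectedin X (connected_component_of_set X x)"
        by (rule connectedin_connected_component_of)
      show "openin X F" "openin X (\<Union>(P - {F}))"
        using P that by auto
      show "F \<inter> \<Union>(P - {F}) = {}"
        using disj that by blast
      show "connected_component_of_set X x \<subseteq> F \<union> \<Union>(P - {F})"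
        using connected_component_of_subset_topspace[of X x] that unfolding cover by blast
      show "x \<in> connected_component_of_set X x \<inter> F"
        using that cover connected_component_of_refl[of X x] by auto
    qed
  qed
  show ?thesis
  proof (intro set_eqI iffI)
    fix F
    assume "F \<in> connected_components_of X"
    then obtain x where "x \<in> topspace X" "F = connected_component_of_set X x"
      by (auto simp: connected_components_of_def)
    then show "F \<in> P"
      using comp unfolding cover by auto
  next
    fix F
    assume "F \<in> P"
    then obtain x where "x \<in> F" "x \<in> topspace X"
      using P cover by blast
    then show "F \<in> connected_components_of X"
      unfolding connected_components_of_def using comp[OF \<open>F \<in> P\<close>] by blast
  qed
qed

lemma edge_point_flip: "edge_point u v t = edge_point v u (1 - t)"
  by (auto simp: edge_point_def)

lemma edge_point_0: "edge_point u v 0 = vertex_point u"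
  by (simp add: edge_point_def)

section \<open>Developing half-cylinders along walks\<close>

context vertex_rotation
begin

text \<open>Walks of both sides follow the direction of the edges, so that \<open>Re\<close>
  increases along the tiles; row circuits are therefore read backwards. At each vertex the walk
  enters on \<open>\<beta> k\<close> and leaves on a neighbour in the rotation,
  \<open>\<alpha> k\<close> on the upper side and \<open>\<alpha> (k + 1)\<close> on the
  lower.\<close>

definition boundary_walk :: "int \<Rightarrow> (int \<Rightarrow> 'g) \<Rightarrow> (int \<Rightarrow> 'g) \<Rightarrow> bool" where
  "boundary_walk s v a \<longleftrightarrow> (s = 1 \<or> s = - 1) \<and>
     (\<forall>n. v (n + 1) = a n + v n \<and> (\<exists>k. a n = \<beta> k \<and> a (n + 1) = \<alpha> (if s = 1 then k else k + 1)))"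

text \<open>The developing map of a walk: it unrolls the half-cylinder and lays its tiles side by
  side.\<close>

definition develop :: "(int \<Rightarrow> 'g) \<Rightarrow> (int \<Rightarrow> 'g) \<Rightarrow> complex \<Rightarrow> ('g \<times> nat \<times> complex) set" where
  "develop v a z = pt (v \<lfloor>Re z\<rfloor>) (a \<lfloor>Re z\<rfloor>) (z - of_int \<lfloor>Re z\<rfloor>)"

lemma develop_tile:
  assumes "0 \<le> Re z" "Re z < 1"
  shows "develop v a (of_int n + z) = pt (v n) (a n) z"
proof -
  have "\<lfloor>Re (of_int n + z)\<rfloor> = n"
    using assms by (simp add: floor_eq_iff)
  then show ?thesis
    by (simp add: develop_def)
qed

lemma boundary_walk_edge_in:
  assumes "boundary_walk s v a"
  shows "a n \<in> E"
  using assms \<beta>_in unfolding boundary_walk_def by metis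

text \<open>The turn condition of \<open>boundary_walk\<close> is exactly the index pattern of
  \<open>continuous_on_half_plane_root\<close>, so near each vertex the developing map is a chart
  composed with one continuous branch.\<close>

lemma develop_local:
  assumes walk: "boundary_walk s v a"
  obtains c where "continuous_on {z. 0 \<le> s * Im z} c" "\<And>z. c z ^ N = z"
    "\<And>z. \<lbrakk>- 1 < Re z; Re z < 1\<rbrakk> \<Longrightarrow> develop v a (of_int n + z) = param (v n) (c z)"
proof -
  obtain k where k: "a (n - 1) = \<beta> k" "a (n - 1 + 1) = \<alpha> (if s = 1 then k else k + 1)"
    and v: "v (n - 1 + 1) = a (n - 1) + v (n - 1)" and s: "s = 1 \<or> s = - 1"
    using walk unfolding boundary_walk_def by blast
  let ?c = "\<lambda>z. if 0 \<le> Re z then rt (4 * (if s = 1 then k else k + 1)) z else rt (4 * k + 2) z"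
  show ?thesis
  proof (rule that[of ?c])
    have "real_of_int s = 1 \<or> real_of_int s = - 1"
      using s by auto
    from continuous_on_half_plane_root[OF N_pos this, of k]
    show "continuous_on {z. 0 \<le> s * Im z} ?c"
      by (simp only: of_int_eq_1_iff)
    show "?c z ^ N = z" for z
      by simp
    fix z
    assume z: "- 1 < Re z" "Re z < 1"
    show "develop v a (of_int n + z) = param (v n) (?c z)"
    proof (cases "0 \<le> Re z")
      case True
      then show ?thesis
        using z k develop_tile[of z v a n] by (simp add: param_right)
    next
      case False
      have "develop v a (of_int n + z) = develop v a (of_int (n - 1) + (z + 1))"
        by simp
      also have "\<dots> = pt (v (n - 1)) (a (n - 1)) (z + 1)"
        by (rule develop_tile) (use z False in auto)
      also have "\<dots> = param (v n) (rt (4 * k + 2) z)"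
        using False k v by (simp add: param_left add.assoc[symmetric])
      finally show ?thesis
        using False by simp
    qed
  qed
qed

lemma continuous_map_develop:
  assumes walk: "boundary_walk s v a"
  shows "continuous_map (top_of_set {z. 0 \<le> s * Im z}) glued (develop v a)"
proof (rule pasting_lemma)
  let ?H = "{z. 0 \<le> s * Im z}"
  \<comment> \<open>Windows of width 2 centred at the vertices overlap, so they also cover the seams
    between tiles.\<close>
  define T where "T n = ?H \<inter> {z. of_int n - 1 < Re z \<and> Re z < of_int n + 1}" for n :: int
  show "openin (top_of_set ?H) (T n)" for n
    unfolding T_def by (intro openin_open_Int open_strip)
  show "\<exists>j. j \<in> UNIV \<and> z \<in> T j \<and> develop v a z = develop v a z" if "z \<in> topspace (top_of_set ?H)" for z
    using that by (intro exI[of _ "\<lfloor>Re z\<rfloor>"]) (auto simp: T_def; linarith)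
  show "continuous_map (subtopology (top_of_set ?H) (T n)) glued (develop v a)" for n
  proof -
    obtain c where c: "continuous_on ?H c" "\<And>z. c z ^ N = z"
      "\<And>z. \<lbrakk>- 1 < Re z; Re z < 1\<rbrakk> \<Longrightarrow> develop v a (of_int n + z) = param (v n) (c z)"
      using develop_local[OF walk] by metis
    have "continuous_on (T n) (\<lambda>z. c (z - of_int n))"
      by (intro continuous_on_compose2[OF c(1)] continuous_intros) (auto simp: T_def)
    moreover have "c (z - of_int n) \<in> star" if "z \<in> T n" for z
      using that by (auto simp: star_def c(2) T_def)
    ultimately have "continuous_map (top_of_set (T n)) glued (param (v n) \<circ> (\<lambda>z. c (z - of_int n)))"
      by (intro continuous_map_compose[OF _ continuous_map_param]) auto
    moreover have "(param (v n) \<circ> (\<lambda>z. c (z - of_int n))) z = develop v a z" if "z \<in> T n" for z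
      using c(3)[of "z - of_int n"] that by (auto simp: T_def)
    ultimately have "continuous_map (top_of_set (T n)) glued (develop v a)"
      by (rule continuous_map_eq) simp
    moreover have "subtopology (top_of_set ?H) (T n) = top_of_set (T n)"
      by (auto simp: subtopology_subtopology T_def Int_ac)
    ultimately show ?thesis
      by simp
  qed
qed simp

definition face :: "int \<Rightarrow> (int \<Rightarrow> 'g) \<Rightarrow> (int \<Rightarrow> 'g) \<Rightarrow> ('g \<times> nat \<times> complex) set set" where
  "face s v a = develop v a ` {z. 0 < s * Im z}"

lemma mem_face_iff:
  "x \<in> face s v a \<longleftrightarrow> (\<exists>n z. x = pt (v n) (a n) z \<and> 0 \<le> Re z \<and> Re z < 1 \<and> 0 < s * Im z)"
proof
  assume "x \<in> face s v a"
  then obtain z where z: "x = develop v a z" "0 < s * Im z"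
    by (auto simp: face_def)
  then show "\<exists>n z. x = pt (v n) (a n) z \<and> 0 \<le> Re z \<and> Re z < 1 \<and> 0 < s * Im z"
    by (intro exI[of _ "\<lfloor>Re z\<rfloor>"] exI[of _ "z - of_int \<lfloor>Re z\<rfloor>"]) (auto simp: develop_def; linarith)
next
  assume "\<exists>n z. x = pt (v n) (a n) z \<and> 0 \<le> Re z \<and> Re z < 1 \<and> 0 < s * Im z"
  then obtain n z where "x = pt (v n) (a n) z" "0 \<le> Re z" "Re z < 1" "0 < s * Im z"
    by blast
  then show "x \<in> face s v a"
    unfolding face_def using develop_tile[of z v a n] by (intro image_eqI[of _ _ "of_int n + z"]) auto
qed

lemma open_half_plane: "open {z. 0 < of_int s * Im z}"
  by (intro open_Collect_less continuous_intros)

lemma openin_face: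
  assumes walk: "boundary_walk s v a"
  shows "openin glued (face s v a)"
proof -
  let ?A = "{z. - 1 < Re z \<and> Re z < 1} \<inter> {z. 0 < s * Im z}"
  have "openin glued ((\<lambda>z. develop v a (of_int n + z)) ` ?A)" for n
  proof -
    obtain c where c: "continuous_on {z. 0 \<le> s * Im z} c" "\<And>z. c z ^ N = z"
      "\<And>z. \<lbrakk>- 1 < Re z; Re z < 1\<rbrakk> \<Longrightarrow> develop v a (of_int n + z) = param (v n) (c z)"
      using develop_local[OF walk] by metis
    \<comment> \<open>Invariance of domain needs only continuity and injectivity of
      \<open>c\<close>, and \<open>c\<close> is injective because the \<open>N\<close>-th power
      undoes it.\<close>
    have "open (c ` ?A)"
    proof (rule invariance_of_domain)
      show "continuous_on ?A c"
        using c(1) by (rule continuous_on_subset) auto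
      show "open ?A"
        by (intro open_Int open_strip open_half_plane)
      show "inj_on c ?A"
        by (rule inj_onI) (metis c(2))
    qed
    moreover have "c ` ?A \<subseteq> star"
      by (auto simp: star_def c(2))
    ultimately have "openin glued (param (v n) ` c ` ?A)"
      by (rule openin_glued_image)
    moreover have "(\<lambda>z. develop v a (of_int n + z)) ` ?A = param (v n) ` c ` ?A"
      unfolding image_image by (rule image_cong) (auto simp: c(3))
    ultimately show ?thesis
      by simp
  qed
  moreover have "face s v a = (\<Union>n. (\<lambda>z. develop v a (of_int n + z)) ` ?A)"
  proof
    show "face s v a \<subseteq> (\<Union>n. (\<lambda>z. develop v a (of_int n + z)) ` ?A)"
    proof
      fix x
      assume "x \<in> face s v a"
      then obtain n z where "x = pt (v n) (a n) z" "0 \<le> Re z" "Re z < 1" "0 < s * Im z"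
        unfolding mem_face_iff by blast
      then show "x \<in> (\<Union>n. (\<lambda>z. develop v a (of_int n + z)) ` ?A)"
        using develop_tile[of z v a n] by (intro UN_I[of n] image_eqI[of _ _ z]) auto
    qed
  qed (auto simp: face_def)
  ultimately show ?thesis
    by auto
qed

lemma connectedin_face:
  assumes walk: "boundary_walk s v a"
  shows "connectedin glued (face s v a)"
  unfolding face_def
proof (rule connectedin_continuous_map_image[OF continuous_map_develop[OF walk]])
  have "s = 1 \<or> s = - 1"
    using walk by (simp add: boundary_walk_def)
  then have "convex {z. 0 < s * Im z}"
    using convex_halfspace_Im_gt[of 0] convex_halfspace_Im_lt[of 0] by auto
  then show "connectedin (top_of_set {z. 0 \<le> s * Im z}) {z. 0 < s * Im z}"
    by (auto simp: connectedin_subtopology convex_connected)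
qed

lemma Im_pos_develop [simp]: "Im (pos (develop v a z)) = Im z"
  by (simp add: develop_def)

lemma face_nonempty:
  assumes "boundary_walk s v a"
  shows "face s v a \<noteq> {}"
proof -
  have "\<i> * of_int s \<in> {z. 0 < s * Im z}"
    using assms by (auto simp: boundary_walk_def)
  then show ?thesis
    unfolding face_def by blast
qed

text \<open>A real point has a neighbourhood made of the tiles around it: the chart at a vertex, the
  open tile at an inner point of an edge. A face that meets this neighbourhood uses one of these
  tiles, so its walk passes through the point.\<close>

lemma closure_of_face_pos:
  assumes walk: "boundary_walk s v a" and "x \<in> glued closure_of face s v a" "Im (pos x) = 0"
  shows "x \<in> develop v a ` {z. Im z = 0}"
proof -
  have "x \<in> topspace glued" and U: "\<And>U. \<lbrakk>x \<in> U; openin glued U\<rbrakk> \<Longrightarrow> U \<inter> face s v a \<noteq> {}"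
    using assms(2) by (auto simp: in_closure_of)
  then obtain y b z where x: "x = pt y b z" "b \<in> E" "0 \<le> Re z" "Re z < 1"
    unfolding topspace_tiles by blast
  then have "Im z = 0"
    using assms(3) by simp
  have a: "a n \<in> E" for n
    by (rule boundary_walk_edge_in[OF walk])
  show ?thesis
  proof (cases "z = 0")
    case True
    obtain w where "w \<in> star" "x = param y w"
      using tile_point_exhaust[OF x(2-4)] x(1) by metis
    then have "param y ` star \<inter> face s v a \<noteq> {}"
      by (intro U openin_glued_image open_star) auto
    then obtain w' n z' where w': "w' \<in> star" "param y w' = pt (v n) (a n) z'" "0 < s * Im z'"
      by (auto simp: mem_face_iff)
    have "z' \<noteq> 0"
      using w'(3) by auto
    obtain m where m: "y = v m"
      using w'(1)
    proof (cases rule: param_exhaust[of w' y])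
      case (1 a' u)
      then have "y = v n"
        using w'(2) a by (simp add: pt_eq_iff)
      then show ?thesis
        by (rule that)
    next
      case (2 a' u)
      then have "- a' + y = v n" "a' = a n"
        using w'(2) \<open>z' \<noteq> 0\<close> a by (auto simp: pt_eq_iff)
      moreover have "v (n + 1) = a n + v n"
        using walk by (simp add: boundary_walk_def)
      ultimately have "y = v (n + 1)"
        by (metis add_minus_cancel)
      then show ?thesis
        by (rule that)
    qed
    have "develop v a (of_int m) = x"
      using develop_tile[of 0 v a m] True x(1) m pt_0 by simp
    then show ?thesis
      by (intro image_eqI[of _ _ "of_int m"]) auto
  next
    case False
    let ?A = "{z. 0 < Re z \<and> Re z < 1}"
    have "z \<in> ?A"
      using False x \<open>Im z = 0\<close> by (auto simp: complex_eq_iff)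
    then have "pt y b ` ?A \<inter> face s v a \<noteq> {}"
      using x by (intro U openin_tile open_strip) auto
    then obtain u n z' where u: "pt y b u = pt (v n) (a n) z'" "u \<in> ?A"
      unfolding mem_face_iff disjoint_iff image_iff by blast
    then have "u \<noteq> 0"
      by auto
    then have "y = v n" "b = a n"
      using u(1) x(2) a by (auto simp: pt_eq_iff)
    then have "x = develop v a (of_int n + z)"
      using x develop_tile[of z v a n] by simp
    then show ?thesis
      using \<open>Im z = 0\<close> by (intro image_eqI[of _ _ "of_int n + z"]) auto
  qed
qed

lemma develop_real_in_closure_of_face:
  assumes walk: "boundary_walk s v a" and "Im z = 0"
  shows "develop v a z \<in> glued closure_of face s v a"
proof -
  let ?H = "{z. 0 \<le> s * Im z}"
  have s: "s = 1 \<or> s = - 1"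
    using walk by (simp add: boundary_walk_def)
  have "z \<in> top_of_set ?H closure_of {z. 0 < s * Im z}"
    unfolding in_closure_of
  proof (intro conjI allI impI)
    show "z \<in> topspace (top_of_set ?H)"
      using assms(2) by simp
    fix T
    assume T: "z \<in> T \<and> openin (top_of_set ?H) T"
    then obtain e where e: "e > 0" "ball z e \<inter> ?H \<subseteq> T"
      unfolding openin_contains_ball by blast
    let ?u = "z + \<i> * of_int s * of_real (e / 2)"
    have "norm (\<i> * of_int s * of_real (e / 2)) < e"
      using e(1) s by (auto simp: norm_mult)
    then have "?u \<in> ball z e"
      by (simp add: dist_norm)
    moreover have "0 < s * Im ?u"
      using s e(1) assms(2) by auto
    ultimately show "\<exists>u. u \<in> {z. 0 < s * Im z} \<and> u \<in> T"
      using e(2) by (intro exI[of _ ?u]) auto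
  qed
  then show ?thesis
    unfolding face_def
    using continuous_map_image_closure_subset[OF continuous_map_develop[OF walk]] by blast
qed

text \<open>Every edge is parametrized in the direction of its label, with \<open>t < 1\<close>
  since its end is the start of another edge. A vertex has one decoding for each outgoing edge;
  \<open>SOME\<close> is harmless because \<open>pt\<close> forgets the label at 0.\<close>

definition embed :: "('g \<Rightarrow> real) \<Rightarrow> ('g \<times> nat \<times> complex) set" where
  "embed f = (SOME x. \<exists>y b t. b \<in> E \<and> 0 \<le> t \<and> t < 1 \<and> f = edge_point y (b + y) t \<and> x = pt y b (of_real t))"

lemma add_neq_self: "b \<in> E \<Longrightarrow> b + y \<noteq> y"
  using zero_notin add_right_cancel[of b y 0] by auto

text \<open>Reading an edge from its other end replaces the label by its negative, which is not a
  label.\<close>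

lemma oriented_edge_unique:
  assumes "b \<in> E" "b' \<in> E" "{y, b + y} = {y', b' + y'}"
  shows "y = y' \<and> b = b'"
proof -
  have False if "y = b' + y'" "b + y = y'"
  proof -
    have "b + b' + y' = 0 + y'"
      using that by (simp add: add.assoc)
    then have "b = - b'"
      unfolding add_right_cancel by (simp add: eq_neg_iff_add_eq_0)
    then show False
      using assms minus_notin by blast
  qed
  then show ?thesis
    using assms(3) by (auto simp: doubleton_eq_iff)
qed

text \<open>The support of the barycentric coordinates recovers the vertex or the edge, and the
  coordinate at \<open>y\<close> recovers \<open>t\<close>.\<close>

lemma edge_point_eqD:
  assumes "b \<in> E" "b' \<in> E" "0 \<le> t" "t < 1" "0 \<le> t'" "t' < 1"
    and eq: "edge_point y (b + y) t = edge_point y' (b' + y') t'"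
  shows "y = y' \<and> t = t' \<and> (t = 0 \<or> b = b')"
proof -
  have supp: "{x. edge_point y (b + y) t x \<noteq> 0} = (if t = 0 then {y} else {y, b + y})"
    if "b \<in> E" "0 \<le> t" "t < 1" for y b and t :: real
    using that add_neq_self[of b y] by (auto simp: edge_point_def vertex_point_def)
  have val: "edge_point y (b + y) t y = 1 - t" if "b \<in> E" for y b and t :: real
    using add_neq_self[OF that, of y] by (auto simp: edge_point_def vertex_point_def)
  have eq_supp: "(if t = 0 then {y} else {y, b + y}) = (if t' = 0 then {y'} else {y', b' + y'})"
    using supp[of b t y] supp[of b' t' y'] assms by simp
  have "y = y' \<and> (t = 0 \<or> b = b')"
  proof (cases "t = 0")
    case True
    then show ?thesis
      using eq_supp add_neq_self[OF assms(2), of y'] by (auto split: if_splits)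
  next
    case False
    then have "{y, b + y} = {y', b' + y'}"
      using eq_supp add_neq_self[OF assms(1), of y] by (auto split: if_splits)
    then show ?thesis
      using oriented_edge_unique assms by blast
  qed
  then show ?thesis
    using val[OF assms(1), of y t] val[OF assms(2), of y' t'] eq by simp
qed

lemma embed_edge_point:
  assumes "b \<in> E" "0 \<le> t" "t < 1"
  shows "embed (edge_point y (b + y) t) = pt y b (of_real t)"
  unfolding embed_def
proof (rule some_equality)
  fix x
  assume "\<exists>y' b' t'. b' \<in> E \<and> 0 \<le> t' \<and> t' < 1 \<and> edge_point y (b + y) t = edge_point y' (b' + y') t' \<and>
    x = pt y' b' (of_real t')"
  then obtain y' b' t' where *: "b' \<in> E" "0 \<le> t'" "t' < 1"
    "edge_point y (b + y) t = edge_point y' (b' + y') t'" "x = pt y' b' (of_real t')"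
    by blast
  then show "x = pt y b (of_real t)"
    using edge_point_eqD[of b b' t t' y y'] assms by (auto simp: pt_eq_iff)
qed (use assms in blast)

lemma embed_vertex_point:
  assumes "b \<in> E"
  shows "embed (vertex_point y) = pt y b 0"
  using embed_edge_point[of b 0 y] assms by (simp add: edge_point_0)

lemma embed_edge_point_develop:
  assumes walk: "boundary_walk s v a" and "0 \<le> t" "t \<le> 1"
  shows "embed (edge_point (v n) (v (n + 1)) t) = develop v a (of_int n + of_real t)"
proof -
  have v: "v (n + 1) = a n + v n"
    using walk by (simp add: boundary_walk_def)
  note a = boundary_walk_edge_in[OF walk]
  show ?thesis
  proof (cases "t = 1")
    case True
    \<comment> \<open>At \<open>t = 1\<close> the floor has moved on, so the end of edge
      \<open>n\<close> is represented as the start of tile \<open>n + 1\<close>.\<close>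
    have "develop v a (of_int n + of_real t) = pt (v (n + 1)) (a (n + 1)) 0"
      using develop_tile[of 0 v a "n + 1"] True by simp
    moreover have "edge_point (v n) (v (n + 1)) t = vertex_point (v (n + 1))"
      using True by (simp add: edge_point_def)
    ultimately show ?thesis
      using embed_vertex_point[OF a] by simp
  next
    case False
    then show ?thesis
      unfolding v using embed_edge_point[OF a] develop_tile[of "of_real t" v a n] assms by simp
  qed
qed

lemma edge_cases:
  assumes "{u, v} \<in> cayley_edges E"
  obtains b where "b \<in> E" "v = b + u" | b where "b \<in> E" "u = b + v"
  using assms by (auto simp: cayley_edges_def doubleton_eq_iff)

text \<open>Every vertex is the start of some edge since \<open>E\<close> is nonempty, and an edge
  named against its direction is reversed by \<open>edge_point_flip\<close>.\<close>

lemma realization_eq: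
  "realization UNIV (cayley_edges E) = {edge_point y (b + y) t | y b t. b \<in> E \<and> 0 \<le> t \<and> t < 1}"
proof -
  obtain b0 where b0: "b0 \<in> E"
    using \<alpha>_in by blast
  have vertex: "vertex_point y \<in> {edge_point y (b + y) t | y b t. b \<in> E \<and> 0 \<le> t \<and> t < 1}" for y
    using b0 edge_point_0[of y "b0 + y"] by (metis (mono_tags, lifting) less_eq_real_def mem_Collect_eq zero_less_one)
  have edge: "edge_point y (b + y) t \<in> {edge_point y (b + y) t | y b t. b \<in> E \<and> 0 \<le> t \<and> t < 1}"
    if "b \<in> E" "0 \<le> t" "t \<le> 1" for y b t
  proof (cases "t = 1")
    case True
    then have "edge_point y (b + y) t = vertex_point (b + y)"
      by (simp add: edge_point_def)
    then show ?thesis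
      using vertex by simp
  next
    case False
    then show ?thesis
      using that by force
  qed
  have "edge_point u v t \<in> {edge_point y (b + y) t | y b t. b \<in> E \<and> 0 \<le> t \<and> t < 1}"
    if "{u, v} \<in> cayley_edges E" "0 \<le> t" "t \<le> 1" for u v t
    using that(1)
  proof (cases rule: edge_cases)
    case (1 b)
    then show ?thesis
      using edge[of b t u] that by simp
  next
    case (2 b)
    then show ?thesis
      using edge[of b "1 - t" v] that edge_point_flip[of u v t] by simp
  qed
  moreover have "{y, b + y} \<in> cayley_edges E" if "b \<in> E" for y b
    using that by (auto simp: cayley_edges_def)
  ultimately show ?thesis
    unfolding realization_def using vertex by (fastforce simp: image_subset_iff)
qed

lemma inj_on_embed: "inj_on embed (realization UNIV (cayley_edges E))"
proof (rule inj_onI)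
  fix f f'
  assume "f \<in> realization UNIV (cayley_edges E)" "f' \<in> realization UNIV (cayley_edges E)" "embed f = embed f'"
  then obtain y b t y' b' t' where *: "f = edge_point y (b + y) t" "b \<in> E" "0 \<le> t" "t < 1"
    "f' = edge_point y' (b' + y') t'" "b' \<in> E" "0 \<le> t'" "t' < 1" "pt y b (of_real t) = pt y' b' (of_real t')"
    unfolding realization_eq by (auto simp: embed_edge_point)
  then show "f = f'"
    by (auto simp: pt_eq_iff edge_point_0)
qed

lemma image_embed_realization:
  "embed ` realization UNIV (cayley_edges E) = {x \<in> topspace glued. Im (pos x) = 0}"
proof (intro set_eqI iffI)
  fix x
  assume "x \<in> embed ` realization UNIV (cayley_edges E)"
  then show "x \<in> {x \<in> topspace glued. Im (pos x) = 0}"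
    unfolding realization_eq topspace_tiles by (force simp: embed_edge_point)
next
  fix x
  assume "x \<in> {x \<in> topspace glued. Im (pos x) = 0}"
  then obtain y b z where x: "x = pt y b z" "b \<in> E" "0 \<le> Re z" "Re z < 1" "Im z = 0"
    unfolding topspace_tiles by force
  then have "x = embed (edge_point y (b + y) (Re z))"
    by (simp add: embed_edge_point complex_is_Real_iff)
  then show "x \<in> embed ` realization UNIV (cayley_edges E)"
    unfolding realization_eq using x by blast
qed

end

section \<open>Circuits and face boundaries\<close>

context vertex_rotation
begin

text \<open>The circuits of the side \<open>s\<close> traverse every edge once, for \<open>s = 1\<close> from \<open>y\<close> to \<open>b + y\<close> and for
  \<open>s = - 1\<close> from \<open>b + y\<close> to \<open>y\<close>, and turn at every vertex to a neighbour in the rotation.\<close>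

definition circuit_system :: "int \<Rightarrow> 'g list set \<Rightarrow> ('g list \<Rightarrow> nat \<Rightarrow> 'g) \<Rightarrow> bool" where
  "circuit_system s C lab \<longleftrightarrow>
     (\<forall>w\<in>C. w \<noteq> [] \<and> (\<forall>j<length w.
        w ! (Suc j mod length w) = (if s = 1 then lab w j else - lab w j) + w ! j \<and>
        (\<exists>k. if s = 1 then lab w j = \<beta> k \<and> lab w (Suc j mod length w) = \<alpha> k
             else lab w (Suc j mod length w) = \<beta> k \<and> lab w j = \<alpha> (k + 1)))) \<and>
     (\<forall>y. \<forall>b\<in>E. \<exists>!(w, j). w \<in> C \<and> j < length w \<and> w ! j = y \<and> lab w j = b)"

text \<open>Vertex \<open>n\<close> of the boundary walk; for \<open>s = - 1\<close> the walk runs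
  against the circuit.\<close>

definition ver :: "int \<Rightarrow> 'g list \<Rightarrow> int \<Rightarrow> 'g" where
  "ver s w n = w ! nat ((s * n) mod int (length w))"

text \<open>\<open>lab w j\<close> belongs to the step from position \<open>j\<close> to
  \<open>j + 1\<close>. In the reversed walk the step from position \<open>- n\<close> to
  \<open>- n - 1\<close> is the step of the circuit at \<open>- n - 1\<close>, hence the
  offset.\<close>

definition edg :: "('g list \<Rightarrow> nat \<Rightarrow> 'g) \<Rightarrow> int \<Rightarrow> 'g list \<Rightarrow> int \<Rightarrow> 'g" where
  "edg lab s w n = lab w (nat ((if s = 1 then n else - n - 1) mod int (length w)))"

end

lemma nat_mod_Suc:
  assumes "0 < l"
  shows "nat ((n + 1) mod int l) = Suc (nat (n mod int l)) mod l"
proof -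
  have "int (Suc (nat (n mod int l)) mod l) = (n + 1) mod int l"
    using assms by (simp add: zmod_int mod_add_right_eq add.commute)
  then show ?thesis
    by (metis nat_int)
qed

section \<open>The circuits of one side\<close>

locale side_circuits = vertex_rotation +
  fixes s :: int and C :: "'a list set" and lab :: "'a list \<Rightarrow> nat \<Rightarrow> 'a"
  assumes s: "s = 1 \<or> s = - 1"
    and system: "circuit_system s C lab"
begin

lemma circuit_nonempty: "w \<in> C \<Longrightarrow> 0 < length w"
  using system by (auto simp: circuit_system_def)

lemma boundary_walk_circuit:
  assumes "w \<in> C"
  shows "boundary_walk s (ver s w) (edg lab s w)"
  unfolding boundary_walk_def
proof (intro conjI allI)
  show "s = 1 \<or> s = - 1"
    by (rule s)
  fix n
  let ?l = "int (length w)"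
  have l: "0 < length w"
    using circuit_nonempty assms .
  have idx: "nat (i mod ?l) < length w" for i
    using l by (simp add: nat_less_iff)
  have step: "w ! (Suc j mod length w) = (if s = 1 then lab w j else - lab w j) + w ! j \<and>
      (\<exists>k. if s = 1 then lab w j = \<beta> k \<and> lab w (Suc j mod length w) = \<alpha> k
           else lab w (Suc j mod length w) = \<beta> k \<and> lab w j = \<alpha> (k + 1))" if "j < length w" for j
    using system assms that unfolding circuit_system_def by blast
  have "ver s w (n + 1) = edg lab s w n + ver s w n \<and>
      (\<exists>k. edg lab s w n = \<beta> k \<and> edg lab s w (n + 1) = \<alpha> (if s = 1 then k else k + 1))"
    using s
  proof
    assume "s = 1"
    then show ?thesis
      using step[OF idx[of n]] by (simp add: ver_def edg_def nat_mod_Suc[OF l])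
  next
    assume s': "s = - 1"
    \<comment> \<open>Positions of the edges \<open>n\<close> and \<open>n + 1\<close> of the
      reversed walk. In the circuit \<open>j\<close> follows \<open>i\<close>, and the turn from
      \<open>i\<close> to \<open>j\<close>, read backwards, is the required turn of the
      walk.\<close>
    define j where "j = nat ((- n - 1) mod ?l)"
    define i where "i = nat ((- n - 2) mod ?l)"
    have "- n - 1 + 1 = - n" "- n - 2 + 1 = - n - 1"
      by simp_all
    then have "nat (- n mod ?l) = Suc j mod length w" "j = Suc i mod length w"
      using nat_mod_Suc[OF l, of "- n - 1"] nat_mod_Suc[OF l, of "- n - 2"] by (simp_all only: j_def i_def)
    moreover have "j < length w" "i < length w"
      using idx by (simp_all add: j_def i_def)
    moreover have "ver s w (n + 1) = w ! j" "ver s w n = w ! nat (- n mod ?l)"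
      "edg lab s w n = lab w j" "edg lab s w (n + 1) = lab w i"
    proof -
      have "s * (n + 1) = - n - 1" "s * n = - n" "- (n + 1) - 1 = - n - 2"
        using s' by simp_all
      then show "ver s w (n + 1) = w ! j" "ver s w n = w ! nat (- n mod ?l)"
        "edg lab s w n = lab w j" "edg lab s w (n + 1) = lab w i"
        using s' by (simp_all only: ver_def edg_def j_def i_def) simp_all
    qed
    moreover have "w ! (Suc j mod length w) = - lab w j + w ! j"
      "\<exists>k. lab w (Suc i mod length w) = \<beta> k \<and> lab w i = \<alpha> (k + 1)"
      using step[OF \<open>j < length w\<close>] step[OF \<open>i < length w\<close>] s' by simp_all
    ultimately have "ver s w (n + 1) = edg lab s w n + ver s w n"
      "\<exists>k. edg lab s w n = \<beta> k \<and> edg lab s w (n + 1) = \<alpha> (k + 1)"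
      by (simp_all only: add_minus_cancel)
    then show ?thesis
      using s' by simp
  qed
  then show "ver s w (n + 1) = edg lab s w n + ver s w n"
    and "\<exists>k. edg lab s w n = \<beta> k \<and> edg lab s w (n + 1) = \<alpha> (if s = 1 then k else k + 1)"
    by blast+
qed

abbreviation \<psi> :: "'a list \<Rightarrow> complex \<Rightarrow> ('a \<times> nat \<times> complex) set" where
  "\<psi> w \<equiv> develop (ver s w) (edg lab s w)"

abbreviation F :: "'a list \<Rightarrow> ('a \<times> nat \<times> complex) set set" where
  "F w \<equiv> face s (ver s w) (edg lab s w)"

lemma develop_periodic: "\<psi> w (z + of_int (int (length w) * m)) = \<psi> w z"
proof -
  have fl: "\<lfloor>Re (z + of_int (int (length w) * m))\<rfloor> = \<lfloor>Re z\<rfloor> + int (length w) * m"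
    by (simp only: plus_complex.sel complex_Re_of_int floor_add_int)
  have "ver s w (n + int (length w) * m) = ver s w n" for n
  proof -
    have "s * (n + int (length w) * m) = s * n + int (length w) * (s * m)"
      by (simp add: algebra_simps)
    then show ?thesis
      by (simp only: ver_def mod_mult_self2)
  qed
  moreover have "edg lab s w (n + int (length w) * m) = edg lab s w n" for n
  proof -
    have "(if s = 1 then n + int (length w) * m else - (n + int (length w) * m) - 1) =
        (if s = 1 then n else - n - 1) + int (length w) * (if s = 1 then m else - m)"
      by simp
    then show ?thesis
      by (simp only: edg_def mod_mult_self2)
  qed
  ultimately show ?thesis
    unfolding develop_def fl by simp
qed

text \<open>A circuit enters the edge of a tile at its start or at its end, according to
  \<open>s\<close>; entry vertex and label form the pair for which \<open>circuit_system\<close>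
  allows only one position.\<close>

lemma tile_index:
  assumes "w \<in> C" "w' \<in> C" "ver s w n = ver s w' n'" "edg lab s w n = edg lab s w' n'"
  shows "w = w' \<and> n mod int (length w) = n' mod int (length w)"
proof -
  have walk: "ver s w (n + 1) = ver s w' (n' + 1)"
    using assms boundary_walk_circuit unfolding boundary_walk_def by metis
  define J where "J w n = nat ((if s = 1 then n else - n - 1) mod int (length w))" for w :: "'a list" and n
  have J: "J w n < length w" if "w \<in> C" for w n
    using circuit_nonempty[OF that] by (simp add: J_def nat_less_iff)
  have start: "w ! J w n = (if s = 1 then ver s w n else ver s w (n + 1))" for w n
    using s by (auto simp: J_def ver_def)
  have lab: "lab w (J w n) = edg lab s w n" for w n
    by (simp add: J_def edg_def)
  have "w ! J w n = w' ! J w' n'" "lab w (J w n) = lab w' (J w' n')"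
    unfolding start lab by (simp_all only: assms(3,4) walk)
  then have Q: "case (w, J w n) of (u, j) \<Rightarrow> u \<in> C \<and> j < length u \<and> u ! j = w ! J w n \<and> lab u j = lab w (J w n)"
    "case (w', J w' n') of (u, j) \<Rightarrow> u \<in> C \<and> j < length u \<and> u ! j = w ! J w n \<and> lab u j = lab w (J w n)"
    using J[OF assms(1), of n] J[OF assms(2), of n'] assms(1,2) by simp_all
  have "lab w (J w n) \<in> E"
    unfolding lab by (rule boundary_walk_edge_in[OF boundary_walk_circuit[OF assms(1)]])
  then have "\<exists>!(u, j). u \<in> C \<and> j < length u \<and> u ! j = w ! J w n \<and> lab u j = lab w (J w n)"
    using system by (simp add: circuit_system_def)
  moreover have "p = q" if "Ex1 R" "R p" "R q" for p q and R :: "'a list \<times> nat \<Rightarrow> bool"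
    using that by blast
  ultimately have "(w, J w n) = (w', J w' n')"
    using Q by blast
  then have "w = w'" and eq: "J w n = J w n'"
    by auto
  have "(if s = 1 then n else - n - 1) mod int (length w) = (if s = 1 then n' else - n' - 1) mod int (length w)"
    using eq circuit_nonempty[OF assms(1)] by (simp add: J_def eq_nat_nat_iff)
  then have "n mod int (length w) = n' mod int (length w)"
  proof (cases "s = 1")
    case False
    then have "int (length w) dvd (- n - 1) - (- n' - 1)"
      using \<open>_ mod _ = (if s = 1 then n' else - n' - 1) mod _\<close> by (simp only: if_False mod_eq_dvd_iff)
    also have "(- n - 1) - (- n' - 1) = - (n - n')"
      by simp
    finally show ?thesis
      by (simp only: dvd_minus_iff mod_eq_dvd_iff)
  qed simp
  then show ?thesis
    using \<open>w = w'\<close> by simp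
qed

lemma tile_exists:
  assumes "b \<in> E"
  obtains w n where "w \<in> C" "ver s w n = y" "edg lab s w n = b"
proof -
  \<comment> \<open>The vertex at which the circuit enters the edge: its start on the upper side,
    its end on the lower.\<close>
  define y' where "y' = (if s = 1 then y else b + y)"
  obtain w j where w: "w \<in> C" "j < length w" "w ! j = y'" "lab w j = b"
    using system assms unfolding circuit_system_def by blast
  define n where "n = (if s = 1 then int j else - int j - 1)"
  have n: "(if s = 1 then n else - n - 1) = int j"
    by (simp add: n_def)
  have edg: "edg lab s w n = b"
    unfolding edg_def n using w by simp
  have "ver s w n = y"
    using s
  proof
    assume "s = 1"
    then show ?thesis
      using w by (simp add: ver_def n_def y'_def)
  next
    assume s': "s = - 1"
    have "ver s w (n + 1) = edg lab s w n + ver s w n"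
      using boundary_walk_circuit[OF w(1)] by (simp add: boundary_walk_def)
    moreover have "ver s w (n + 1) = b + y"
      using w s' by (simp add: ver_def n_def y'_def)
    ultimately show ?thesis
      using edg by simp
  qed
  then show ?thesis
    using that w(1) edg by blast
qed

lemma face_disjoint:
  assumes "w \<in> C" "w' \<in> C" "F w \<inter> F w' \<noteq> {}"
  shows "w = w'"
proof -
  obtain n z n' z' where "pt (ver s w n) (edg lab s w n) z = pt (ver s w' n') (edg lab s w' n') z'"
    "0 < s * Im z"
    using assms(3) unfolding disjoint_iff mem_face_iff by blast
  then have "ver s w n = ver s w' n' \<and> edg lab s w n = edg lab s w' n'"
    using boundary_walk_edge_in[OF boundary_walk_circuit] assms(1,2) by (subst (asm) pt_eq_iff) auto
  then show ?thesis
    using tile_index assms(1,2) by blast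
qed

lemma face_side:
  assumes "x \<in> F w"
  shows "0 < s * Im (pos x)"
  using assms by (auto simp: mem_face_iff)

lemma Un_faces: "\<Union> (F ` C) = {x \<in> topspace glued. 0 < s * Im (pos x)}"
proof (intro set_eqI iffI)
  fix x
  assume "x \<in> \<Union> (F ` C)"
  then obtain w where "w \<in> C" "x \<in> F w"
    by blast
  then show "x \<in> {x \<in> topspace glued. 0 < s * Im (pos x)}"
    using openin_subset[OF openin_face[OF boundary_walk_circuit[of w]]]
    by (metis (mono_tags, lifting) mem_Collect_eq mem_face_iff pos_pt subsetD)
next
  fix x
  assume "x \<in> {x \<in> topspace glued. 0 < s * Im (pos x)}"
  then obtain y b z where x: "x = pt y b z" "b \<in> E" "0 \<le> Re z" "Re z < 1" "0 < s * Im z"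
    unfolding topspace_tiles by force
  then show "x \<in> \<Union> (F ` C)"
  proof -
    obtain w n where "w \<in> C" "ver s w n = y" "edg lab s w n = b"
      by (rule tile_exists[OF x(2)])
    moreover from this have "x \<in> F w"
      using x unfolding mem_face_iff by blast
    ultimately show ?thesis
      by blast
  qed
qed

lemma image_embed_circuit_points:
  assumes "w \<in> C"
  shows "embed ` circuit_points w = \<psi> w ` {z. Im z = 0}"
    and "\<lbrakk>j < length w; 0 \<le> u; u \<le> 1\<rbrakk> \<Longrightarrow>
      embed (edge_point (w ! j) (w ! (Suc j mod length w)) u) = \<psi> w (of_int s * of_real (real j + u))"
proof -
  note walk = boundary_walk_circuit[OF assms]
  have l: "0 < length w"
    using circuit_nonempty assms .
  have edge: "embed (edge_point (w ! j) (w ! (Suc j mod length w)) u) = \<psi> w (of_int s * of_real (real j + u))"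
    if "j < length w" "0 \<le> u" "u \<le> 1" for j u
    using s
  proof
    assume s': "s = 1"
    have "w ! j = ver s w (int j)" "w ! (Suc j mod length w) = ver s w (int j + 1)"
      using that s' nat_mod_Suc[OF l, of "int j"] by (simp_all add: ver_def)
    moreover have "of_int (int j) + complex_of_real u = of_int s * of_real (real j + u)"
      using s' by simp
    ultimately show ?thesis
      using embed_edge_point_develop[OF walk that(2,3), of "int j"] by (simp only:)
  next
    assume s': "s = - 1"
    have "w ! j = ver s w (- int j - 1 + 1)" "w ! (Suc j mod length w) = ver s w (- int j - 1)"
      using that s' nat_mod_Suc[OF l, of "int j"] by (simp_all add: ver_def add.commute[of 1])
    moreover have "of_int (- int j - 1) + complex_of_real (1 - u) = of_int s * of_real (real j + u)"
      using s' by simp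
    moreover have "0 \<le> 1 - u" "1 - u \<le> 1"
      using that by simp_all
    ultimately show ?thesis
      using embed_edge_point_develop[OF walk, of "1 - u" "- int j - 1"]
        edge_point_flip[of "w ! j" "w ! (Suc j mod length w)" u] by (simp only:)
  qed
  then show "\<lbrakk>j < length w; 0 \<le> u; u \<le> 1\<rbrakk> \<Longrightarrow>
      embed (edge_point (w ! j) (w ! (Suc j mod length w)) u) = \<psi> w (of_int s * of_real (real j + u))" .
  show "embed ` circuit_points w = \<psi> w ` {z. Im z = 0}"
  proof (intro set_eqI iffI)
    fix x
    assume "x \<in> embed ` circuit_points w"
    then show "x \<in> \<psi> w ` {z. Im z = 0}"
      using edge by (force simp: circuit_points_def)
  next
    fix x
    assume "x \<in> \<psi> w ` {z. Im z = 0}"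
    then obtain z where z: "Im z = 0" "x = \<psi> w z"
      by blast
    \<comment> \<open>The position along the circuit in its own direction: the integer part modulo
      the length selects the edge, the fractional part the point on it.\<close>
    define q where "q = s * Re z"
    define j where "j = nat (\<lfloor>q\<rfloor> mod int (length w))"
    define u where "u = frac q"
    have ss: "s * s = 1"
      using s by auto
    have z_eq: "z = of_int s * of_real q"
      using z(1) ss by (simp add: complex_eq_iff q_def flip: mult.assoc of_int_mult)
    define d where "d = \<lfloor>q\<rfloor> div int (length w)"
    have "int j = \<lfloor>q\<rfloor> - int (length w) * d"
      using l by (simp add: j_def d_def minus_mult_div_eq_mod)
    then have "real j = of_int (\<lfloor>q\<rfloor> - int (length w) * d)"
      by (metis of_int_of_nat_eq)
    then have "q = (real j + u) + of_int (int (length w) * d)"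
      by (simp add: u_def frac_def)
    then have "complex_of_real q = of_real (real j + u) + of_int (int (length w) * d)"
      by (metis of_real_add of_real_of_int_eq)
    then have "z = of_int s * (of_real (real j + u) + of_int (int (length w) * d))"
      using z_eq by simp
    also have "\<dots> = of_int s * of_real (real j + u) + of_int (int (length w) * (s * d))"
      by (simp add: distrib_left mult.left_commute)
    finally have "z = of_int s * of_real (real j + u) + of_int (int (length w) * (s * d))" .
    then have "x = \<psi> w (of_int s * of_real (real j + u))"
      unfolding z(2) using develop_periodic by metis
    moreover have "j < length w" "0 \<le> u" "u \<le> 1"
      using l by (simp_all add: j_def u_def nat_less_iff frac_lt_1 less_imp_le)
    ultimately show "x \<in> embed ` circuit_points w"
      using edge[of j u] by (force simp: circuit_points_def intro!: rev_image_eqI)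
  qed
qed

text \<open>The part of the half-cylinder up to height 1 is the collar. For \<open>s = - 1\<close>
  multiplication by \<open>s\<close> is a half-turn, which reverses the walk and enters the lower
  half-plane at once; so the collar follows the circuit in its own direction.\<close>

lemma collar:
  assumes "w \<in> C"
  defines "f \<equiv> \<lambda>(x, t). \<psi> w (of_int s * Complex x t)"
  shows "continuous_map (top_of_set ({0..real (length w)} \<times> {0..1})) glued f"
    and "\<forall>t\<in>{0..1}. f (real (length w), t) = f (0, t)"
    and "inj_on f ({0..<real (length w)} \<times> {0<..1})"
    and "f ` ({0..<real (length w)} \<times> {0<..1}) \<subseteq> F w"
    and "\<forall>j<length w. \<forall>u\<in>{0..1}.
      f (real j + u, 0) = embed (edge_point (w ! j) (w ! (Suc j mod length w)) u)"
proof -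
  note walk = boundary_walk_circuit[OF assms(1)]
  have f_comp: "f = \<psi> w \<circ> (\<lambda>p. of_int s * Complex (fst p) (snd p))"
    by (auto simp: f_def)
  show "continuous_map (top_of_set ({0..real (length w)} \<times> {0..1})) glued f"
    unfolding f_comp
  proof (rule continuous_map_compose[OF _ continuous_map_develop[OF walk]])
    have "continuous_on ({0..real (length w)} \<times> {0..1}) (\<lambda>p. of_int s * Complex (fst p) (snd p))"
      unfolding Complex_eq by (intro continuous_intros)
    then show "continuous_map (top_of_set ({0..real (length w)} \<times> {0..1})) (top_of_set {z. 0 \<le> s * Im z})
        (\<lambda>p. of_int s * Complex (fst p) (snd p))"
      using s by auto
  qed
  show "\<forall>t\<in>{0..1}. f (real (length w), t) = f (0, t)"
  proof
    fix t :: real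
    have "of_int s * Complex (real (length w)) t = of_int s * Complex 0 t + of_int (int (length w) * s)"
      by (simp add: complex_eq_iff)
    then show "f (real (length w), t) = f (0, t)"
      unfolding f_def using develop_periodic by simp
  qed
  show "inj_on f ({0..<real (length w)} \<times> {0<..1})"
  proof (rule inj_onI, clarify)
    fix x t x' t'
    assume bounds: "x \<in> {0..<real (length w)}" "t \<in> {0<..1}" "x' \<in> {0..<real (length w)}" "t' \<in> {0<..1}"
      and eq: "f (x, t) = f (x', t')"
    let ?n = "\<lfloor>s * x\<rfloor>" and ?n' = "\<lfloor>s * x'\<rfloor>"
    let ?z = "of_int s * Complex x t - of_int ?n" and ?z' = "of_int s * Complex x' t' - of_int ?n'"
    have "Im ?z \<noteq> 0"
      using bounds s by auto
    then have "?z \<noteq> 0"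
      by (metis zero_complex.simps(2))
    have "pt (ver s w ?n) (edg lab s w ?n) ?z = pt (ver s w ?n') (edg lab s w ?n') ?z'"
      using eq by (simp add: f_def develop_def)
    then have *: "?z = ?z'" "ver s w ?n = ver s w ?n'" "edg lab s w ?n = edg lab s w ?n'"
      using \<open>?z \<noteq> 0\<close> boundary_walk_edge_in[OF walk] by (auto simp: pt_eq_iff)
    then have "?n mod int (length w) = ?n' mod int (length w)"
      using tile_index assms(1) by blast
    \<comment> \<open>The two tiles differ by \<open>m\<close> turns of the cylinder, and even one
      turn is too long for \<open>x\<close> and \<open>x'\<close> in a single period.\<close>
    then obtain m where m: "?n = ?n' + int (length w) * m"
      by (metis cong_def cong_iff_lin)
    have "Re ?z = Re ?z'" "Im ?z = Im ?z'"
      using *(1) by simp_all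
    then have "s * x = s * x' + real (length w) * m" "s * t = s * t'"
      unfolding m by simp_all
    moreover have "\<bar>s * x - s * x'\<bar> < real (length w)"
      using bounds s by auto
    ultimately have "\<bar>real (length w) * m\<bar> < real (length w) * 1"
      by simp
    then have "\<bar>real_of_int m\<bar> < 1"
      unfolding abs_mult using circuit_nonempty[OF assms(1)] by (simp add: mult_less_cancel_left)
    then have "m = 0"
      by simp
    then show "x = x' \<and> t = t'"
      using \<open>s * x = s * x' + real (length w) * m\<close> \<open>s * t = s * t'\<close> s by auto
  qed
  show "f ` ({0..<real (length w)} \<times> {0<..1}) \<subseteq> F w"
  proof clarify
    fix x t :: real
    assume "t \<in> {0<..1}"
    then have "of_int s * Complex x t \<in> {z. 0 < s * Im z}"
      using s by auto
    then show "f (x, t) \<in> F w"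
      unfolding face_def f_def by simp
  qed
  show "\<forall>j<length w. \<forall>u\<in>{0..1}.
      f (real j + u, 0) = embed (edge_point (w ! j) (w ! (Suc j mod length w)) u)"
    using image_embed_circuit_points(2)[OF assms(1)] by (simp add: f_def Complex_eq)
qed

text \<open>By \<open>oriented_edge_unique\<close> an undirected edge has one start and one label,
  and \<open>circuit_system\<close> gives exactly one step with these data.\<close>

lemma circuit_decomposition_edges: "circuit_decomposition (cayley_edges E) C"
proof -
  have lab_in: "lab w j \<in> E" if "w \<in> C" "j < length w" for w j
    using boundary_walk_edge_in[OF boundary_walk_circuit[OF that(1)], of "if s = 1 then int j else - int j - 1"] that s
    by (auto simp: edg_def)
  \<comment> \<open>The start of the edge in the direction of its label; for \<open>s = - 1\<close>
    it is the vertex at which the step arrives.\<close>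
  define tl where "tl w j = (if s = 1 then w ! j else - lab w j + w ! j)" for w j
  have edge: "{w ! j, w ! (Suc j mod length w)} = {tl w j, lab w j + tl w j}" if "w \<in> C" "j < length w" for w j
  proof -
    have "w ! (Suc j mod length w) = (if s = 1 then lab w j else - lab w j) + w ! j"
      using system that by (simp add: circuit_system_def)
    then show ?thesis
      by (auto simp: tl_def)
  qed
  show ?thesis
    unfolding circuit_decomposition_def
  proof (intro conjI ballI allI impI)
    show "w \<noteq> []" if "w \<in> C" for w
      using circuit_nonempty[OF that] by auto
    show "{w ! j, w ! (Suc j mod length w)} \<in> cayley_edges E" if "w \<in> C" "j < length w" for w j
      unfolding edge[OF that] using lab_in[OF that] by (auto simp: cayley_edges_def)
    fix e
    assume "e \<in> cayley_edges E"
    then obtain y b where e: "e = {y, b + y}" "b \<in> E"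
      by (auto simp: cayley_edges_def)
    have iff: "e = {w ! j, w ! (Suc j mod length w)} \<longleftrightarrow> w ! j = (if s = 1 then y else b + y) \<and> lab w j = b"
      if "w \<in> C" "j < length w" for w j
    proof -
      have "e = {w ! j, w ! (Suc j mod length w)} \<longleftrightarrow> y = tl w j \<and> b = lab w j"
        unfolding edge[OF that] e(1) using oriented_edge_unique[OF e(2) lab_in[OF that]] by blast
      also have "\<dots> \<longleftrightarrow> w ! j = (if s = 1 then y else b + y) \<and> lab w j = b"
        by (auto simp: tl_def add.assoc[symmetric])
      finally show ?thesis .
    qed
    have "\<exists>!(w, j). w \<in> C \<and> j < length w \<and> w ! j = (if s = 1 then y else b + y) \<and> lab w j = b"
      using system e(2) by (simp add: circuit_system_def)
    then show "\<exists>!(w, j). w \<in> C \<and> j < length w \<and> e = {w ! j, w ! (Suc j mod length w)}"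
      using iff by (simp cong: conj_cong)
  qed
qed

end

section \<open>Both sides together: faces and biembedding\<close>

locale two_sided_circuits = vertex_rotation +
  fixes C :: "int \<Rightarrow> 'a list set" and lab :: "int \<Rightarrow> 'a list \<Rightarrow> nat \<Rightarrow> 'a"
  assumes systems: "s = 1 \<or> s = - 1 \<Longrightarrow> circuit_system s (C s) (lab s)"
begin

sublocale up: side_circuits N E \<alpha> \<beta> idx 1 "C 1" "lab 1"
  by unfold_locales (use systems in auto)

sublocale down: side_circuits N E \<alpha> \<beta> idx "- 1" "C (- 1)" "lab (- 1)"
  by unfold_locales (use systems in auto)

abbreviation X :: "('a \<times> nat \<times> complex) set topology" where
  "X \<equiv> glued"

definition all_faces :: "('a \<times> nat \<times> complex) set set set" where
  "all_faces = up.F ` C 1 \<union> down.F ` C (- 1)"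

lemma all_faces_cases:
  assumes "A \<in> all_faces"
  obtains (up) w where "w \<in> C 1" "A = up.F w" | (down) w where "w \<in> C (- 1)" "A = down.F w"
  using assms unfolding all_faces_def by (elim UnE imageE)

lemma Union_all_faces: "\<Union> all_faces = {x \<in> topspace X. Im (pos x) \<noteq> 0}"
  unfolding all_faces_def Union_Un_distrib up.Un_faces down.Un_faces by auto

lemma all_faces_disjoint:
  assumes "A \<in> all_faces" "B \<in> all_faces" "x \<in> A" "x \<in> B"
  shows "A = B"
  using assms(1)
proof (cases rule: all_faces_cases)
  case A: (up w)
  show ?thesis
    using assms(2)
  proof (cases rule: all_faces_cases)
    case (up w')
    then show ?thesis
      using up.face_disjoint[of w w'] A assms(3,4) by auto
  next
    case (down w')
    then show ?thesis
      using up.face_side[of x w] down.face_side[of x w'] A assms(3,4) by simp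
  qed
next
  case A: (down w)
  show ?thesis
    using assms(2)
  proof (cases rule: all_faces_cases)
    case (up w')
    then show ?thesis
      using up.face_side[of x w'] down.face_side[of x w] A assms(3,4) by simp
  next
    case (down w')
    then show ?thesis
      using down.face_disjoint[of w w'] A assms(3,4) by auto
  qed
qed

lemma all_faces_walk:
  assumes "A \<in> all_faces"
  obtains s v a where "boundary_walk s v a" "A = face s v a"
  using assms
proof (cases rule: all_faces_cases)
  case (up w)
  then show ?thesis
    using up.boundary_walk_circuit by (intro that)
next
  case (down w)
  then show ?thesis
    using down.boundary_walk_circuit by (intro that)
qed

lemma openin_all_faces: "A \<in> all_faces \<Longrightarrow> openin X A"
  by (metis all_faces_walk openin_face)

text \<open>Off the real axis the point would lie in some face, an open neighbourhood that is
  disjoint from \<open>A\<close> unless it is \<open>A\<close> itself.\<close>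

lemma closure_of_face_real:
  assumes "A \<in> all_faces" "x \<in> X closure_of A" "x \<notin> A"
  shows "Im (pos x) = 0"
proof (rule ccontr)
  assume "Im (pos x) \<noteq> 0"
  moreover have "x \<in> topspace X"
    using assms(2) by (simp add: in_closure_of)
  ultimately have "x \<in> \<Union> all_faces"
    unfolding Union_all_faces by simp
  then obtain B where B: "B \<in> all_faces" "x \<in> B"
    by blast
  then obtain y where "y \<in> A" "y \<in> B"
    using assms(2) openin_all_faces[OF B(1)] unfolding in_closure_of by blast
  then show False
    using all_faces_disjoint[OF assms(1) B(1)] B(2) assms(3) by blast
qed

lemma face_boundary_circuit:
  assumes walk: "boundary_walk s v a" and face: "face s v a \<in> all_faces"
  shows "X frontier_of face s v a = develop v a ` {z. Im z = 0}"
proof -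
  have "X frontier_of face s v a = X closure_of face s v a - face s v a"
    by (rule frontier_of_openin[OF openin_face[OF walk]])
  also have "\<dots> = develop v a ` {z. Im z = 0}"
  proof
    show "X closure_of face s v a - face s v a \<subseteq> develop v a ` {z. Im z = 0}"
      using closure_of_face_pos[OF walk] closure_of_face_real[OF face] by blast
    have "develop v a z \<notin> face s v a" if "Im z = 0" for z
      using that unfolding mem_face_iff by (metis Im_pos_develop less_irrefl mult_zero_right pos_pt)
    then show "develop v a ` {z. Im z = 0} \<subseteq> X closure_of face s v a - face s v a"
      using develop_real_in_closure_of_face[OF walk] by blast
  qed
  finally show ?thesis .
qed

lemma face_boundary_up:
  assumes "w \<in> C 1"
  shows "X frontier_of up.F w = embed ` circuit_points w" "face_boundary X embed (up.F w) w"
proof -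
  show *: "X frontier_of up.F w = embed ` circuit_points w"
    using face_boundary_circuit[OF up.boundary_walk_circuit[OF assms]] assms
    unfolding all_faces_def up.image_embed_circuit_points(1)[OF assms] by blast
  show "face_boundary X embed (up.F w) w"
    unfolding face_boundary_def using * up.collar[OF assms] by blast
qed

lemma face_boundary_down:
  assumes "w \<in> C (- 1)"
  shows "X frontier_of down.F w = embed ` circuit_points w" "face_boundary X embed (down.F w) w"
proof -
  show *: "X frontier_of down.F w = embed ` circuit_points w"
    using face_boundary_circuit[OF down.boundary_walk_circuit[OF assms]] assms
    unfolding all_faces_def down.image_embed_circuit_points(1)[OF assms] by blast
  show "face_boundary X embed (down.F w) w"
    unfolding face_boundary_def using * down.collar[OF assms] by blast
qed

lemma faces_eq: "faces UNIV (cayley_edges E) X embed = all_faces"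
proof -
  have compl: "topspace X - embed ` realization UNIV (cayley_edges E) = \<Union> all_faces"
    unfolding image_embed_realization Union_all_faces by auto
  show ?thesis
    unfolding faces_def compl
  proof (rule connected_components_of_open_partition)
    fix A
    assume A: "A \<in> all_faces"
    have "connectedin X A" "A \<noteq> {}"
      using A connectedin_face face_nonempty by (metis all_faces_walk)+
    moreover have "A \<subseteq> \<Union> all_faces"
      using A by blast
    ultimately show "openin (subtopology X (\<Union> all_faces)) A \<and> connectedin (subtopology X (\<Union> all_faces)) A \<and> A \<noteq> {}"
      using openin_all_faces[OF A] by (simp add: connectedin_subtopology subset_openin_subtopology)
  next
    show "topspace (subtopology X (\<Union> all_faces)) = \<Union> all_faces"
      unfolding Union_all_faces by auto
  next
    fix A B
    assume "A \<in> all_faces" "B \<in> all_faces" "A \<inter> B \<noteq> {}"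
    then show "A = B"
      using all_faces_disjoint by blast
  qed
qed

lemma graph_embedding_embed: "graph_embedding UNIV (cayley_edges E) X embed"
proof -
  have path: "continuous_map (top_of_set {0..1}) X (\<lambda>t. embed (edge_point y (b + y) t))" if "b \<in> E" for y b
  proof -
    \<comment> \<open>The column circuit through the edge supplies a developed half-plane with the
      edge on its border, so continuity along the edge comes from \<open>develop\<close>.\<close>
    obtain w n where w: "w \<in> C 1" "ver 1 w n = y" "edg (lab 1) 1 w n = b"
      using up.tile_exists \<open>b \<in> E\<close> by blast
    note walk = up.boundary_walk_circuit[OF w(1)]
    have v: "ver 1 w (n + 1) = b + y"
      using walk w by (simp add: boundary_walk_def)
    have "continuous_map (top_of_set {0..1}) X (up.\<psi> w \<circ> (\<lambda>t. of_int n + of_real t))"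
      by (rule continuous_map_compose[OF _ continuous_map_develop[OF walk]])
        (auto intro!: continuous_intros)
    then show ?thesis
      by (rule continuous_map_eq) (use embed_edge_point_develop[OF walk, of _ n] w v in simp)
  qed
  have flip: "continuous_map (top_of_set {0..1}) (top_of_set {0..1}) (\<lambda>t. 1 - t :: real)"
    by (auto intro!: continuous_intros)
  have any: "continuous_map (top_of_set {0..1}) X (\<lambda>t. embed (edge_point u v t))"
    if "{u, v} \<in> cayley_edges E" for u v
    using that
  proof (cases rule: edge_cases)
    case (1 b)
    then show ?thesis
      using path by simp
  next
    case (2 b)
    have "continuous_map (top_of_set {0..1}) X ((\<lambda>t. embed (edge_point v (b + v) t)) \<circ> (\<lambda>t. 1 - t))"
      by (rule continuous_map_compose[OF flip path[OF 2(1)]])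
    then show ?thesis
      by (rule continuous_map_eq) (use 2 edge_point_flip[of v u] in simp)
  qed
  have "continuous_map (graph_topology UNIV (cayley_edges E)) X embed"
    unfolding continuous_map topspace_graph_topology
  proof (intro conjI allI impI)
    show "embed ` realization UNIV (cayley_edges E) \<subseteq> topspace X"
      using image_embed_realization by blast
    fix U
    assume "openin X U"
    show "openin (graph_topology UNIV (cayley_edges E)) {x \<in> realization UNIV (cayley_edges E). embed x \<in> U}"
      unfolding openin_graph_topology
    proof (intro conjI allI impI)
      fix u v
      assume uv: "{u, v} \<in> cayley_edges E"
      have "openin (top_of_set {0..1}) {t \<in> topspace (top_of_set {0..1}). embed (edge_point u v t) \<in> U}"
        by (rule openin_continuous_map_preimage[OF any[OF uv] \<open>openin X U\<close>])
      moreover have "edge_point u v t \<in> realization UNIV (cayley_edges E)" if "t \<in> {0..1}" for t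
        using uv that unfolding realization_def by blast
      ultimately show "openin (top_of_set {0..1})
          {t \<in> {0..1}. edge_point u v t \<in> {x \<in> realization UNIV (cayley_edges E). embed x \<in> U}}"
        by (simp cong: conj_cong)
    qed auto
  qed
  then show ?thesis
    unfolding graph_embedding_def using inj_on_embed by blast
qed

text \<open>The midpoint of an edge is not a vertex, so \<open>pt\<close> remembers its label and
  the tile is determined.\<close>

lemma shared_edge_circuit:
  assumes "b \<in> E" "w \<in> C s" "s = 1 \<or> s = - 1"
    and "embed (edge_point y (b + y) (1 / 2)) \<in> develop (ver s w) (edg (lab s) s w) ` {z. Im z = 0}"
  obtains n where "ver s w n = y" "edg (lab s) s w n = b"
proof -
  interpret side_circuits N E \<alpha> \<beta> idx s "C s" "lab s"
    by unfold_locales (use assms systems in auto)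
  obtain z where z: "pt y b (of_real (1 / 2)) = \<psi> w z"
    using assms(1,4) embed_edge_point[of b "1 / 2" y] by auto
  then have "pt y b (of_real (1 / 2)) =
      pt (ver s w \<lfloor>Re z\<rfloor>) (edg (lab s) s w \<lfloor>Re z\<rfloor>) (z - of_int \<lfloor>Re z\<rfloor>)"
    by (simp only: develop_def)
  then have "ver s w \<lfloor>Re z\<rfloor> = y" "edg (lab s) s w \<lfloor>Re z\<rfloor> = b"
    using assms(1) boundary_walk_edge_in[OF boundary_walk_circuit[OF assms(2)]]
    by (auto simp: pt_eq_iff)
  then show ?thesis
    by (rule that)
qed

text \<open>Each side of an edge borders one circuit only, so two faces of one colour with a common
  edge belong to the same circuit.\<close>

lemma not_share_edge:
  assumes "A \<noteq> B" and AB: "A \<in> up.F ` C 1 \<and> B \<in> up.F ` C 1 \<or> A \<in> down.F ` C (- 1) \<and> B \<in> down.F ` C (- 1)"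
  shows "\<not> share_edge (cayley_edges E) X embed A B"
proof
  assume "share_edge (cayley_edges E) X embed A B"
  then obtain u v where uv: "{u, v} \<in> cayley_edges E"
    "embed ` edge_point u v ` {0..1} \<subseteq> X frontier_of A \<inter> X frontier_of B"
    unfolding share_edge_def by blast
  have mid: "embed (edge_point u v (1 / 2)) \<in> X frontier_of A \<inter> X frontier_of B"
    using uv(2) by force
  obtain y b where b: "b \<in> E" "embed (edge_point y (b + y) (1 / 2)) \<in> X frontier_of A \<inter> X frontier_of B"
    using uv(1)
  proof (cases rule: edge_cases)
    case (1 b)
    then show ?thesis
      using that mid by blast
  next
    case (2 b)
    then show ?thesis
      using that mid edge_point_flip[of u v "1 / 2"] by simp
  qed
  from AB show False
  proof
    assume "A \<in> up.F ` C 1 \<and> B \<in> up.F ` C 1"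
    then obtain w w' where w: "w \<in> C 1" "A = up.F w" "w' \<in> C 1" "B = up.F w'"
      by blast
    have "embed (edge_point y (b + y) (1 / 2)) \<in> up.\<psi> w ` {z. Im z = 0}"
      "embed (edge_point y (b + y) (1 / 2)) \<in> up.\<psi> w' ` {z. Im z = 0}"
      using b(2) w face_boundary_up(1) up.image_embed_circuit_points(1) by auto
    then obtain n n' where "ver 1 w n = y" "edg (lab 1) 1 w n = b"
      "ver 1 w' n' = y" "edg (lab 1) 1 w' n' = b"
      using shared_edge_circuit[OF b(1) w(1)] shared_edge_circuit[OF b(1) w(3)] by metis
    then show False
      using up.tile_index[of w w' n n'] w \<open>A \<noteq> B\<close> by simp
  next
    assume "A \<in> down.F ` C (- 1) \<and> B \<in> down.F ` C (- 1)"
    then obtain w w' where w: "w \<in> C (- 1)" "A = down.F w" "w' \<in> C (- 1)" "B = down.F w'"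
      by blast
    have "embed (edge_point y (b + y) (1 / 2)) \<in> down.\<psi> w ` {z. Im z = 0}"
      "embed (edge_point y (b + y) (1 / 2)) \<in> down.\<psi> w' ` {z. Im z = 0}"
      using b(2) w face_boundary_down(1) down.image_embed_circuit_points(1) by auto
    then obtain n n' where "ver (- 1) w n = y" "edg (lab (- 1)) (- 1) w n = b"
      "ver (- 1) w' n' = y" "edg (lab (- 1)) (- 1) w' n' = b"
      using shared_edge_circuit[OF b(1) w(1)] shared_edge_circuit[OF b(1) w(3)] by metis
    then show False
      using down.tile_index[of w w' n n'] w \<open>A \<noteq> B\<close> by simp
  qed
qed

lemma biembedding_embed: "biembedding UNIV (cayley_edges E) (C (- 1)) (C 1) X embed"
  unfolding biembedding_def
proof (intro conjI exI)
  show "circuit_decomposition (cayley_edges E) (C (- 1))" "circuit_decomposition (cayley_edges E) (C 1)"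
    by (rule down.circuit_decomposition_edges up.circuit_decomposition_edges)+
  show "graph_embedding UNIV (cayley_edges E) X embed"
    by (rule graph_embedding_embed)
  show "down.F ` C (- 1) \<union> up.F ` C 1 = faces UNIV (cayley_edges E) X embed"
    unfolding faces_eq all_faces_def by (rule Un_commute)
  show "down.F ` C (- 1) \<inter> up.F ` C 1 = {}"
  proof -
    have "down.F w \<noteq> up.F w'" if w: "w \<in> C (- 1)" "w' \<in> C 1" for w w'
    proof
      assume eq: "down.F w = up.F w'"
      obtain x where "x \<in> up.F w'"
        using face_nonempty[OF up.boundary_walk_circuit[OF w(2)]] by blast
      then have "0 < Im (pos x)" "Im (pos x) < 0"
        using eq up.face_side[of x w'] down.face_side[of x w] by simp_all
      then show False
        by simp
    qed
    then show ?thesis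
      by blast
  qed
  show "\<forall>K\<in>{down.F ` C (- 1), up.F ` C 1}. \<forall>A\<in>K. \<forall>B\<in>K. A \<noteq> B \<longrightarrow> \<not> share_edge (cayley_edges E) X embed A B"
    using not_share_edge by blast
  show "color_class_bounded_by X embed (down.F ` C (- 1)) (C (- 1))"
    unfolding color_class_bounded_by_def using face_boundary_down(2) by blast
  show "color_class_bounded_by X embed (up.F ` C 1) (C 1)"
    unfolding color_class_bounded_by_def using face_boundary_up(2) by blast
qed

end

section \<open>Circuits of orderings\<close>

lemma cycle_of_list_nth:
  assumes "distinct xs" "j < length xs"
  shows "cycle_of_list xs (xs ! j) = xs ! (Suc j mod length xs)"
proof -
  have "map (cycle_of_list xs) xs = rotate1 xs"
    using cyclic_rotation[OF assms(1), of 1] by (simp add: rotate_def)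
  then have "cycle_of_list xs (xs ! j) = rotate1 xs ! j"
    using assms(2) by (metis nth_map)
  then show ?thesis
    using assms(2) by (simp add: nth_rotate1)
qed

lemma ordering_perm_0 [simp]: "ordering_perm 0 \<omega> = id"
  by (simp add: ordering_perm_def)

lemma ordering_perm_Suc: "ordering_perm (Suc l) \<omega> = ordering_perm l \<omega> \<circ> cycle_of_list (\<omega> l)"
proof -
  have "foldr (\<circ>) fs g = foldr (\<circ>) fs id \<circ> g" for fs and g :: "'a \<Rightarrow> 'a"
    by (induction fs) (simp_all add: o_assoc)
  from this[of _ "cycle_of_list (\<omega> l)"] show ?thesis
    by (simp add: ordering_perm_def)
qed

lemma ordering_perm_permutes: "ordering_perm l \<omega> permutes (\<Union>i<l. set (\<omega> i))"
proof (induction l)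
  case 0
  show ?case
    by (simp add: permutes_empty fun_eq_iff)
next
  case (Suc l)
  have "cycle_of_list (\<omega> l) permutes (\<Union>i<Suc l. set (\<omega> i))"
    by (rule permutes_subset[OF cycle_permutes]) auto
  moreover have "ordering_perm l \<omega> permutes (\<Union>i<Suc l. set (\<omega> i))"
    by (rule permutes_subset[OF Suc]) (auto simp: less_Suc_eq)
  ultimately show ?case
    unfolding ordering_perm_Suc by (rule permutes_compose)
qed

lemma ordering_perm_eq_cycle:
  assumes "\<And>i j. \<lbrakk>i < l; j < l; i \<noteq> j\<rbrakk> \<Longrightarrow> set (\<omega> i) \<inter> set (\<omega> j) = {}" "i < l" "x \<in> set (\<omega> i)"
  shows "ordering_perm l \<omega> x = cycle_of_list (\<omega> i) x"
  using assms
proof (induction l)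
  case (Suc l)
  show ?case
  proof (cases "i = l")
    case True
    have "cycle_of_list (\<omega> l) x \<in> set (\<omega> l)"
      using Suc.prems(3) True permutes_in_image[OF cycle_permutes] by metis
    moreover have "set (\<omega> l) \<inter> set (\<omega> i') = {}" if "i' < l" for i'
      using Suc.prems(1)[of l i'] that by simp
    ultimately have "cycle_of_list (\<omega> l) x \<notin> (\<Union>i<l. set (\<omega> i))"
      by blast
    then show ?thesis
      using True permutes_not_in[OF ordering_perm_permutes] by (simp add: ordering_perm_Suc)
  next
    case False
    then have "x \<notin> set (\<omega> l)"
      using Suc.prems by fastforce
    then show ?thesis
      using Suc False by (simp add: ordering_perm_Suc id_outside_supp)
  qed
qed simp

lemma inj_on_of_image_mset_eq_mset_set:
  assumes "image_mset f (mset_set A) = mset_set B" "finite A" "finite B"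
  shows "inj_on f A" "f ` A = B"
proof -
  have "set_mset (image_mset f (mset_set A)) = set_mset (mset_set B)"
    using assms(1) by simp
  then show "f ` A = B"
    using assms(2,3) by simp
  have "card A = card B"
    using arg_cong[OF assms(1), of size] by simp
  then show "inj_on f A"
    using assms(2) \<open>f ` A = B\<close> by (intro eq_card_imp_inj_on) simp_all
qed

lemma mset_eq_image_mset_set:
  assumes "mset xs = image_mset f (mset_set A)" "finite A" "inj_on f A"
  shows "distinct xs" "set xs = f ` A"
proof -
  have eq: "mset xs = mset_set (f ` A)"
    using assms by (simp add: image_mset_mset_set)
  then show "set xs = f ` A"
    using assms(2) by (metis finite_imageI finite_set_mset_mset_set set_mset_mset)
  then show "distinct xs"
    using eq by (metis assms(2) card_distinct finite_imageI size_mset size_mset_set)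
qed

lemma Ex1_pairD:
  assumes "\<exists>!(x, y). P x y"
  shows "\<exists>x y. P x y \<and> (\<forall>x' y'. P x' y' \<longrightarrow> x' = x \<and> y' = y)"
proof -
  obtain z where "case_prod P z" "\<And>z'. case_prod P z' \<Longrightarrow> z' = z"
    using assms by (rule ex1E) blast
  then show ?thesis
    by (intro exI[of _ "fst z"] exI[of _ "snd z"]) (metis case_prod_conv prod.collapse fst_conv snd_conv)
qed

section \<open>Walks and the circuits made of their translates\<close>

lemma add_eq_iff_minus_add: "a + b + t = y \<longleftrightarrow> - a + y = b + t" for a b t y :: "'g::group_add"
proof
  assume "a + b + t = y"
  then have "y = a + (b + t)"
    by (simp add: add.assoc)
  then show "- a + y = b + t"
    by simp
next
  assume "- a + y = b + t"
  then have "a + (- a + y) = a + (b + t)"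
    by simp
  then show "a + b + t = y"
    by (simp add: add.assoc)
qed

lemma nat_mult_Suc: "nat_mult (Suc i) g = g + nat_mult i g"
  by (simp add: nat_mult_def)

lemma nat_mult_period:
  assumes "finite_period g"
  shows "0 < period g" "nat_mult (period g) g = 0"
  using LeastI_ex[of "\<lambda>p. 0 < p \<and> nat_mult p g = 0"] assms
  unfolding finite_period_def period_def by auto

lemma length_concat_uniform:
  assumes "\<And>i. length (f i) = k"
  shows "length (concat (map f [a..<a + p])) = p * k"
  using assms by (induction p) (simp_all add: add.commute)

lemma nth_concat_uniform:
  assumes "\<And>i. length (f i) = k" "q < p * k"
  shows "concat (map f [a..<a + p]) ! q = f (a + q div k) ! (q mod k)"
  using assms(2)
proof (induction p)
  case (Suc p)
  have len: "length (concat (map f [a..<a + p])) = p * k"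
    using assms(1) by (rule length_concat_uniform)
  show ?case
  proof (cases "q < p * k")
    case True
    then show ?thesis
      using Suc.IH len by (simp add: nth_append)
  next
    case False
    then obtain r where r: "q = p * k + r" "r < k"
      using Suc.prems by (metis add.commute add_less_cancel_left le_Suc_ex mult_Suc not_less)
    then have "q div k = p" "q mod k = r"
      by simp_all
    then show ?thesis
      using r len by (simp add: nth_append)
  qed
qed simp

text \<open>A common form of both kinds of walk. Steps are added on the left, so right translates
  are again made of the same steps, even in a nonabelian group.\<close>

definition is_walk :: "'g::group_add list \<Rightarrow> 'g list \<Rightarrow> bool" where
  "is_walk W gs \<longleftrightarrow> length W = Suc (length gs) \<and> W ! 0 = 0 \<and> (\<forall>j<length gs. W ! Suc j = gs ! j + W ! j)"

text \<open>Negation reverses a sum, so each negated partial sum gains its new term on the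
  left.\<close>

lemma is_walk_walk_plus: "is_walk (walk_plus \<omega>) (map uminus \<omega>)"
proof -
  have "- sum_list (take (Suc j) \<omega>) = - \<omega> ! j + - sum_list (take j \<omega>)" if "j < length \<omega>" for j
    using that by (simp add: take_Suc_conv_app_nth minus_add)
  then show ?thesis
    unfolding is_walk_def walk_plus_def by (simp del: upt_Suc)
qed

text \<open>The last \<open>i\<close> terms of \<open>rev \<omega>\<close> are the first
  \<open>i\<close> terms of \<open>\<omega>\<close> in reverse order, so the newest term stands
  leftmost.\<close>

lemma is_walk_walk_minus: "is_walk (walk_minus (rev \<omega>)) \<omega>"
proof -
  have "walk_minus (rev \<omega>) = map (\<lambda>i. sum_list (rev (take i \<omega>))) [0..<Suc (length \<omega>)]"
    unfolding walk_minus_def by (rule map_cong) (auto simp: rev_take)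
  moreover have "sum_list (rev (take (Suc j) \<omega>)) = \<omega> ! j + sum_list (rev (take j \<omega>))" if "j < length \<omega>" for j
    using that by (simp add: take_Suc_conv_app_nth)
  ultimately show ?thesis
    unfolding is_walk_def by (simp del: upt_Suc)
qed

locale closed_walk =
  fixes W gs :: "'g::group_add list"
  assumes walk: "is_walk W gs" and nonempty: "gs \<noteq> []" and fin: "finite_period (last W)"
begin

abbreviation k :: nat where "k \<equiv> length gs"
abbreviation p :: nat where "p \<equiv> period (last W)"
abbreviation translate :: "'g \<Rightarrow> 'g list" where
  "translate t \<equiv> map (\<lambda>y. y + t) (circuit_of_walk W)"

lemma k_pos: "0 < k"
  using nonempty by simp

lemma length_butlast_W: "length (butlast W) = k"
  using walk by (simp add: is_walk_def)

lemma circuit_of_walk_eq: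
  "circuit_of_walk W = concat (map (\<lambda>i. map (\<lambda>y. y + nat_mult i (last W)) (butlast W)) [1..<1 + p])"
  by (simp add: circuit_of_walk_def)

lemma length_translate: "length (translate t) = p * k"
  unfolding circuit_of_walk_eq length_map
  by (rule length_concat_uniform) (simp add: length_butlast_W del: length_butlast)

lemma translate_nth:
  assumes "q < p * k"
  shows "translate t ! q = W ! (q mod k) + nat_mult (Suc (q div k)) (last W) + t"
proof -
  have "q mod k < length (butlast W)"
    using k_pos length_butlast_W by simp
  moreover have "circuit_of_walk W ! q = map (\<lambda>y. y + nat_mult (1 + q div k) (last W)) (butlast W) ! (q mod k)"
    unfolding circuit_of_walk_eq
    by (rule nth_concat_uniform) (use assms in \<open>simp_all add: length_butlast_W del: length_butlast\<close>)
  moreover have "q < length (circuit_of_walk W)"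
    using length_translate[of 0] assms by simp
  ultimately show ?thesis
    by (simp add: nth_butlast)
qed

text \<open>Inside a copy this is the step of the walk itself; the end of a copy is the start of the
  next one because one more \<open>last W\<close> on the left gives the next multiple.\<close>

lemma translate_step:
  assumes "q < p * k"
  shows "translate t ! (Suc q mod (p * k)) = gs ! (q mod k) + translate t ! q"
proof -
  define i j where "i = q div k" and "j = q mod k"
  have q: "q = i * k + j" "j < k"
    using k_pos by (simp_all add: i_def j_def)
  have "i < p"
    unfolding i_def using assms by (simp add: less_mult_imp_div_less)
  have step: "W ! Suc j = gs ! j + W ! j" and W0: "W ! 0 = 0" and len: "length W = Suc k"
    using walk q by (auto simp: is_walk_def)
  have tq: "translate t ! q = W ! j + nat_mult (Suc i) (last W) + t"
    unfolding translate_nth[OF assms] i_def j_def ..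
  show ?thesis
  proof (cases "Suc j = k")
    case False
    then have "Suc j < k"
      using q by simp
    moreover have "Suc q = i * k + Suc j"
      using q by simp
    moreover have "(i * k + r) div k = i" "(i * k + r) mod k = r" if "r < k" for r
      using that k_pos by simp_all
    ultimately have *: "Suc q div k = i" "Suc q mod k = Suc j"
      by metis+
    have "Suc q < p * k"
    proof -
      have "Suc q < Suc i * k"
        using \<open>Suc j < k\<close> q by simp
      also have "\<dots> \<le> p * k"
        using \<open>i < p\<close> by (intro mult_le_mono1) simp
      finally show ?thesis .
    qed
    then show ?thesis
      unfolding tq using translate_nth[of "Suc q" t] * step by (simp add: add.assoc j_def[symmetric])
  next
    case True
    have last: "last W = gs ! j + W ! j"
      using len step True by (metis diff_Suc_1 last_conv_nth list.size(3) nat.distinct(1))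
    have "Suc q = Suc i * k"
      using True q by simp
    have eq: "translate t ! (Suc q mod (p * k)) = last W + nat_mult (Suc i) (last W) + t"
    proof (cases "Suc i < p")
      case True
      then have "Suc q < p * k"
        using mult_less_mono1[OF True k_pos] \<open>Suc q = Suc i * k\<close> by (simp only:)
      then show ?thesis
        using translate_nth[of "Suc q" t] \<open>Suc q = Suc i * k\<close> W0 k_pos by (simp add: nat_mult_Suc)
    next
      case False
      then have "Suc i = p"
        using \<open>i < p\<close> by simp
      then have "Suc q mod (p * k) = 0" "0 < p * k"
        using \<open>Suc q = Suc i * k\<close> k_pos by simp_all
      \<comment> \<open>Copies are numbered from 1, so the circuit starts at
        \<open>last W + t\<close>, and it closes up because the multiple number \<open>p\<close>
        vanishes.\<close>
      moreover have "nat_mult (Suc i) (last W) = 0"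
        using nat_mult_period[OF fin] \<open>Suc i = p\<close> by simp
      ultimately show ?thesis
        using translate_nth[of 0 t] W0 by (simp add: nat_mult_def)
    qed
    then show ?thesis
      unfolding tq using last by (simp add: add.assoc j_def[symmetric])
  qed
qed

end

context vertex_rotation
begin

text \<open>The label of a step is the difference of its vertices. A label fixes the walk
  \<open>i\<close> and the place \<open>j\<close> in it; the copy and the translate are then fixed
  by the unique representation of \<open>- W i ! j + y\<close>.\<close>

lemma circuit_system_translates:
  fixes s :: int and W :: "nat \<Rightarrow> 'g list"
  assumes s: "s = 1 \<or> s = - 1"
    and nonempty: "\<And>i. i < l \<Longrightarrow> \<omega> i \<noteq> []"
    and position: "\<And>b. b \<in> E \<Longrightarrow> \<exists>!(i, j). i < l \<and> j < length (\<omega> i) \<and> \<omega> i ! j = b"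
    and walk: "\<And>i. i < l \<Longrightarrow> is_walk (W i) (map (\<lambda>a. if s = 1 then a else - a) (\<omega> i))"
    and fin: "\<And>i. i < l \<Longrightarrow> finite_period (last (W i))"
    and reps: "\<And>i. i < l \<Longrightarrow> representatives (last (W i)) (T i)"
    and turn: "\<And>i j. \<lbrakk>i < l; j < length (\<omega> i)\<rbrakk> \<Longrightarrow> \<exists>k. if s = 1
      then \<omega> i ! j = \<beta> k \<and> \<omega> i ! (Suc j mod length (\<omega> i)) = \<alpha> k
      else \<omega> i ! (Suc j mod length (\<omega> i)) = \<beta> k \<and> \<omega> i ! j = \<alpha> (k + 1)"
  shows "circuit_system s (\<Union>i<l. circuit_translates (W i) (T i))
    (\<lambda>w q. if s = 1 then w ! (Suc q mod length w) - w ! q else w ! q - w ! (Suc q mod length w))"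
    (is "circuit_system s ?C ?lab")
proof -
  define circ where "circ i t = map (\<lambda>y. y + t) (circuit_of_walk (W i))" for i t
  let ?k = "\<lambda>i. length (\<omega> i)" and ?p = "\<lambda>i. period (last (W i))"
  have closed: "closed_walk (W i) (map (\<lambda>a. if s = 1 then a else - a) (\<omega> i))" if "i < l" for i
    by (rule closed_walk.intro) (use that walk nonempty fin in simp_all)
  have len: "length (circ i t) = ?p i * ?k i" if "i < l" for i t
    unfolding circ_def using closed_walk.length_translate[OF closed[OF that]] by (simp only: length_map)
  have nth: "circ i t ! q = W i ! (q mod ?k i) + nat_mult (Suc (q div ?k i)) (last (W i)) + t"
    if "i < l" "q < ?p i * ?k i" for i t q
    unfolding circ_def using closed_walk.translate_nth[OF closed[OF that(1)]] that(2) by (simp only: length_map)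
  have k_pos: "0 < ?k i" if "i < l" for i
    using nonempty[OF that] by simp
  have step: "circ i t ! (Suc q mod length (circ i t)) =
      (if s = 1 then \<omega> i ! (q mod ?k i) else - \<omega> i ! (q mod ?k i)) + circ i t ! q"
    if "i < l" "q < ?p i * ?k i" for i t q
  proof -
    have "q mod ?k i < ?k i"
      using k_pos[OF that(1)] by simp
    then show ?thesis
      unfolding len[OF that(1)] unfolding circ_def
      using closed_walk.translate_step[OF closed[OF that(1)], of q t] that(2)
      by (simp only: length_map nth_map)
  qed
  have lab: "?lab (circ i t) q = \<omega> i ! (q mod ?k i)" if "i < l" "q < ?p i * ?k i" for i t q
  proof -
    have "b - (- a + b) = a" for a b :: 'g
      by (simp add: diff_conv_add_uminus minus_add add.assoc[symmetric] del: add_uminus_conv_diff)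
    then show ?thesis
      unfolding step[OF that] by simp
  qed
  have C: "w \<in> ?C \<longleftrightarrow> (\<exists>i<l. \<exists>t\<in>T i. w = circ i t)" for w
    by (auto simp: circuit_translates_def circ_def)
  show ?thesis
    unfolding circuit_system_def
  proof (intro conjI ballI allI impI)
    fix w
    assume "w \<in> ?C"
    then obtain i t where w: "i < l" "t \<in> T i" "w = circ i t"
      unfolding C by blast
    have p_pos: "0 < ?p i"
      using nat_mult_period[OF fin[OF w(1)]] by simp
    show "w \<noteq> []"
      using len[OF w(1), of t] k_pos[OF w(1)] p_pos unfolding w(3) by auto
    fix q
    assume "q < length w"
    then have q: "q < ?p i * ?k i"
      using len[OF w(1)] w(3) by simp
    show "w ! (Suc q mod length w) = (if s = 1 then ?lab w q else - ?lab w q) + w ! q"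
      unfolding w(3) lab[OF w(1) q] by (rule step[OF w(1) q])
    have "Suc q mod length w < ?p i * ?k i"
      unfolding w(3) len[OF w(1)] using p_pos k_pos[OF w(1)] by simp
    then have "?lab w (Suc q mod length w) = \<omega> i ! (Suc q mod length w mod ?k i)"
      unfolding w(3) by (rule lab[OF w(1)])
    also have "Suc q mod length w mod ?k i = Suc (q mod ?k i) mod ?k i"
      unfolding w(3) len[OF w(1)] by (simp add: mod_mod_cancel mod_Suc_eq)
    finally have next_lab: "?lab w (Suc q mod length w) = \<omega> i ! (Suc (q mod ?k i) mod ?k i)" .
    show "\<exists>k. if s = 1 then ?lab w q = \<beta> k \<and> ?lab w (Suc q mod length w) = \<alpha> k
        else ?lab w (Suc q mod length w) = \<beta> k \<and> ?lab w q = \<alpha> (k + 1)"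
      unfolding next_lab unfolding w(3) lab[OF w(1) q]
      by (rule turn[OF w(1)]) (use k_pos[OF w(1)] in simp)
  next
    fix y b
    assume "b \<in> E"
    obtain i j where "(i < l \<and> j < ?k i \<and> \<omega> i ! j = b) \<and>
        (\<forall>i' j'. i' < l \<and> j' < ?k i' \<and> \<omega> i' ! j' = b \<longrightarrow> i' = i \<and> j' = j)"
      using Ex1_pairD[OF position[OF \<open>b \<in> E\<close>]] by blast
    then have ij: "i < l" "j < ?k i" "\<omega> i ! j = b"
      and ij_unique: "\<And>i' j'. \<lbrakk>i' < l; j' < ?k i'; \<omega> i' ! j' = b\<rbrakk> \<Longrightarrow> i' = i \<and> j' = j"
      by simp_all
    have "\<exists>!(r, t). 1 \<le> r \<and> r \<le> ?p i \<and> t \<in> T i \<and> - W i ! j + y = nat_mult r (last (W i)) + t"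
      using reps[OF ij(1)] unfolding representatives_def by (rule spec)
    from Ex1_pairD[OF this] obtain r t where
      "(1 \<le> r \<and> r \<le> ?p i \<and> t \<in> T i \<and> - W i ! j + y = nat_mult r (last (W i)) + t) \<and>
        (\<forall>r' t'. 1 \<le> r' \<and> r' \<le> ?p i \<and> t' \<in> T i \<and> - W i ! j + y = nat_mult r' (last (W i)) + t' \<longrightarrow>
          r' = r \<and> t' = t)"
      by (elim exE)
    then have rt: "1 \<le> r" "r \<le> ?p i" "t \<in> T i" "- W i ! j + y = nat_mult r (last (W i)) + t"
      and rt_unique: "\<And>r' t'. \<lbrakk>1 \<le> r'; r' \<le> ?p i; t' \<in> T i; - W i ! j + y = nat_mult r' (last (W i)) + t'\<rbrakk>
        \<Longrightarrow> r' = r \<and> t' = t"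
      by blast+
    have vertex: "circ i t' ! q = y \<longleftrightarrow> - W i ! j + y = nat_mult (Suc (q div ?k i)) (last (W i)) + t'"
      if "q < ?p i * ?k i" "q mod ?k i = j" for q t'
      unfolding nth[OF ij(1) that(1)] that(2)
      by (rule add_eq_iff_minus_add)
    \<comment> \<open>Copies are counted from 1, positions from 0.\<close>
    define q where "q = (r - 1) * ?k i + j"
    have q: "q div ?k i = r - 1" "q mod ?k i = j"
      using ij(2) k_pos[OF ij(1)] by (simp_all add: q_def)
    have "q < r * ?k i"
      using rt(1) ij(2) by (cases r) (simp_all add: q_def)
    also have "\<dots> \<le> ?p i * ?k i"
      using rt(2) by (rule mult_le_mono1)
    finally have q_less: "q < ?p i * ?k i" .
    show "\<exists>!(w, j). w \<in> ?C \<and> j < length w \<and> w ! j = y \<and> ?lab w j = b"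
    proof (rule ex1I[of _ "(circ i t, q)"])
      show "case (circ i t, q) of (w, j) \<Rightarrow> w \<in> ?C \<and> j < length w \<and> w ! j = y \<and> ?lab w j = b"
        unfolding prod.case
      proof (intro conjI)
        show "circ i t \<in> ?C"
          unfolding C using ij(1) rt(3) by blast
        show "q < length (circ i t)"
          unfolding len[OF ij(1)] by (rule q_less)
        have "Suc (r - 1) = r"
          using rt(1) by simp
        then show "circ i t ! q = y"
          unfolding vertex[OF q_less q(2)] q(1) using rt(4) by (simp only:)
        show "?lab (circ i t) q = b"
          unfolding lab[OF ij(1) q_less] q(2) by (rule ij(3))
      qed
      fix z
      assume "case z of (w, j) \<Rightarrow> w \<in> ?C \<and> j < length w \<and> w ! j = y \<and> ?lab w j = b"
      then obtain w' q' where z: "z = (w', q')" "w' \<in> ?C" "q' < length w'" "w' ! q' = y" "?lab w' q' = b"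
        by (cases z) simp
      then obtain i' t' where w': "i' < l" "t' \<in> T i'" "w' = circ i' t'"
        unfolding C by blast
      have q': "q' < ?p i' * ?k i'"
        using z(3) len[OF w'(1)] w'(3) by simp
      have "i' = i \<and> q' mod ?k i' = j"
      proof (rule ij_unique[OF w'(1)])
        show "q' mod ?k i' < ?k i'"
          using k_pos[OF w'(1)] by simp
        show "\<omega> i' ! (q' mod ?k i') = b"
          using z(5) unfolding w'(3) lab[OF w'(1) q'] .
      qed
      then have i': "i' = i" "q' mod ?k i = j"
        by auto
      have "Suc (q' div ?k i) \<le> ?p i"
        using q' i'(1) by (simp add: Suc_le_eq less_mult_imp_div_less)
      moreover have "- W i ! j + y = nat_mult (Suc (q' div ?k i)) (last (W i)) + t'"
        using vertex[of q' t'] q' i' w'(3) z(4) by (simp only:)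
      moreover have "1 \<le> Suc (q' div ?k i)" "t' \<in> T i"
        using w'(2) i'(1) by simp_all
      ultimately have "Suc (q' div ?k i) = r" "t' = t"
        using rt_unique by blast+
      then have "q' = q"
        using i'(2) div_mult_mod_eq[of q' "?k i"] unfolding q_def by (metis diff_Suc_1)
      then show "z = (circ i t, q)"
        using z(1) w'(3) i'(1) \<open>t' = t\<close> by simp
    qed
  qed
qed

end

section \<open>Rows and columns of the array\<close>

lemma funpow_mod_eq_self:
  assumes "(f ^^ n) x = x"
  shows "(f ^^ (m mod n)) x = (f ^^ m) x"
proof -
  have "(f ^^ (n * q)) x = x" for q
    using assms by (induction q) (simp_all add: funpow_add)
  then have "(f ^^ (m mod n + n * (m div n))) x = (f ^^ (m mod n)) x"
    unfolding funpow_add by simp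
  then show ?thesis
    by simp
qed

text \<open>The labels of the outgoing edges around a vertex, counterclockwise, are the successive images of
  one label under the inverse of \<open>\<sigma>\<close>.\<close>

lemma cyclic_on_enumeration:
  assumes "cyclic_on \<sigma> E"
  obtains N :: nat and \<alpha> :: "int \<Rightarrow> 'a" where "0 < N" "range \<alpha> = E"
    "\<And>k l. \<alpha> k = \<alpha> l \<longleftrightarrow> [k = l] (mod int N)" "\<And>k. \<sigma> (\<alpha> (k + 1)) = \<alpha> k"
proof -
  obtain x where x: "x \<in> E" "E = orbit \<sigma> x"
    using assms by (auto simp: cyclic_on_def)
  define N where "N = funpow_dist1 \<sigma> x x"
  have N: "0 < N" "(\<sigma> ^^ N) x = x" "E = (\<lambda>n. (\<sigma> ^^ n) x) ` {0..<N}" "inj_on (\<lambda>n. (\<sigma> ^^ n) x) {0..<N}"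
    using x funpow_dist1_prop[of x \<sigma> x] orbit_conv_funpow_dist1[of x \<sigma>] inj_on_funpow_dist1[of x \<sigma> x]
    unfolding N_def by simp_all
  define e where "e k = nat (- k mod int N)" for k
  have e: "e k < N" for k
    using N(1) by (simp add: e_def nat_less_iff)
  define \<alpha> where "\<alpha> k = (\<sigma> ^^ e k) x" for k
  have e_eq: "e k = e l \<longleftrightarrow> [k = l] (mod int N)" for k l
  proof -
    have "e k = e l \<longleftrightarrow> - k mod int N = - l mod int N"
      using N(1) by (simp add: e_def eq_nat_nat_iff)
    also have "\<dots> \<longleftrightarrow> [k = l] (mod int N)"
      using cong_minus_minus_iff[of k l "int N"] by (simp add: cong_def)
    finally show ?thesis .
  qed
  show ?thesis
  proof (rule that[of N \<alpha>])
    show "0 < N"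
      by (rule N(1))
    show "range \<alpha> = E"
    proof
      show "range \<alpha> \<subseteq> E"
        using e by (auto simp: \<alpha>_def N(3))
      show "E \<subseteq> range \<alpha>"
      proof
        fix y
        assume "y \<in> E"
        then obtain n where n: "n < N" "y = (\<sigma> ^^ n) x"
          unfolding N(3) by auto
        then have "e (- int n) = n"
          by (simp add: e_def)
        then show "y \<in> range \<alpha>"
          using n by (intro range_eqI[of _ _ "- int n"]) (simp add: \<alpha>_def)
      qed
    qed
    show "\<alpha> k = \<alpha> l \<longleftrightarrow> [k = l] (mod int N)" for k l
    proof -
      have "\<alpha> k = \<alpha> l \<longleftrightarrow> e k = e l"
        unfolding \<alpha>_def using inj_on_eq_iff[OF N(4)] e by simp
      then show ?thesis
        unfolding e_eq .
    qed
    show "\<sigma> (\<alpha> (k + 1)) = \<alpha> k" for k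
    proof -
      have "e k = Suc (e (k + 1)) mod N"
        using nat_mod_Suc[OF N(1), of "- (k + 1)"] by (simp add: e_def)
      then show ?thesis
        using funpow_mod_eq_self[OF N(2), of "Suc (e (k + 1))"] by (simp add: \<alpha>_def)
    qed
  qed
qed

text \<open>Parity: an involution of \<open>S\<close> would be counted once on the right of the
  multiset equation but an even number of times on the left.\<close>

lemma GHA_involutions:
  assumes "GHA nrm S m n h k H"
  shows "involutions S = {}"
proof (rule ccontr)
  assume "involutions S \<noteq> {}"
  then obtain x where x: "x \<in> involutions S"
    by blast
  have "finite S"
    using assms by (simp add: GHA_def)
  then have fin: "finite (involutions S)" "finite (S - involutions S)"
    by (auto simp: involutions_def)
  have "repeat_mset 2 (image_mset nrm (entries m n H)) =
      repeat_mset 2 (mset_set (S - involutions S)) + mset_set (involutions S)"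
    using assms by (simp add: GHA_def)
  from arg_cong[OF this, of "\<lambda>M. count M x"] have "2 * count (image_mset nrm (entries m n H)) x = 1"
    using x fin by simp
  then show False
    by presburger
qed

definition positions :: "nat \<Rightarrow> nat \<Rightarrow> (nat \<Rightarrow> nat \<Rightarrow> 'g::group_add) \<Rightarrow> (nat \<times> nat) set" where
  "positions m n H = {(i, j). i < m \<and> j < n \<and> H i j \<noteq> 0}"

lemma finite_positions: "finite (positions m n H)"
  by (rule finite_subset[of _ "{..<m} \<times> {..<n}"]) (auto simp: positions_def)

lemma entries_positions: "entries m n H = image_mset (\<lambda>(i, j). H i j) (mset_set (positions m n H))"
  by (simp add: entries_def positions_def)

lemma set_entries: "set_mset (entries m n H) = (\<lambda>(i, j). H i j) ` positions m n H"
  by (simp add: entries_positions finite_positions)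

text \<open>Without involutions the doubled equation can be halved, and its right side then has no
  repetitions.\<close>

lemma GHA_abs_entries:
  assumes "GHA nrm S m n h k H"
  shows "inj_on (\<lambda>(i, j). nrm (H i j)) (positions m n H)"
    and "(\<lambda>(i, j). nrm (H i j)) ` positions m n H = S"
proof -
  have "repeat_mset 2 (image_mset nrm (entries m n H)) = repeat_mset 2 (mset_set S)"
    using assms GHA_involutions[OF assms] by (simp add: GHA_def)
  then have "image_mset nrm (entries m n H) = mset_set S"
    by (simp add: multiset_eq_iff)
  moreover have "nrm \<circ> (\<lambda>(i, j). H i j) = (\<lambda>(i, j). nrm (H i j))"
    by auto
  ultimately have eq: "image_mset (\<lambda>(i, j). nrm (H i j)) (mset_set (positions m n H)) = mset_set S"
    unfolding entries_positions by (simp add: multiset.map_comp)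
  have "finite S"
    using assms by (simp add: GHA_def)
  then show "inj_on (\<lambda>(i, j). nrm (H i j)) (positions m n H)"
    "(\<lambda>(i, j). nrm (H i j)) ` positions m n H = S"
    using inj_on_of_image_mset_eq_mset_set[OF eq finite_positions] by simp_all
qed

text \<open>\<open>a\<close> and \<open>- a\<close> have the same absolute value and hence sit in
  the same cell; then \<open>a\<close> equals its negative and is an involution in
  \<open>S\<close>.\<close>

lemma GHA_minus_notin_entries:
  assumes nrm: "absolute_value nrm" and gha: "GHA nrm S m n h k H" and "a \<in> set_mset (entries m n H)"
  shows "- a \<notin> set_mset (entries m n H)"
proof
  assume "- a \<in> set_mset (entries m n H)"
  then obtain i j i' j' where pos: "(i, j) \<in> positions m n H" "H i j = a"
    "(i', j') \<in> positions m n H" "H i' j' = - a"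
    using assms(3) unfolding set_entries by auto
  have "nrm (- a) = nrm a" and nrm_a: "nrm a \<in> {a, - a}"
    using nrm unfolding absolute_value_def by metis+
  then have "(i, j) = (i', j')"
    using inj_onD[OF GHA_abs_entries(1)[OF gha], of "(i, j)" "(i', j')"] pos by simp
  then have "- a = a"
    using pos by simp
  then have "a + a = 0"
    by (metis add.right_inverse)
  moreover have "a \<in> S"
    using GHA_abs_entries(2)[OF gha] pos nrm_a \<open>- a = a\<close> by force
  moreover have "a \<noteq> 0"
    using pos by (auto simp: positions_def)
  ultimately show False
    using GHA_involutions[OF gha] by (auto simp: involutions_def)
qed

text \<open>Replacing \<open>d\<close> by \<open>- d\<close> reads the same edges from their other
  ends.\<close>

lemma cayley_edges_abs:
  assumes nrm: "absolute_value nrm"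
  shows "cayley_edges (nrm ` E) = cayley_edges E"
proof -
  have flip: "{y, - d + y} \<in> cayley_edges A" if "d \<in> A" for y d :: 'a and A
  proof -
    have "{- d + y, d + (- d + y)} \<in> cayley_edges A"
      unfolding cayley_edges_def mem_Collect_eq by (intro exI conjI) (rule refl, rule that)
    then show ?thesis
      by (simp add: insert_commute)
  qed
  have edge: "{y, d + y} \<in> cayley_edges A" if "d \<in> A" for y d :: 'a and A
    unfolding cayley_edges_def mem_Collect_eq by (intro exI conjI) (rule refl, rule that)
  have abs: "nrm d = d \<or> nrm d = - d" for d
    using nrm unfolding absolute_value_def by blast
  show ?thesis
  proof (intro set_eqI iffI)
    fix e
    assume "e \<in> cayley_edges (nrm ` E)"
    then obtain y d where "e = {y, nrm d + y}" "d \<in> E"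
      unfolding cayley_edges_def by blast
    then show "e \<in> cayley_edges E"
      using abs[of d] edge[of d E y] flip[of d E y] by auto
  next
    fix e
    assume "e \<in> cayley_edges E"
    then obtain y d where d: "e = {y, d + y}" "d \<in> E"
      unfolding cayley_edges_def by blast
    then have "nrm d \<in> nrm ` E"
      by blast
    then show "e \<in> cayley_edges (nrm ` E)"
      using abs[of d] edge[of "nrm d" "nrm ` E" y] flip[of "nrm d" "nrm ` E" y] d(1) by (metis minus_minus)
  qed
qed

text \<open>The rows and the columns are treated alike as the fibres of a coordinate \<open>f\<close> of the positions.\<close>

lemma fibre_lists:
  assumes fin: "finite P" and inj: "inj_on g P"
    and f: "\<forall>p\<in>P. f p < l"
    and \<omega>: "\<forall>i<l. mset (\<omega> i) = image_mset g (mset_set {p \<in> P. f p = i})"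
  shows "i < l \<Longrightarrow> distinct (\<omega> i)" and "(\<Union>i<l. set (\<omega> i)) = g ` P"
    and "\<lbrakk>i < l; j < l; i \<noteq> j\<rbrakk> \<Longrightarrow> set (\<omega> i) \<inter> set (\<omega> j) = {}"
proof -
  have list: "distinct (\<omega> i)" "set (\<omega> i) = g ` {p \<in> P. f p = i}" if "i < l" for i
    using mset_eq_image_mset_set[OF \<omega>[rule_format, OF that]] fin inj_on_subset[OF inj] by auto
  then show "i < l \<Longrightarrow> distinct (\<omega> i)"
    by blast
  show "(\<Union>i<l. set (\<omega> i)) = g ` P"
    using list(2) f by fastforce
  show "\<lbrakk>i < l; j < l; i \<noteq> j\<rbrakk> \<Longrightarrow> set (\<omega> i) \<inter> set (\<omega> j) = {}"
    using list(2) inj by (auto simp: inj_on_def)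
qed

lemma list_positions_unique:
  assumes "\<And>i. i < l \<Longrightarrow> distinct (\<omega> i)"
    and "\<And>i j. \<lbrakk>i < l; j < l; i \<noteq> j\<rbrakk> \<Longrightarrow> set (\<omega> i) \<inter> set (\<omega> j) = {}"
    and "b \<in> (\<Union>i<l. set (\<omega> i))"
  shows "\<exists>!(i, j). i < l \<and> j < length (\<omega> i) \<and> \<omega> i ! j = b"
proof -
  obtain i j where ij: "i < l" "j < length (\<omega> i)" "\<omega> i ! j = b"
    using assms(3) by (auto simp: in_set_conv_nth)
  show ?thesis
  proof (rule ex1I[of _ "(i, j)"])
    fix z
    assume "case z of (i, j) \<Rightarrow> i < l \<and> j < length (\<omega> i) \<and> \<omega> i ! j = b"
    then obtain i' j' where z: "z = (i', j')" "i' < l" "j' < length (\<omega> i')" "\<omega> i' ! j' = b"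
      by (cases z) simp
    have "b \<in> set (\<omega> i) \<inter> set (\<omega> i')"
      using nth_mem[OF ij(2)] nth_mem[OF z(3)] ij(3) z(4) by simp
    then have "i' = i"
      using assms(2)[OF ij(1) z(2)] by auto
    then show "z = (i, j)"
      using z ij nth_eq_iff_index_eq[OF assms(1)[OF ij(1)]] by auto
  qed (use ij in simp)
qed

lemma ordering_perm_nth:
  assumes "\<And>i. i < l \<Longrightarrow> distinct (\<omega> i)"
    and "\<And>i j. \<lbrakk>i < l; j < l; i \<noteq> j\<rbrakk> \<Longrightarrow> set (\<omega> i) \<inter> set (\<omega> j) = {}"
    and "i < l" "j < length (\<omega> i)"
  shows "ordering_perm l \<omega> (\<omega> i ! j) = \<omega> i ! (Suc j mod length (\<omega> i))"
  using ordering_perm_eq_cycle[OF assms(2,3), where x = "\<omega> i ! j"] cycle_of_list_nth[OF assms(1)[OF assms(3)] assms(4)]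
    assms(4) by simp

theorem theorem7p4:
  fixes nrm :: "'g::group_add \<Rightarrow> 'g"
    and S :: "'g set"
    and m n :: nat
    and h k :: "nat \<Rightarrow> nat"
    and H :: "nat \<Rightarrow> nat \<Rightarrow> 'g"
    and \<omega>r \<omega>c :: "nat \<Rightarrow> 'g list"
    and Tr Tc :: "nat \<Rightarrow> 'g set"
  assumes "absolute_value nrm"
    and "GHA nrm S m n h k H"
    and "compatible_ordering m n H \<omega>r \<omega>c"
    and "\<And>i. i < m \<Longrightarrow> finite_period (last (walk_plus (\<omega>r i)))"
    and "\<And>j. j < n \<Longrightarrow> finite_period (last (walk_minus (rev (\<omega>c j))))"
    and "\<And>i. i < m \<Longrightarrow> representatives (last (walk_plus (\<omega>r i))) (Tr i)"
    and "\<And>j. j < n \<Longrightarrow> representatives (last (walk_minus (rev (\<omega>c j)))) (Tc j)"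
  shows "\<exists>(\<Sigma> :: ('g \<times> nat \<times> complex) set topology) (\<phi> :: ('g \<Rightarrow> real) \<Rightarrow> ('g \<times> nat \<times> complex) set).
    surface \<Sigma> \<and> orientable \<Sigma> \<and>
    biembedding UNIV (cayley_edges S)
      (\<Union>i<m. circuit_translates (walk_plus (\<omega>r i)) (Tr i))
      (\<Union>j<n. circuit_translates (walk_minus (rev (\<omega>c j))) (Tc j))
      \<Sigma> \<phi>"
proof -
  note nrm = assms(1) and gha = assms(2)
  define E where "E = set_mset (entries m n H)"
  let ?P = "positions m n H" and ?H = "\<lambda>(i, j). H i j"
  have E: "E = ?H ` ?P"
    unfolding E_def set_entries ..
  have S: "S = nrm ` E"
    using GHA_abs_entries(2)[OF gha] by (simp add: E image_image split_def)
  have inj_H: "inj_on ?H ?P"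
  proof (rule inj_onI)
    fix p q
    assume "p \<in> ?P" "q \<in> ?P" "?H p = ?H q"
    then show "p = q"
      using inj_onD[OF GHA_abs_entries(1)[OF gha], of p q] by (simp add: split_def)
  qed
  have rows: "\<forall>i<m. mset (\<omega>r i) = image_mset ?H (mset_set {p \<in> ?P. fst p = i})"
  proof (intro allI impI)
    fix i
    assume less: "i < m"
    have "mset (\<omega>r i) = image_mset (H i) (mset_set {j. j < n \<and> H i j \<noteq> 0})"
      using assms(3) less by (simp add: compatible_ordering_def GHA_ordering_def row_entries_def)
    also have "\<dots> = image_mset ?H (image_mset (Pair i) (mset_set {j. j < n \<and> H i j \<noteq> 0}))"
      by (simp add: multiset.map_comp comp_def)
    also have "image_mset (Pair i) (mset_set {j. j < n \<and> H i j \<noteq> 0}) = mset_set (Pair i ` {j. j < n \<and> H i j \<noteq> 0})"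
      by (rule image_mset_mset_set) (simp add: inj_on_def)
    also have "Pair i ` {j. j < n \<and> H i j \<noteq> 0} = {p \<in> ?P. fst p = i}"
      using less by (auto simp: positions_def)
    finally show "mset (\<omega>r i) = image_mset ?H (mset_set {p \<in> ?P. fst p = i})" .
  qed
  have cols: "\<forall>j<n. mset (\<omega>c j) = image_mset ?H (mset_set {p \<in> ?P. snd p = j})"
  proof (intro allI impI)
    fix j
    assume less: "j < n"
    have "mset (\<omega>c j) = image_mset (\<lambda>i. H i j) (mset_set {i. i < m \<and> H i j \<noteq> 0})"
      using assms(3) less by (simp add: compatible_ordering_def GHA_ordering_def col_entries_def)
    also have "\<dots> = image_mset ?H (image_mset (\<lambda>i. (i, j)) (mset_set {i. i < m \<and> H i j \<noteq> 0}))"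
      by (simp add: multiset.map_comp comp_def)
    also have "image_mset (\<lambda>i. (i, j)) (mset_set {i. i < m \<and> H i j \<noteq> 0}) =
        mset_set ((\<lambda>i. (i, j)) ` {i. i < m \<and> H i j \<noteq> 0})"
      by (rule image_mset_mset_set) (simp add: inj_on_def)
    also have "(\<lambda>i. (i, j)) ` {i. i < m \<and> H i j \<noteq> 0} = {p \<in> ?P. snd p = j}"
      using less by (auto simp: positions_def)
    finally show "mset (\<omega>c j) = image_mset ?H (mset_set {p \<in> ?P. snd p = j})" .
  qed
  have coords: "\<forall>p\<in>?P. fst p < m" "\<forall>p\<in>?P. snd p < n"
    by (auto simp: positions_def)
  note row = fibre_lists[where f = fst and \<omega> = \<omega>r, OF finite_positions inj_H coords(1) rows]
    and col = fibre_lists[where f = snd and \<omega> = \<omega>c, OF finite_positions inj_H coords(2) cols]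
  have row_nonempty: "\<omega>r i \<noteq> []" if "i < m" for i
  proof -
    have "1 \<le> size (row_entries n H i)"
      using gha that by (simp add: GHA_def)
    moreover have "mset (\<omega>r i) = row_entries n H i"
      using assms(3) that by (simp add: compatible_ordering_def GHA_ordering_def)
    ultimately show ?thesis
      by auto
  qed
  have col_nonempty: "\<omega>c j \<noteq> []" if "j < n" for j
  proof -
    have "1 \<le> size (col_entries m H j)"
      using gha that by (simp add: GHA_def)
    moreover have "mset (\<omega>c j) = col_entries m H j"
      using assms(3) that by (simp add: compatible_ordering_def GHA_ordering_def)
    ultimately show ?thesis
      by auto
  qed
  define \<rho> where "\<rho> = ordering_perm m \<omega>r"
  define \<gamma> where "\<gamma> = ordering_perm n \<omega>c"
  have \<rho>: "\<rho> permutes E"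
    unfolding \<rho>_def E row(2)[symmetric] by (rule ordering_perm_permutes)
  have "cyclic_on (\<gamma> \<circ> \<rho>) E"
    using assms(3) by (simp add: compatible_ordering_def E_def \<rho>_def \<gamma>_def)
  then obtain N :: nat and \<alpha> :: "int \<Rightarrow> 'g" where \<alpha>: "0 < N" "range \<alpha> = E"
    "\<And>k l. \<alpha> k = \<alpha> l \<longleftrightarrow> [k = l] (mod int N)" "\<And>k. (\<gamma> \<circ> \<rho>) (\<alpha> (k + 1)) = \<alpha> k"
    by (rule cyclic_on_enumeration) (rule that)
  \<comment> \<open>The row circuit arrives backwards on the outgoing edge
    \<open>\<alpha> (k + 1)\<close> and leaves backwards on the incoming edge labelled by the image
    under \<open>\<rho>\<close>, which therefore precedes \<open>\<alpha> (k + 1)\<close> in the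
    rotation.\<close>
  define \<beta> where "\<beta> k = \<rho> (\<alpha> (k + 1))" for k
  have \<gamma>\<beta>: "\<gamma> (\<beta> k) = \<alpha> k" for k
    using \<alpha>(4)[of k] by (simp add: \<beta>_def)
  have "finite E"
    by (simp add: E_def)
  \<comment> \<open>Labels are coded by numbers to fit into the second component of the point
    type.\<close>
  then obtain idx :: "'g \<Rightarrow> nat" where "inj_on idx E"
    using finite_imp_inj_to_nat_seg by blast
  have range_\<beta>: "range \<beta> = E"
  proof -
    have "range \<beta> = \<rho> ` \<alpha> ` range (\<lambda>k. k + 1)"
      by (auto simp only: \<beta>_def image_image)
    also have "range (\<lambda>k :: int. k + 1) = UNIV"
      by (metis diff_add_cancel surjI)
    finally show ?thesis
      using \<alpha>(2) permutes_image[OF \<rho>] by simp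
  qed
  interpret vertex_rotation N E \<alpha> \<beta> idx
  proof
    show "\<beta> k = \<beta> l \<longleftrightarrow> [k = l] (mod int N)" for k l
      using permutes_inj[OF \<rho>] \<alpha>(3)[of "k + 1" "l + 1"] cong_add_rcancel[of k 1 l "int N"]
      by (simp add: \<beta>_def inj_eq)
    show "- a \<notin> E" if "a \<in> E" for a
      using GHA_minus_notin_entries[OF nrm gha] that by (simp add: E_def)
  qed (use \<alpha> range_\<beta> \<open>inj_on idx E\<close> in auto)
  \<comment> \<open>Columns traverse edges forwards and bound the upper half-cylinders, rows
    traverse them backwards and bound the lower ones.\<close>
  let ?C = "\<lambda>s :: int. if s = 1 then \<Union>j<n. circuit_translates (walk_minus (rev (\<omega>c j))) (Tc j)
    else \<Union>i<m. circuit_translates (walk_plus (\<omega>r i)) (Tr i)"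
  let ?lab = "\<lambda>(s :: int) (w :: 'g list) q. if s = 1 then w ! (Suc q mod length w) - w ! q
    else w ! q - w ! (Suc q mod length w)"
  have up: "circuit_system 1 (?C 1) (?lab 1)"
  proof -
    have "circuit_system 1 (\<Union>j<n. circuit_translates (walk_minus (rev (\<omega>c j))) (Tc j)) (?lab 1)"
    proof (rule circuit_system_translates)
      show "\<exists>!(i, j). i < n \<and> j < length (\<omega>c i) \<and> \<omega>c i ! j = b" if "b \<in> E" for b
        using that list_positions_unique[where l = n and \<omega> = \<omega>c, OF col(1,3)] by (simp add: col(2) E)
      show "is_walk (walk_minus (rev (\<omega>c i))) (map (\<lambda>a. if 1 = (1 :: int) then a else - a) (\<omega>c i))" for i
        using is_walk_walk_minus by simp
      fix i j
      assume ij: "i < n" "j < length (\<omega>c i)"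
      then have "\<omega>c i ! j \<in> E"
        using col(2) nth_mem E by blast
      then obtain k where "\<omega>c i ! j = \<beta> k"
        using range_\<beta> by blast
      moreover from this have "\<omega>c i ! (Suc j mod length (\<omega>c i)) = \<alpha> k"
        using ordering_perm_nth[where l = n and \<omega> = \<omega>c, OF col(1,3) ij] \<gamma>\<beta> by (simp add: \<gamma>_def)
      ultimately show "\<exists>k. if 1 = (1 :: int) then \<omega>c i ! j = \<beta> k \<and> \<omega>c i ! (Suc j mod length (\<omega>c i)) = \<alpha> k
          else \<omega>c i ! (Suc j mod length (\<omega>c i)) = \<beta> k \<and> \<omega>c i ! j = \<alpha> (k + 1)"
        by auto
    qed (use col_nonempty assms(5,7) in auto)
    then show ?thesis
      by simp
  qed
  have down: "circuit_system (- 1) (?C (- 1)) (?lab (- 1))"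
  proof -
    have "circuit_system (- 1) (\<Union>i<m. circuit_translates (walk_plus (\<omega>r i)) (Tr i)) (?lab (- 1))"
    proof (rule circuit_system_translates)
      show "\<exists>!(i, j). i < m \<and> j < length (\<omega>r i) \<and> \<omega>r i ! j = b" if "b \<in> E" for b
        using that list_positions_unique[where l = m and \<omega> = \<omega>r, OF row(1,3)] by (simp add: row(2) E)
      show "is_walk (walk_plus (\<omega>r i)) (map (\<lambda>a. if - 1 = (1 :: int) then a else - a) (\<omega>r i))" for i
        using is_walk_walk_plus[of "\<omega>r i"] by simp
      fix i j
      assume ij: "i < m" "j < length (\<omega>r i)"
      then have "\<omega>r i ! j \<in> E"
        using row(2) nth_mem E by blast
      then obtain l where "\<omega>r i ! j = \<alpha> l"
        using \<alpha>(2) by blast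
      \<comment> \<open>Row turns start from \<open>\<alpha> (k + 1)\<close>, so the index of the
        turn is \<open>l - 1\<close>.\<close>
      then have "\<omega>r i ! j = \<alpha> (l - 1 + 1)"
        by simp
      moreover from this have "\<omega>r i ! (Suc j mod length (\<omega>r i)) = \<beta> (l - 1)"
        using ordering_perm_nth[where l = m and \<omega> = \<omega>r, OF row(1,3) ij] unfolding \<beta>_def by (simp add: \<rho>_def)
      ultimately show "\<exists>k. if - 1 = (1 :: int) then \<omega>r i ! j = \<beta> k \<and> \<omega>r i ! (Suc j mod length (\<omega>r i)) = \<alpha> k
          else \<omega>r i ! (Suc j mod length (\<omega>r i)) = \<beta> k \<and> \<omega>r i ! j = \<alpha> (k + 1)"
        by auto
    qed (use row_nonempty assms(4,6) in auto)
    then show ?thesis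
      by simp
  qed
  interpret two_sided_circuits N E \<alpha> \<beta> idx ?C ?lab
    by unfold_locales (use up down in blast)
  have "cayley_edges S = cayley_edges E"
    unfolding S by (rule cayley_edges_abs[OF nrm])
  then have "biembedding UNIV (cayley_edges S) (?C (- 1)) (?C 1) glued embed"
    using biembedding_embed by simp
  then show ?thesis
    using surface_glued orientable_glued by (intro exI[of _ glued] exI[of _ embed]) simp
qed

end
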